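(* Fix $\alpha\in(0,1)$. For all $\ell\in\mathbb{N}=\{1,2,\dots\}$, the bifurcation of the equation $\bar{\mathcal{G}}(\tilde\rho,\lambda)=0$ at $(0,\ell)$, with bifurcating branch $(\tilde\rho_\ell(s),\lambda_\ell(s))$, $s\in(-\delta_\ell,\delta_\ell)$, is a subcritical pitchfork type bifurcation. More precisely, $$\dot\lambda_\ell(0)=0\qquad\text{and}\qquad\ddot\lambda_\ell(0)<0,$$ where the dot denotes the derivative with respect to the parameter $s$. Moreover, the perturbed eigenvalues $\hat\mu_\ell(s)$ are strictly positive for $|s|>0$ chosen sufficiently small.
   Context: $\mathbb{T}=[-\pi,\pi]$ with endpoints identified. $h^{k+\alpha}(\mathbb{T})$ is the little-Hölder space of real $f\in C^{k+\alpha}(\mathbb{T})$ with $\lim_{\delta\to0}\sup_{0<d(x,y)<\delta}|f^{(k)}(x)-f^{(k)}(y)|/d(x,y)^\alpha=0$ ($d$ the metric of the circle of length $2\pi$), with the $C^{k+\alpha}$ norm. $P_0\rho=\rho-\frac1{2\pi}\int_{\mathbb{T}}\rho\,dx$, $h^\sigma_0(\mathbb{T})=P_0h^\sigma(\mathbb{T})$ (mean-zero functions), and $h^{4+\alpha}_{0,\mathrm{even}}(\mathbb{T})$ is the subspace of even functions in $h^{4+\alpha}_0(\mathbb{T})$. For positive $r\in h^{4+\alpha}(\mathbb{T})$, $$G(r)=\frac1r\,\partial_x\Big[\frac{r}{\sqrt{1+r_x^2}}\,\partial_x\mathcal{H}(r)\Big],\qquad \mathcal{H}(r)=\frac{1}{r\sqrt{1+r_x^2}}-\frac{r_{xx}}{(1+r_x^2)^{3/2}}.$$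 Lifting map: for $\lambda>0$ put $r_\star=1/\lambda$ and $F_\star(\rho)=\int_{\mathbb{T}}(\rho+r_\star)^2dx$. By the implicit function theorem, for $\tilde\rho$ in a neighborhood of $0$ in $h^{\alpha}_0(\mathbb{T})$ there is a unique $\psi(\tilde\rho)$ in a neighborhood of $0$ in $h^{\alpha}(\mathbb{T})$ with $P_0\psi(\tilde\rho)=\tilde\rho$ and $F_\star(\psi(\tilde\rho))=F_\star(0)$; $\psi$ is real analytic with $\psi(0)=0$, depends on $\lambda$, preserves the regularity of $\tilde\rho$, and the neighborhood is taken small enough that $\psi(\tilde\rho)>-r_\star$ on $\mathbb{T}$. The bifurcation function is $\bar{\mathcal{G}}(\tilde\rho,\lambda):=P_0\,G(\psi(\tilde\rho)+1/\lambda)$, for $\lambda\in(0,\infty)$ and $\tilde\rho$ near $0$ in $h^{4+\alpha}_{0,\mathrm{even}}(\mathbb{T})$. Branch: for each $\ell\in\mathbb{N}$, $\{(\tilde\rho_\ell(s),\lambda_\ell(s)):s\in(-\delta_\ell,\delta_\ell)\}\subset h^{4+\alpha}_{0,\mathrm{even}}(\mathbb{T})\times\mathbb{R}$ is the analytic curve of solutions of $\bar{\mathcal{G}}=0$ through $(\tilde\rho_\ell(0),\lambda_\ell(0))=(0,\ell)$, nontrivial for $s\neq0$, given by the Crandall–Rabinowitz theorem on bifurcation from a simple eigenvalue (the kernel of $D_1\bar{\mathcal{G}}(0,\ell)=-\partial_x^2(\ell^2+\partial_x^2)$ on $h^{4+\alpha}_{0,\mathrm{even}}(\mathbb{T})$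 is spanned by $\cos(\ell x)$, and the curve has tangent direction $\frac{d}{ds}\tilde\rho_\ell(0)=\cos(\ell\,\cdot)$ at $s=0$); all solutions near $(0,\ell)$ are either trivial, $(0,\lambda)$, or on this curve. Perturbed eigenvalue: $0$ is a simple eigenvalue of $D_1\bar{\mathcal{G}}(0,\ell)$ on $h^{4+\alpha}_{0,\mathrm{even}}(\mathbb{T})$, and $\hat\mu_\ell(s)$ denotes the associated perturbed eigenvalue of the linearization $D_1\bar{\mathcal{G}}(\tilde\rho_\ell(s),\lambda_\ell(s))$ about the nontrivial equilibrium, i.e. the eigenvalue depending continuously on $s$ near $0$ with $\hat\mu_\ell(0)=0$. *)

theory Defs
  imports "HOL-Analysis.Analysis"
begin

section \<open>Little Hoelder spaces on the circle\<close>

text \<open>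
  Functions on the circle of length \<open>2\<pi>\<close> are represented by \<open>2\<pi>\<close>-periodic functions
  on the real line. The exponent \<open>\<alpha>\<close> is a term, so the spaces are explicit carrier
  sets with explicit norms rather than types.
\<close>

definition circle_dist :: "real \<Rightarrow> real \<Rightarrow> real" where
  "circle_dist x y = (INF k::int. \<bar>x - y + 2 * pi * of_int k\<bar>)"

definition Ck_circle :: "nat \<Rightarrow> (real \<Rightarrow> real) set" where
  "Ck_circle k = {f. (\<forall>x. f (x + 2 * pi) = f x)
     \<and> (\<forall>j<k. \<forall>x. (deriv ^^ j) f differentiable at x)
     \<and> continuous_on UNIV ((deriv ^^ k) f)}"

definition holder_quotient :: "real \<Rightarrow> (real \<Rightarrow> real) \<Rightarrow> real \<times> real \<Rightarrow> real" where
  "holder_quotient \<alpha> f = (\<lambda>(x, y). \<bar>f x - f y\<bar> / circle_dist x y powr \<alpha>)"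

definition holder_space :: "nat \<Rightarrow> real \<Rightarrow> (real \<Rightarrow> real) set" where
  "holder_space k \<alpha> = {f \<in> Ck_circle k.
     bdd_above (holder_quotient \<alpha> ((deriv ^^ k) f) ` {(x, y). 0 < circle_dist x y})}"

definition holder_norm :: "nat \<Rightarrow> real \<Rightarrow> (real \<Rightarrow> real) \<Rightarrow> real" where
  "holder_norm k \<alpha> f =
     (\<Sum>j\<le>k. SUP x. \<bar>(deriv ^^ j) f x\<bar>)
     + (SUP p\<in>{(x, y). 0 < circle_dist x y}. holder_quotient \<alpha> ((deriv ^^ k) f) p)"

definition little_holder :: "nat \<Rightarrow> real \<Rightarrow> (real \<Rightarrow> real) set" where
  "little_holder k \<alpha> = {f \<in> holder_space k \<alpha>.
     ((\<lambda>\<delta>. SUP p\<in>{(x, y). 0 < circle_dist x y \<and> circle_dist x y < \<delta>}.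
         holder_quotient \<alpha> ((deriv ^^ k) f) p) \<longlongrightarrow> 0) (at_right 0)}"

definition P0 :: "(real \<Rightarrow> real) \<Rightarrow> real \<Rightarrow> real" where
  "P0 f = (\<lambda>x. f x - 1 / (2 * pi) * integral {-pi..pi} f)"

definition little_holder0 :: "nat \<Rightarrow> real \<Rightarrow> (real \<Rightarrow> real) set" where
  "little_holder0 k \<alpha> = P0 ` little_holder k \<alpha>"

definition little_holder0_even :: "nat \<Rightarrow> real \<Rightarrow> (real \<Rightarrow> real) set" where
  "little_holder0_even k \<alpha> = {f \<in> little_holder0 k \<alpha>. \<forall>x. f (- x) = f x}"


section \<open>Calculus in function spaces given by a carrier and a norm\<close>

definition bounded_linear_betw ::
  "(real \<Rightarrow> real) set \<Rightarrow> ((real \<Rightarrow> real) \<Rightarrow> real) \<Rightarrow> (real \<Rightarrow> real) set \<Rightarrow> ((real \<Rightarrow> real) \<Rightarrow> real)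
    \<Rightarrow> ((real \<Rightarrow> real) \<Rightarrow> (real \<Rightarrow> real)) \<Rightarrow> bool" where
  "bounded_linear_betw X nX Y nY A \<longleftrightarrow>
     (\<forall>u\<in>X. A u \<in> Y)
     \<and> (\<forall>u\<in>X. \<forall>v\<in>X. A (\<lambda>x. u x + v x) = (\<lambda>x. A u x + A v x))
     \<and> (\<forall>c. \<forall>u\<in>X. A (\<lambda>x. c * u x) = (\<lambda>x. c * A u x))
     \<and> (\<exists>C. \<forall>u\<in>X. nY (A u) \<le> C * nX u)"

text \<open>\<open>A\<close> is the Frechet derivative at the interior point \<open>p\<close> of a map \<open>F : U \<rightarrow> Y\<close>,
  \<open>U \<subseteq> X\<close>.\<close>

definition has_frechet_deriv ::
  "(real \<Rightarrow> real) set \<Rightarrow> ((real \<Rightarrow> real) \<Rightarrow> real) \<Rightarrow> (real \<Rightarrow> real) set \<Rightarrow> ((real \<Rightarrow> real) \<Rightarrow> real)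
    \<Rightarrow> (real \<Rightarrow> real) set \<Rightarrow> ((real \<Rightarrow> real) \<Rightarrow> (real \<Rightarrow> real)) \<Rightarrow> (real \<Rightarrow> real)
    \<Rightarrow> ((real \<Rightarrow> real) \<Rightarrow> (real \<Rightarrow> real)) \<Rightarrow> bool" where
  "has_frechet_deriv X nX Y nY U F p A \<longleftrightarrow>
     U \<subseteq> X \<and> (\<forall>u\<in>U. F u \<in> Y) \<and> p \<in> U \<and> bounded_linear_betw X nX Y nY A
     \<and> (\<forall>\<epsilon>>0. \<exists>\<eta>>0. \<forall>h\<in>X. nX h < \<eta> \<longrightarrow>
          (\<lambda>x. p x + h x) \<in> U
          \<and> nY (\<lambda>x. F (\<lambda>y. p y + h y) x - F p x - A h x) \<le> \<epsilon> * nX h)"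

definition eigenvalue_on ::
  "(real \<Rightarrow> real) set \<Rightarrow> ((real \<Rightarrow> real) \<Rightarrow> (real \<Rightarrow> real)) \<Rightarrow> real \<Rightarrow> bool" where
  "eigenvalue_on X A \<mu> \<longleftrightarrow> (\<exists>u\<in>X. u \<noteq> (\<lambda>x. 0) \<and> A u = (\<lambda>x. \<mu> * u x))"

definition analytic_curve_on ::
  "(real \<Rightarrow> real) set \<Rightarrow> ((real \<Rightarrow> real) \<Rightarrow> real) \<Rightarrow> real set \<Rightarrow> (real \<Rightarrow> (real \<Rightarrow> real)) \<Rightarrow> bool" where
  "analytic_curve_on X nX I \<gamma> \<longleftrightarrow>
     (\<forall>s\<in>I. \<gamma> s \<in> X) \<and>
     (\<forall>s\<^sub>0\<in>I. \<exists>c R. R > 0 \<and> (\<forall>n::nat. c n \<in> X) \<and>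
        (\<forall>s\<in>I. \<bar>s - s\<^sub>0\<bar> < R \<longrightarrow>
           (\<lambda>N. nX (\<lambda>x. \<gamma> s x - (\<Sum>n<N. (s - s\<^sub>0) ^ n * c n x))) \<longlonglongrightarrow> 0))"

definition real_analytic_on :: "real set \<Rightarrow> (real \<Rightarrow> real) \<Rightarrow> bool" where
  "real_analytic_on I f \<longleftrightarrow>
     (\<forall>s\<^sub>0\<in>I. \<exists>c R. R > 0 \<and>
        (\<forall>s\<in>I. \<bar>s - s\<^sub>0\<bar> < R \<longrightarrow> (\<lambda>n. c n * (s - s\<^sub>0) ^ n) sums f s))"


section \<open>The axisymmetric surface diffusion operator and the bifurcation function\<close>

definition mean_curv :: "(real \<Rightarrow> real) \<Rightarrow> real \<Rightarrow> real" where
  "mean_curv r = (\<lambda>x. 1 / (r x * sqrt (1 + (deriv r x)\<^sup>2))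
                      - deriv (deriv r) x / (1 + (deriv r x)\<^sup>2) powr (3 / 2))"

definition G_op :: "(real \<Rightarrow> real) \<Rightarrow> real \<Rightarrow> real" where
  "G_op r = (\<lambda>x. 1 / r x *
     deriv (\<lambda>y. r y / sqrt (1 + (deriv r y)\<^sup>2) * deriv (mean_curv r) y) x)"

definition F_star :: "real \<Rightarrow> (real \<Rightarrow> real) \<Rightarrow> real" where
  "F_star lam \<rho> = integral {-pi..pi} (\<lambda>x. (\<rho> x + 1 / lam)\<^sup>2)"

text \<open>
  The implicit function theorem yields a unique solution \<open>\<psi>(\<rho>)\<close> near \<open>0\<close>. The
  neighbourhood of \<open>0\<close> in \<open>h\<^sup>\<alpha>\<close> in which \<open>\<psi>(\<rho>)\<close> is sought is taken to be the open set
  of all \<open>f\<close> with \<open>f > -1/\<lambda>\<close>; the solution is unique there, see \<open>is_lift_unique\<close>.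
\<close>

definition is_lift :: "real \<Rightarrow> real \<Rightarrow> (real \<Rightarrow> real) \<Rightarrow> (real \<Rightarrow> real) \<Rightarrow> bool" where
  "is_lift \<alpha> lam \<rho> f \<longleftrightarrow>
     f \<in> little_holder 0 \<alpha> \<and> (\<forall>x. f x > - 1 / lam)
     \<and> P0 f = \<rho> \<and> F_star lam f = F_star lam (\<lambda>x. 0)"

definition lift_map :: "real \<Rightarrow> real \<Rightarrow> (real \<Rightarrow> real) \<Rightarrow> (real \<Rightarrow> real)" where
  "lift_map \<alpha> lam \<rho> = (THE f. is_lift \<alpha> lam \<rho> f)"

definition G_bar :: "real \<Rightarrow> (real \<Rightarrow> real) \<Rightarrow> real \<Rightarrow> (real \<Rightarrow> real)" where
  "G_bar \<alpha> \<rho> lam = P0 (G_op (\<lambda>x. lift_map \<alpha> lam \<rho> x + 1 / lam))"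

definition G_bar_dom :: "real \<Rightarrow> real \<Rightarrow> (real \<Rightarrow> real) set" where
  "G_bar_dom \<alpha> lam = {\<rho> \<in> little_holder0_even 4 \<alpha>. \<exists>f. is_lift \<alpha> lam \<rho> f}"

definition has_D1_G_bar ::
  "real \<Rightarrow> (real \<Rightarrow> real) \<Rightarrow> real \<Rightarrow> ((real \<Rightarrow> real) \<Rightarrow> (real \<Rightarrow> real)) \<Rightarrow> bool" where
  "has_D1_G_bar \<alpha> \<rho> lam A \<longleftrightarrow>
     has_frechet_deriv (little_holder0_even 4 \<alpha>) (holder_norm 4 \<alpha>)
       (little_holder0_even 0 \<alpha>) (holder_norm 0 \<alpha>)
       (G_bar_dom \<alpha> lam) (\<lambda>\<rho>. G_bar \<alpha> \<rho> lam) \<rho> A"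


section \<open>The bifurcating branch and the perturbed eigenvalue\<close>

text \<open>The Crandall--Rabinowitz curve through \<open>(0, \<ell>)\<close>, parametrized over \<open>(-\<delta>, \<delta>)\<close>;
  it is determined up to analytic reparametrization.\<close>

definition bifurcation_branch ::
  "real \<Rightarrow> nat \<Rightarrow> real \<Rightarrow> (real \<Rightarrow> (real \<Rightarrow> real)) \<Rightarrow> (real \<Rightarrow> real) \<Rightarrow> bool" where
  "bifurcation_branch \<alpha> l \<delta> \<rho> lam \<longleftrightarrow>
     \<delta> > 0
     \<and> analytic_curve_on (little_holder0_even 4 \<alpha>) (holder_norm 4 \<alpha>) {-\<delta><..<\<delta>} \<rho>
     \<and> real_analytic_on {-\<delta><..<\<delta>} lam
     \<and> \<rho> 0 = (\<lambda>x. 0) \<and> lam 0 = real l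
     \<and> (\<forall>s\<in>{-\<delta><..<\<delta>}. lam s > 0 \<and> \<rho> s \<in> G_bar_dom \<alpha> (lam s)
           \<and> G_bar \<alpha> (\<rho> s) (lam s) = (\<lambda>x. 0))
     \<and> (\<forall>s\<in>{-\<delta><..<\<delta>}. s \<noteq> 0 \<longrightarrow> \<rho> s \<noteq> (\<lambda>x. 0))
     \<and> ((\<lambda>s. holder_norm 4 \<alpha> (\<lambda>x. (\<rho> s x - \<rho> 0 x) / s - cos (real l * x))) \<longlongrightarrow> 0) (at 0)
     \<and> (\<exists>\<epsilon>>0. \<forall>\<sigma> m. m > 0 \<and> \<sigma> \<in> G_bar_dom \<alpha> m
           \<and> holder_norm 4 \<alpha> \<sigma> < \<epsilon> \<and> \<bar>m - real l\<bar> < \<epsilon> \<and> G_bar \<alpha> \<sigma> m = (\<lambda>x. 0)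
           \<longrightarrow> \<sigma> = (\<lambda>x. 0) \<or> (\<exists>s\<in>{-\<delta><..<\<delta>}. \<sigma> = \<rho> s \<and> m = lam s))"

definition perturbed_eigenvalue ::
  "real \<Rightarrow> real \<Rightarrow> (real \<Rightarrow> (real \<Rightarrow> real)) \<Rightarrow> (real \<Rightarrow> real) \<Rightarrow> (real \<Rightarrow> real) \<Rightarrow> bool" where
  "perturbed_eigenvalue \<alpha> \<delta> \<rho> lam \<mu> \<longleftrightarrow>
     \<mu> 0 = 0 \<and>
     (\<exists>\<eta>>0. \<eta> \<le> \<delta> \<and> continuous_on {-\<eta><..<\<eta>} \<mu> \<and>
        (\<forall>s\<in>{-\<eta><..<\<eta>}. \<exists>A. has_D1_G_bar \<alpha> (\<rho> s) (lam s) A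
            \<and> eigenvalue_on (little_holder0_even 4 \<alpha>) A (\<mu> s)))"


section \<open>The lifting map is well defined\<close>

lemma is_lift_unique:
  assumes f: "is_lift \<alpha> lam \<rho> f" and g: "is_lift \<alpha> lam \<rho> g"
  shows "f = g"
proof -
  define m where "m = (\<lambda>f. 1 / (2 * pi) * integral {-pi..pi} f)"
  have cont: "continuous_on {-pi..pi} f" "continuous_on {-pi..pi} g"
    using f g
    by (auto simp: is_lift_def little_holder_def holder_space_def Ck_circle_def
             intro: continuous_on_subset[OF _ subset_UNIV])
  define c where "c = m f - m g"
  have fg: "f x = g x + c" for x
  proof -
    have "P0 f x = P0 g x" using f g by (simp add: is_lift_def)
    then show ?thesis by (simp add: P0_def c_def m_def)
  qed
  define w where "w = (\<lambda>x. (f x + 1 / lam) + (g x + 1 / lam))"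
  have wpos: "w x > 0" for x
  proof -
    have "f x > - 1 / lam" "g x > - 1 / lam" using f g by (auto simp: is_lift_def)
    then show ?thesis unfolding w_def by simp
  qed
  have wcont: "continuous_on {-pi..pi} w"
    unfolding w_def by (intro continuous_intros cont)
  have "integral {-pi..pi} w > 0"
  proof -
    have "integral {-pi..pi} w \<ge> 0"
      by (rule integral_nonneg) (use wcont wpos in \<open>auto intro: integrable_continuous_real less_imp_le\<close>)
    moreover have "integral {-pi..pi} w \<noteq> 0"
    proof
      assume "integral {-pi..pi} w = 0"
      then have "\<forall>x\<in>{-pi..pi}. w x = 0"
        using integral_eq_0_iff[OF wcont] wpos
        by (auto simp: less_imp_le)
      then show False using wpos[of 0] by force
    qed
    ultimately show ?thesis by linarith
  qed
  moreover have "c * integral {-pi..pi} w = 0"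
  proof -
    have "c * integral {-pi..pi} w = integral {-pi..pi} (\<lambda>x. c * w x)"
      by simp
    also have "(\<lambda>x. c * w x) = (\<lambda>x. (f x + 1 / lam)\<^sup>2 - (g x + 1 / lam)\<^sup>2)"
      by (rule ext) (simp add: fg w_def power2_eq_square algebra_simps)
    also have "integral {-pi..pi} \<dots> = F_star lam f - F_star lam g"
      unfolding F_star_def
      by (rule integral_diff) (intro integrable_continuous_real continuous_intros cont)+
    also have "\<dots> = 0" using f g by (simp add: is_lift_def)
    finally show ?thesis .
  qed
  ultimately have "c = 0" by simp
  then show ?thesis using fg by auto
qed

lemma is_lift_zero:
  assumes "lam > 0"
  shows "is_lift \<alpha> lam (\<lambda>x. 0) (\<lambda>x. 0)"
proof -
  define S where "S = (\<lambda>\<delta>::real. {(x, y). 0 < circle_dist x y \<and> circle_dist x y < \<delta>})"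
  have q: "holder_quotient \<alpha> (\<lambda>x. 0) = (\<lambda>p. 0)"
    by (auto simp: holder_quotient_def)
  have ne: "S \<delta> \<noteq> {}" if d: "\<delta> > 0" for \<delta>
  proof -
    define e where "e = min \<delta> pi / 2"
    have e: "0 < e" "e < \<delta>" "e \<le> pi / 2" using d by (auto simp: e_def min_def)
    have lb: "e \<le> \<bar>e - 0 + 2 * pi * of_int k\<bar>" for k :: int
    proof -
      consider "k = 0" | "k \<ge> 1" | "k \<le> - 1" by linarith
      then show ?thesis
      proof cases
        case 2
        then have "2 * pi * of_int k \<ge> 0" by simp
        then show ?thesis using e by linarith
      next
        case 3
        then have "of_int k \<le> (-1::real)" by linarith
        then have "2 * pi * of_int k \<le> 2 * pi * (-1)" by (intro mult_left_mono) auto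
        then show ?thesis using e by linarith
      qed (use e in auto)
    qed
    have "circle_dist e 0 \<ge> e"
      unfolding circle_dist_def by (rule cINF_greatest) (use lb in auto)
    moreover have "circle_dist e 0 \<le> \<bar>e - 0 + 2 * pi * of_int 0\<bar>"
      unfolding circle_dist_def by (rule cINF_lower[OF _ UNIV_I]) (auto intro!: bdd_belowI[of _ e] lb[simplified])
    ultimately have "circle_dist e 0 = e" using e by simp
    then have "(e, 0) \<in> S \<delta>" using e by (simp add: S_def)
    then show ?thesis by blast
  qed
  have "eventually (\<lambda>\<delta>. (SUP p\<in>S \<delta>. holder_quotient \<alpha> (\<lambda>x. 0) p) = 0) (at_right 0)"
    using eventually_at_right_less[of "0::real"]
    by eventually_elim (simp add: q ne)
  then have "((\<lambda>\<delta>. SUP p\<in>S \<delta>. holder_quotient \<alpha> (\<lambda>x. 0) p) \<longlongrightarrow> 0) (at_right 0)"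
    by (simp add: tendsto_eventually)
  then show ?thesis
    using assms unfolding S_def
    by (simp add: is_lift_def little_holder_def holder_space_def Ck_circle_def P0_def q
                  bdd_aboveI2[of _ _ 0])
qed

lemma lift_map_eq: "is_lift \<alpha> lam \<rho> f \<Longrightarrow> lift_map \<alpha> lam \<rho> = f"
  unfolding lift_map_def by (rule the_equality) (simp_all add: is_lift_unique)

end

theory Submission
  imports Defs
begin

text \<open>
  The lift is explicit: \<open>\<psi>(\<rho>) + 1/\<lambda> = \<rho> + a\<close> with
  \<open>a\<^sup>2 = 1/\<lambda>\<^sup>2 - (1/2\<pi>) \<integral>\<rho>\<^sup>2\<close>. Since \<open>\<integral> r G(r) = 0\<close>, a zero of the
  bifurcation function is a profile \<open>r = \<rho> + a\<close> of constant mean curvature. Write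
  \<open>\<rho>(s) = s c + s\<^sup>2 u(s)\<close> with \<open>c = cos (l x)\<close> and \<open>u(s)\<close> convergent in \<open>C\<^sup>2\<close>. Testing
  \<open>H(r) = const\<close> with \<open>c\<close> and expanding to third order in \<open>s\<close>, the contribution of \<open>u\<close> cancels, and
  \<open>1/a\<^sup>2 = l\<^sup>2 - l\<^sup>4 s\<^sup>2 + o(s\<^sup>2)\<close>, that is \<open>\<lambda> = l - (3/4) l\<^sup>3 s\<^sup>2 + o(s\<^sup>2)\<close>.

  For the eigenvalue, the equation \<open>A w = \<mu> w\<close> integrates twice to \<open>L v = const + \<mu> K v\<close>, where \<open>L\<close>
  is the linearized mean curvature, \<open>v = w + const\<close> satisfies \<open>\<integral> r v = 0\<close>, and \<open>K\<close> is a double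
  primitive. This is a small perturbation of \<open>v'' + l\<^sup>2 v = const\<close>, so \<open>v\<close> is close to \<open>c\<close> after
  normalization. Testing with \<open>c\<close> and expanding to second order gives \<open>\<mu> = 3 l\<^sup>6 s\<^sup>2 + o(s\<^sup>2)\<close>.
\<close>

section \<open>Periodic functions and Hoelder spaces\<close>

text \<open>The limit of the corrector u(s) is never computed. It enters the deciding coefficient
  only through 2 l^3 c^2 u - l c c' u', and integration by parts shows that this has integral 0 for
  every mean-zero u. The lower orders need no solving either: 1/a^2 - l^2 is carried along as an
  unknown, every coefficient below the deciding one integrates to 0 or to a multiple of that
  unknown, and what remains is an exact identity that can be divided by s^2. The difficulty with the
  eigenvalue is that v - c is only known to tend to 0, without a rate, so terms of size s (v - c)
  look too large. The same integration by parts reduces them to s times the integral of v - c, up to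
  a factor 1/a^2 - l^2, and the constraint that r v has integral 0 makes that integral of order s.
  The two results fit the exchange of stability: on the trivial branch cos (l x) has the eigenvalue
  l^2 (lambda^2 - l^2), with slope 2 l^3 at lambda = l, and - s lambda'(s) 2 l^3 is 3 l^6 s^2 to
  leading order.\<close>

lemma Ck_circle_has_deriv:
  assumes "f \<in> Ck_circle k" "j < k"
  shows "((deriv ^^ j) f has_real_derivative (deriv ^^ Suc j) f x) (at x)"
  using assms by (auto simp: Ck_circle_def DERIV_deriv_iff_real_differentiable)

lemma Ck_circle_continuous:
  assumes "f \<in> Ck_circle k" "j \<le> k"
  shows "continuous_on A ((deriv ^^ j) f)"
proof (cases "j = k")
  case True
  then show ?thesis
    using assms by (auto simp: Ck_circle_def intro: continuous_on_subset)
next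
  case False
  then show ?thesis
    using assms Ck_circle_has_deriv[OF assms(1), of j]
    by (meson DERIV_isCont continuous_at_imp_continuous_on le_neq_implies_less)
qed

text \<open>No differentiability is assumed: both points admit the same derivatives, so the choice
  operator in \<open>deriv\<close> returns the same value even where there is none.\<close>

lemma deriv_shift:
  fixes f :: "real \<Rightarrow> real"
  assumes "\<And>x. f (x + p) = f x"
  shows "deriv f (x + p) = deriv f x"
proof -
  have "(f has_real_derivative D) (at (x + p)) \<longleftrightarrow> (f has_real_derivative D) (at x)" for D
    using DERIV_shift[of f D x p] assms by simp
  then show ?thesis by (simp add: deriv_def)
qed

lemma Ck_circle_periodic:
  assumes "f \<in> Ck_circle k"
  shows "(deriv ^^ j) f (x + 2 * pi) = (deriv ^^ j) f x"
proof (induction j arbitrary: x)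
  case 0
  then show ?case using assms by (simp add: Ck_circle_def)
next
  case (Suc j)
  then show ?case by (auto intro: deriv_shift)
qed

lemma periodic_int:
  fixes f :: "real \<Rightarrow> real"
  assumes "\<And>x. f (x + p) = f x"
  shows "f (x + of_int k * p) = f x"
proof -
  have n: "f (x + of_nat n * p) = f x" for n x
  proof (induction n)
    case (Suc n)
    have "f (x + of_nat (Suc n) * p) = f (x + of_nat n * p + p)" by (simp add: algebra_simps)
    then show ?case using assms Suc by simp
  qed auto
  show ?thesis
  proof (cases "k \<ge> 0")
    case True
    then show ?thesis using n[of x "nat k"] by simp
  next
    case False
    then show ?thesis using n[of "x + of_int k * p" "nat (-k)"] by simp
  qed
qed

lemma periodic_reduce: "\<exists>k::int. x + of_int k * (2 * pi) \<in> {-pi..pi}"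
proof -
  define k where "k = - \<lfloor>(x + pi) / (2 * pi)\<rfloor>"
  have "of_int (- k) \<le> (x + pi) / (2 * pi)" "(x + pi) / (2 * pi) < of_int (- k) + 1"
    by (simp_all add: k_def)
  then show ?thesis by (intro exI[of _ k]) (auto simp: field_simps)
qed

lemma periodic_bounded:
  fixes f :: "real \<Rightarrow> real"
  assumes per: "\<And>x. f (x + 2 * pi) = f x" and c: "continuous_on UNIV f"
  obtains B where "\<And>x. \<bar>f x\<bar> \<le> B"
proof -
  have "bounded (f ` {-pi..pi})"
    by (intro compact_imp_bounded compact_continuous_image continuous_on_subset[OF c]) auto
  then obtain B where "\<forall>x\<in>{-pi..pi}. \<bar>f x\<bar> \<le> B"
    unfolding bounded_iff by auto
  then have B: "\<bar>f x\<bar> \<le> B" if "x \<in> {-pi..pi}" for x using that by blast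
  have "\<bar>f x\<bar> \<le> B" for x
  proof -
    obtain k :: int where "x + of_int k * (2 * pi) \<in> {-pi..pi}" using periodic_reduce by blast
    from B[OF this] show ?thesis using periodic_int[of f "2 * pi" x k] per by simp
  qed
  then show ?thesis by (rule that)
qed

lemma Ck_circle_bounded:
  assumes "f \<in> Ck_circle k" "j \<le> k"
  shows "\<exists>B. \<forall>x. \<bar>(deriv ^^ j) f x\<bar> \<le> B"
  by (rule periodic_bounded[of "(deriv ^^ j) f"])
     (use Ck_circle_periodic[OF assms(1)] Ck_circle_continuous[OF assms] in auto)

lemma higher_deriv_linear:
  assumes "f \<in> Ck_circle k" "g \<in> Ck_circle k" "j \<le> k"
  shows "(deriv ^^ j) (\<lambda>x. a * f x + b * g x) = (\<lambda>x. a * (deriv ^^ j) f x + b * (deriv ^^ j) g x)"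
  using assms(3)
proof (induction j)
  case (Suc j)
  have "(deriv ^^ Suc j) (\<lambda>x. a * f x + b * g x) = deriv (\<lambda>x. a * (deriv ^^ j) f x + b * (deriv ^^ j) g x)"
    using Suc by simp
  also have "\<dots> = (\<lambda>x. a * (deriv ^^ Suc j) f x + b * (deriv ^^ Suc j) g x)"
    using Suc.prems
    by (intro ext DERIV_imp_deriv)
       (auto intro!: derivative_eq_intros Ck_circle_has_deriv[OF assms(1), of j, simplified]
          Ck_circle_has_deriv[OF assms(2), of j, simplified])
  finally show ?case .
qed auto

lemma Ck_circle_linear:
  assumes "f \<in> Ck_circle k" "g \<in> Ck_circle k"
  shows "(\<lambda>x. a * f x + b * g x) \<in> Ck_circle k"
proof -
  have "(deriv ^^ j) (\<lambda>x. a * f x + b * g x) differentiable at x" if "j < k" for j x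
  proof -
    have "((\<lambda>x. a * (deriv ^^ j) f x + b * (deriv ^^ j) g x) has_real_derivative
        a * (deriv ^^ Suc j) f x + b * (deriv ^^ Suc j) g x) (at x)"
      using that by (auto intro!: derivative_eq_intros Ck_circle_has_deriv[OF assms(1), of j, simplified]
          Ck_circle_has_deriv[OF assms(2), of j, simplified])
    then show ?thesis
      unfolding higher_deriv_linear[OF assms less_imp_le[OF that]] by (auto simp: real_differentiable_def)
  qed
  moreover have "continuous_on UNIV ((deriv ^^ k) (\<lambda>x. a * f x + b * g x))"
    unfolding higher_deriv_linear[OF assms order_refl]
    by (intro continuous_intros Ck_circle_continuous[OF assms(1)] Ck_circle_continuous[OF assms(2)]) auto
  ultimately show ?thesis using assms by (auto simp: Ck_circle_def)
qed

section \<open>The circle metric and the Hoelder norm\<close>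

lemma circle_dist_small:
  assumes e: "0 \<le> e" "e \<le> pi"
  shows "circle_dist e 0 = e"
proof -
  have lb: "e \<le> \<bar>e - 0 + 2 * pi * of_int k\<bar>" for k :: int
  proof -
    consider "k = 0" | "k \<ge> 1" | "k \<le> - 1" by linarith
    then show ?thesis
    proof cases
      case 2
      then have "2 * pi * of_int k \<ge> 0" by simp
      then show ?thesis using e by linarith
    next
      case 3
      then have "of_int k \<le> (-1::real)" by linarith
      then have "2 * pi * of_int k \<le> 2 * pi * (-1)" by (intro mult_left_mono) auto
      then show ?thesis using e by linarith
    qed (use e in auto)
  qed
  have "circle_dist e 0 \<ge> e"
    unfolding circle_dist_def by (rule cINF_greatest) (use lb in auto)
  moreover have "circle_dist e 0 \<le> \<bar>e - 0 + 2 * pi * of_int 0\<bar>"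
    unfolding circle_dist_def
    by (rule cINF_lower[OF _ UNIV_I]) (auto intro!: bdd_belowI[of _ e] lb[simplified])
  ultimately show ?thesis using e by simp
qed

text \<open>A real supremum over the empty set carries no information, so every estimate of a
  Hoelder seminorm needs a pair of distinct points on the circle.\<close>

lemma circle_dist_pos_ex: "\<exists>x y. 0 < circle_dist x y"
  using circle_dist_small[of 1] pi_gt3 by (metis less_eq_real_def less_trans not_less zero_less_one one_less_numeral_iff semiring_norm(77))

lemma holder_quotient_nonneg: "0 \<le> holder_quotient \<alpha> f p"
  by (cases p) (simp add: holder_quotient_def)

lemma holder_space_linear:
  assumes "f \<in> holder_space k \<alpha>" "g \<in> holder_space k \<alpha>"
  shows "(\<lambda>x. a * f x + b * g x) \<in> holder_space k \<alpha>"
proof -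
  let ?S = "{(x, y). 0 < circle_dist x y}"
  have fg: "f \<in> Ck_circle k" "g \<in> Ck_circle k"
    using assms by (auto simp: holder_space_def)
  obtain B C where B: "\<And>p. p \<in> ?S \<Longrightarrow> holder_quotient \<alpha> ((deriv ^^ k) f) p \<le> B"
    and C: "\<And>p. p \<in> ?S \<Longrightarrow> holder_quotient \<alpha> ((deriv ^^ k) g) p \<le> C"
    using assms by (force simp: holder_space_def bdd_above_def)
  have "holder_quotient \<alpha> ((deriv ^^ k) (\<lambda>x. a * f x + b * g x)) p \<le> \<bar>a\<bar> * B + \<bar>b\<bar> * C"
    if "p \<in> ?S" for p
  proof -
    obtain x y where p: "p = (x, y)" by fastforce
    let ?f = "(deriv ^^ k) f" and ?g = "(deriv ^^ k) g"
    have "\<bar>(a * ?f x + b * ?g x) - (a * ?f y + b * ?g y)\<bar> = \<bar>a * (?f x - ?f y) + b * (?g x - ?g y)\<bar>"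
      by (simp add: algebra_simps)
    also have "\<dots> \<le> \<bar>a\<bar> * \<bar>?f x - ?f y\<bar> + \<bar>b\<bar> * \<bar>?g x - ?g y\<bar>"
      by (metis abs_mult abs_triangle_ineq)
    finally have "holder_quotient \<alpha> ((deriv ^^ k) (\<lambda>x. a * f x + b * g x)) p
        \<le> (\<bar>a\<bar> * \<bar>?f x - ?f y\<bar> + \<bar>b\<bar> * \<bar>?g x - ?g y\<bar>) / circle_dist x y powr \<alpha>"
      unfolding higher_deriv_linear[OF fg order_refl] by (simp add: holder_quotient_def p divide_right_mono)
    also have "\<dots> = \<bar>a\<bar> * holder_quotient \<alpha> ?f p + \<bar>b\<bar> * holder_quotient \<alpha> ?g p"
      by (simp add: holder_quotient_def p add_divide_distrib)
    also have "\<dots> \<le> \<bar>a\<bar> * B + \<bar>b\<bar> * C"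
      using B[OF that] C[OF that] by (intro add_mono mult_left_mono) auto
    finally show ?thesis .
  qed
  then show ?thesis
    using Ck_circle_linear[OF fg] unfolding holder_space_def by (auto intro!: bdd_aboveI2)
qed

text \<open>All summands of the norm are nonnegative, the Hoelder supremum because it runs over a
  nonempty set. Through this bound the Frechet estimate and the convergence of the branch become
  uniform estimates of functions and derivatives.\<close>

lemma holder_norm_bound:
  assumes f: "f \<in> holder_space k \<alpha>" and j: "j \<le> k"
  shows "\<bar>(deriv ^^ j) f x\<bar> \<le> holder_norm k \<alpha> f"
proof -
  let ?S = "{(x, y). 0 < circle_dist x y}"
  have fk: "f \<in> Ck_circle k" using f by (auto simp: holder_space_def)
  have sup: "\<bar>(deriv ^^ i) f x\<bar> \<le> (SUP x. \<bar>(deriv ^^ i) f x\<bar>)" if i: "i \<le> k" for i x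
  proof -
    obtain B where "\<And>x. \<bar>(deriv ^^ i) f x\<bar> \<le> B" using Ck_circle_bounded[OF fk i] by blast
    then show ?thesis by (intro cSUP_upper) (auto intro!: bdd_aboveI2[where M = B])
  qed
  have "\<bar>(deriv ^^ j) f x\<bar> \<le> (\<Sum>i\<le>k. SUP x. \<bar>(deriv ^^ i) f x\<bar>)"
    using sup[OF j, of x] member_le_sum[of j "{..k}" "\<lambda>i. SUP x. \<bar>(deriv ^^ i) f x\<bar>"] j sup
    by (smt (verit) DiffD1 atMost_iff finite_atMost)
  moreover obtain p where "p \<in> ?S" using circle_dist_pos_ex by blast
  then have "0 \<le> (SUP p\<in>?S. holder_quotient \<alpha> ((deriv ^^ k) f) p)"
    using f unfolding holder_space_def
    by (intro cSUP_upper2[where x = p]) (auto simp: holder_quotient_nonneg)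
  ultimately show ?thesis unfolding holder_norm_def by linarith
qed

lemma holder_norm_scale_le:
  assumes f: "f \<in> holder_space k \<alpha>"
  shows "holder_norm k \<alpha> (\<lambda>x. c * f x) \<le> \<bar>c\<bar> * holder_norm k \<alpha> f"
proof -
  let ?S = "{(x, y). 0 < circle_dist x y}"
  have fk: "f \<in> Ck_circle k" using f by (auto simp: holder_space_def)
  have d: "(deriv ^^ j) (\<lambda>x. c * f x) = (\<lambda>x. c * (deriv ^^ j) f x)" if "j \<le> k" for j
    using higher_deriv_linear[OF fk fk that, of c 0] by simp
  have "(SUP x. \<bar>(deriv ^^ j) (\<lambda>x. c * f x) x\<bar>) \<le> \<bar>c\<bar> * (SUP x. \<bar>(deriv ^^ j) f x\<bar>)" if j: "j \<le> k" for j
  proof -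
    obtain B where "\<And>x. \<bar>(deriv ^^ j) f x\<bar> \<le> B" using Ck_circle_bounded[OF fk j] by blast
    then have "\<bar>(deriv ^^ j) f x\<bar> \<le> (SUP x. \<bar>(deriv ^^ j) f x\<bar>)" for x
      by (intro cSUP_upper) (auto intro!: bdd_aboveI2[where M = B])
    then show ?thesis by (intro cSUP_least) (auto simp: d[OF j] abs_mult mult_left_mono)
  qed
  then have "(\<Sum>j\<le>k. SUP x. \<bar>(deriv ^^ j) (\<lambda>x. c * f x) x\<bar>) \<le> \<bar>c\<bar> * (\<Sum>j\<le>k. SUP x. \<bar>(deriv ^^ j) f x\<bar>)"
    unfolding sum_distrib_left by (intro sum_mono) auto
  moreover have "(SUP p\<in>?S. holder_quotient \<alpha> ((deriv ^^ k) (\<lambda>x. c * f x)) p)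
      \<le> \<bar>c\<bar> * (SUP p\<in>?S. holder_quotient \<alpha> ((deriv ^^ k) f) p)"
  proof (rule cSUP_least)
    show "?S \<noteq> {}" using circle_dist_pos_ex by blast
    fix p assume p: "p \<in> ?S"
    have "holder_quotient \<alpha> ((deriv ^^ k) (\<lambda>x. c * f x)) p = \<bar>c\<bar> * holder_quotient \<alpha> ((deriv ^^ k) f) p"
      by (cases p) (simp add: d holder_quotient_def abs_mult flip: right_diff_distrib)
    moreover have "holder_quotient \<alpha> ((deriv ^^ k) f) p \<le> (SUP p\<in>?S. holder_quotient \<alpha> ((deriv ^^ k) f) p)"
      using f p unfolding holder_space_def by (intro cSUP_upper) auto
    ultimately show "holder_quotient \<alpha> ((deriv ^^ k) (\<lambda>x. c * f x)) p
      \<le> \<bar>c\<bar> * (SUP p\<in>?S. holder_quotient \<alpha> ((deriv ^^ k) f) p)"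
      by (simp add: mult_left_mono)
  qed
  ultimately show ?thesis unfolding holder_norm_def by (simp add: distrib_left)
qed

text \<open>By periodicity \<open>x\<close> may be shifted by any number of periods, so the
  Lipschitz bound on the line passes to the circle metric d. For d at most 1 use that d is at most d
  powr \<alpha>; for larger d the sup bound \<open>B\<close> gives 2 B. Hence the constant
  \<open>L + 2 * B\<close>.\<close>

lemma holder_space_Lipschitz:
  assumes f: "f \<in> Ck_circle k" and \<alpha>: "0 < \<alpha>" "\<alpha> < 1"
    and lip: "\<And>x y. \<bar>(deriv ^^ k) f x - (deriv ^^ k) f y\<bar> \<le> L * \<bar>x - y\<bar>"
  shows "f \<in> holder_space k \<alpha>"
proof -
  let ?g = "(deriv ^^ k) f"
  obtain B where B: "\<And>x. \<bar>?g x\<bar> \<le> B" using Ck_circle_bounded[OF f order_refl] by blast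
  have B0: "0 \<le> B" using B[of 0] by linarith
  have L0: "0 \<le> L" using lip[of 1 0] by simp
  have "holder_quotient \<alpha> ?g (x, y) \<le> L + 2 * B" if d: "0 < circle_dist x y" for x y
  proof -
    have *: "\<bar>?g x - ?g y\<bar> \<le> L * \<bar>x - y + 2 * pi * of_int n\<bar>" for n :: int
      using lip[of "x + of_int n * (2 * pi)" y] periodic_int[of ?g "2 * pi" x n] Ck_circle_periodic[OF f]
      by (simp add: algebra_simps)
    have le: "\<bar>?g x - ?g y\<bar> \<le> L * circle_dist x y"
    proof (cases "L = 0")
      case False
      then have "\<bar>?g x - ?g y\<bar> / L \<le> circle_dist x y"
        unfolding circle_dist_def using * L0
        by (intro cINF_greatest) (auto simp: divide_le_eq mult.commute)
      then show ?thesis using L0 False by (simp add: divide_le_eq mult.commute)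
    qed (use *[of 0] in auto)
    have "\<bar>?g x - ?g y\<bar> \<le> (L + 2 * B) * circle_dist x y powr \<alpha>"
    proof (cases "circle_dist x y \<le> 1")
      case True
      have "circle_dist x y powr 1 \<le> circle_dist x y powr \<alpha>"
        using True d \<alpha> by (intro powr_mono') auto
      then have "L * circle_dist x y \<le> (L + 2 * B) * circle_dist x y powr \<alpha>"
        using L0 B0 d by (intro mult_mono) auto
      then show ?thesis using le by linarith
    next
      case False
      then have "1 \<le> circle_dist x y powr \<alpha>" using \<alpha> by (intro ge_one_powr_ge_zero) auto
      then have "2 * B * 1 \<le> (L + 2 * B) * circle_dist x y powr \<alpha>"
        using L0 B0 by (intro mult_mono) auto
      then show ?thesis using B[of x] B[of y] by linarith
    qed
    then show ?thesis using d by (simp add: holder_quotient_def divide_le_eq)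
  qed
  then show ?thesis using f by (auto simp: holder_space_def intro!: bdd_aboveI2)
qed

section \<open>Constants and cosines in the Hoelder spaces\<close>

lemma higher_deriv_const: "(deriv ^^ j) (\<lambda>x::real. c::real) = (\<lambda>x. if j = 0 then c else 0)"
  by (induction j) auto

lemma holder_space_const: "0 < \<alpha> \<Longrightarrow> \<alpha> < 1 \<Longrightarrow> (\<lambda>x. c) \<in> holder_space k \<alpha>"
  by (rule holder_space_Lipschitz[where L = 0])
     (auto simp: Ck_circle_def higher_deriv_const)

lemma higher_deriv_trig:
  "\<exists>a b. (deriv ^^ j) (\<lambda>x::real. cos (m * x)) = (\<lambda>x. a * cos (m * x) + b * sin (m * x))"
proof (induction j)
  case 0
  then show ?case by (intro exI[of _ 1] exI[of _ 0]) auto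
next
  case (Suc j)
  then obtain a b where ab: "(deriv ^^ j) (\<lambda>x::real. cos (m * x)) = (\<lambda>x. a * cos (m * x) + b * sin (m * x))"
    by blast
  have "(deriv ^^ Suc j) (\<lambda>x::real. cos (m * x)) = (\<lambda>x. (b * m) * cos (m * x) + (- a * m) * sin (m * x))"
    by (auto simp: ab intro!: ext DERIV_imp_deriv derivative_eq_intros)
  then show ?case by blast
qed

text \<open>Makes the tangency condition of the branch usable pointwise: its norm bounds the
  function inside only once that function is known to lie in \<open>holder_space\<close>.\<close>

lemma holder_space_cos:
  assumes "0 < \<alpha>" "\<alpha> < 1"
  shows "(\<lambda>x. cos (real l * x)) \<in> holder_space k \<alpha>"
proof -
  have ck: "(\<lambda>x. cos (real l * x)) \<in> Ck_circle k"
  proof -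
    have "(deriv ^^ j) (\<lambda>x::real. cos (real l * x)) differentiable at x" for j x
    proof -
      obtain a b where "(deriv ^^ j) (\<lambda>x::real. cos (real l * x)) = (\<lambda>x. a * cos (real l * x) + b * sin (real l * x))"
        using higher_deriv_trig by blast
      then show ?thesis
        by (auto simp: real_differentiable_def intro!: exI derivative_eq_intros)
    qed
    moreover from this have "continuous_on UNIV ((deriv ^^ k) (\<lambda>x::real. cos (real l * x)))"
      by (auto intro!: differentiable_imp_continuous_on simp: differentiable_on_def)
    moreover have "cos (real l * (x + 2 * pi)) = cos (real l * x)" for x
    proof -
      have "cos (real l * x + of_int (int l) * (2 * pi)) = cos (real l * x)"
        by (rule periodic_int) simp
      then show ?thesis by (simp add: algebra_simps)
    qed
    ultimately show ?thesis by (auto simp: Ck_circle_def)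
  qed
  obtain B where B: "\<And>x. \<bar>(deriv ^^ Suc k) (\<lambda>x. cos (real l * x)) x\<bar> \<le> B"
  proof -
    obtain a b where ab: "(deriv ^^ Suc k) (\<lambda>x::real. cos (real l * x)) = (\<lambda>x. a * cos (real l * x) + b * sin (real l * x))"
      using higher_deriv_trig by blast
    have "\<bar>a * cos z + b * sin z\<bar> \<le> \<bar>a\<bar> * 1 + \<bar>b\<bar> * 1" for z :: real
      by (rule order_trans[OF abs_triangle_ineq])
         (auto simp: abs_mult mult_left_le intro!: add_mono)
    then show ?thesis by (intro that[of "\<bar>a\<bar> + \<bar>b\<bar>"]) (simp only: ab, simp)
  qed
  have d: "((deriv ^^ k) (\<lambda>x. cos (real l * x)) has_real_derivative (deriv ^^ Suc k) (\<lambda>x. cos (real l * x)) x) (at x within UNIV)" for x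
  proof -
    obtain a b where "(deriv ^^ k) (\<lambda>x::real. cos (real l * x)) = (\<lambda>x. a * cos (real l * x) + b * sin (real l * x))"
      using higher_deriv_trig by blast
    then show ?thesis
      by (auto simp: DERIV_deriv_iff_real_differentiable real_differentiable_def intro!: exI derivative_eq_intros)
  qed
  show ?thesis
    using field_differentiable_bound[OF convex_UNIV d B[unfolded real_norm_def[symmetric]]]
    by (intro holder_space_Lipschitz[OF ck assms, of B]) (auto simp: abs_minus_commute)
qed

section \<open>Mean-zero even functions and scaling\<close>

lemma little_holder0_evenD:
  assumes "f \<in> little_holder0_even k \<alpha>" "0 < \<alpha>" "\<alpha> < 1"
  shows "f \<in> holder_space k \<alpha>" "f \<in> Ck_circle k" "f (- x) = f x"
    "(f has_integral 0) {-pi..pi}"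
proof -
  obtain g where g: "g \<in> little_holder k \<alpha>" "f = P0 g"
    using assms by (auto simp: little_holder0_even_def little_holder0_def)
  have gh: "g \<in> holder_space k \<alpha>" using g by (simp add: little_holder_def)
  have feq: "f = (\<lambda>x. 1 * g x + (- 1) * (1 / (2 * pi) * integral {-pi..pi} g))"
    using g by (auto simp: P0_def)
  show "f \<in> holder_space k \<alpha>"
    unfolding feq by (intro holder_space_linear gh holder_space_const assms)
  then show "f \<in> Ck_circle k" by (simp add: holder_space_def)
  show "f (- x) = f x" using assms by (auto simp: little_holder0_even_def)
  have "continuous_on {-pi..pi} g"
    using Ck_circle_continuous[of g k 0] gh by (auto simp: holder_space_def)
  then have "(g has_integral integral {-pi..pi} g) {-pi..pi}"
    using integrable_continuous_real by blast
  from has_integral_diff[OF this has_integral_const_real[of "1 / (2 * pi) * integral {-pi..pi} g" "-pi" pi]]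
  show "(f has_integral 0) {-pi..pi}" unfolding g(2) P0_def by simp
qed

text \<open>Needed to test the Frechet derivative along a ray: the increments t u must stay in the
  space on which the derivative is defined.\<close>

lemma little_holder_scale:
  assumes f: "f \<in> little_holder k \<alpha>"
  shows "(\<lambda>x. c * f x) \<in> little_holder k \<alpha>"
proof -
  let ?S = "\<lambda>\<delta>::real. {(x, y). 0 < circle_dist x y \<and> circle_dist x y < \<delta>}"
  let ?q = "holder_quotient \<alpha> ((deriv ^^ k) f)" and ?Q = "holder_quotient \<alpha> ((deriv ^^ k) (\<lambda>x. c * f x))"
  have fh: "f \<in> holder_space k \<alpha>" and fk: "f \<in> Ck_circle k"
    using f by (auto simp: little_holder_def holder_space_def)
  have ch: "(\<lambda>x. c * f x) \<in> holder_space k \<alpha>"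
    using holder_space_linear[OF fh fh, of c 0] by simp
  have d: "(deriv ^^ k) (\<lambda>x. c * f x) = (\<lambda>x. c * (deriv ^^ k) f x)"
    using higher_deriv_linear[OF fk fk order_refl, of c 0] by simp
  have Qq: "?Q p = \<bar>c\<bar> * ?q p" for p
    by (cases p) (simp add: d holder_quotient_def abs_mult flip: right_diff_distrib)
  have bdd: "bdd_above (?q ` ?S \<delta>)" "bdd_above (?Q ` ?S \<delta>)" for \<delta>
    using fh ch by (auto simp: holder_space_def intro: bdd_above_mono)
  have ne: "\<exists>p. p \<in> ?S \<delta>" if "\<delta> > 0" for \<delta>
  proof -
    define e where "e = min \<delta> pi / 2"
    have "0 < e" "e < \<delta>" "e \<le> pi" using that pi_gt_zero by (auto simp: e_def min_def)
    then show ?thesis using circle_dist_small[of e] by (intro exI[of _ "(e, 0)"]) auto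
  qed
  have pos: "\<forall>\<^sub>F \<delta> in at_right (0::real). \<delta> > 0" by (simp add: eventually_at_right_less)
  have lim: "((\<lambda>\<delta>. \<bar>c\<bar> * (SUP p\<in>?S \<delta>. ?q p)) \<longlongrightarrow> \<bar>c\<bar> * 0) (at_right 0)"
    using f unfolding little_holder_def by (intro tendsto_intros) auto
  have "((\<lambda>\<delta>. SUP p\<in>?S \<delta>. ?Q p) \<longlongrightarrow> 0) (at_right 0)"
  proof (rule tendsto_sandwich[OF _ _ tendsto_const])
    show "\<forall>\<^sub>F \<delta> in at_right 0. 0 \<le> (SUP p\<in>?S \<delta>. ?Q p)"
      using pos
    proof eventually_elim
      case (elim \<delta>)
      then obtain p where "p \<in> ?S \<delta>" using ne by blast
      then show ?case by (rule cSUP_upper2[OF bdd(2)]) (rule holder_quotient_nonneg)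
    qed
    show "\<forall>\<^sub>F \<delta> in at_right 0. (SUP p\<in>?S \<delta>. ?Q p) \<le> \<bar>c\<bar> * (SUP p\<in>?S \<delta>. ?q p)"
      using pos
    proof eventually_elim
      case (elim \<delta>)
      show ?case
        by (rule cSUP_least) (use ne[OF elim] in \<open>auto simp: Qq intro!: mult_left_mono cSUP_upper bdd\<close>)
    qed
  qed (use lim in simp)
  then show ?thesis using ch by (simp add: little_holder_def)
qed

lemma little_holder0_even_scale:
  assumes "f \<in> little_holder0_even k \<alpha>"
  shows "(\<lambda>x. c * f x) \<in> little_holder0_even k \<alpha>"
proof -
  obtain g where g: "g \<in> little_holder k \<alpha>" "f = P0 g" and even: "\<And>x. f (- x) = f x"
    using assms by (auto simp: little_holder0_even_def little_holder0_def)
  have "P0 (\<lambda>x. c * g x) = (\<lambda>x. c * f x)"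
    by (simp add: g(2) P0_def right_diff_distrib)
  then have "(\<lambda>x. c * f x) \<in> P0 ` little_holder k \<alpha>"
    using little_holder_scale[OF g(1)] by (metis imageI)
  then show ?thesis using even by (simp add: little_holder0_even_def little_holder0_def)
qed

section \<open>The surface diffusion operator and the lifting map\<close>

lemma has_integral_deriv_circle:
  fixes F f :: "real \<Rightarrow> real"
  assumes "\<And>x. (F has_real_derivative f x) (at x)"
  shows "(f has_integral F pi - F (-pi)) {-pi..pi}"
  by (rule fundamental_theorem_of_calculus)
     (auto intro!: has_field_derivative_at_within assms simp flip: has_real_derivative_iff_has_vector_derivative)

section \<open>Line element, flux and mean curvature of a profile\<close>

definition line_elem :: "(real \<Rightarrow> real) \<Rightarrow> real \<Rightarrow> real" where
  "line_elem r = (\<lambda>x. sqrt (1 + (deriv r x)^2))"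

text \<open>The expression under the outer derivative of \<open>G_op\<close>, that is, a primitive
  of r G(r).\<close>

definition flux :: "(real \<Rightarrow> real) \<Rightarrow> real \<Rightarrow> real" where
  "flux r = (\<lambda>x. r x / line_elem r x * deriv (mean_curv r) x)"

lemma line_elem_pos: "line_elem r x > 0"
  by (simp add: line_elem_def add_pos_nonneg)

text \<open>Trades the real power 3/2 for a cube, so that all later algebra is rational in the
  profile, its derivatives and \<open>line_elem\<close>.\<close>

lemma mean_curv_line_elem:
  "mean_curv r x = 1 / (r x * line_elem r x) - deriv (deriv r) x / line_elem r x ^ 3"
proof -
  have "(1 + (deriv r x)^2) powr (3 / 2) = (1 + (deriv r x)^2) powr (of_nat 3 * (1 / 2))"
    by simp
  also have "\<dots> = ((1 + (deriv r x)^2) powr (1 / 2)) ^ 3"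
    by (subst powr_powr[symmetric, of _ "1/2" "of_nat 3", simplified mult.commute])
       (simp add: powr_realpow add_pos_nonneg)
  also have "\<dots> = line_elem r x ^ 3"
    by (simp add: line_elem_def powr_half_sqrt)
  finally show ?thesis by (simp add: mean_curv_def line_elem_def)
qed

lemma Ck4_derivs:
  assumes "r \<in> Ck_circle 4"
  shows "(r has_real_derivative deriv r x) (at x)"
    "(deriv r has_real_derivative deriv (deriv r) x) (at x)"
    "(deriv (deriv r) has_real_derivative deriv (deriv (deriv r)) x) (at x)"
    "(deriv (deriv (deriv r)) has_real_derivative deriv (deriv (deriv (deriv r))) x) (at x)"
  using Ck_circle_has_deriv[OF assms, of 0] Ck_circle_has_deriv[OF assms, of 1]
    Ck_circle_has_deriv[OF assms, of 2] Ck_circle_has_deriv[OF assms, of 3]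
  by (simp_all add: numeral_2_eq_2 numeral_3_eq_3)

lemma line_elem_has_deriv:
  assumes "r \<in> Ck_circle 4"
  shows "(line_elem r has_real_derivative deriv r x * deriv (deriv r) x / line_elem r x) (at x)"
proof -
  have "1 + (deriv r x)^2 > 0" by (simp add: add_pos_nonneg)
  then show ?thesis
    unfolding line_elem_def
    by (auto intro!: derivative_eq_intros Ck4_derivs(2)[OF assms] simp: field_simps)
qed

text \<open>The quotient is the sine of the tangent angle. Since q^2 - p^2 = 1, the second-order
  part of the mean curvature is an exact derivative, which is what integration by parts against a
  cosine uses.\<close>

lemma slope_has_deriv:
  assumes "r \<in> Ck_circle 4"
  shows "((\<lambda>x. deriv r x / line_elem r x) has_real_derivative deriv (deriv r) x / line_elem r x ^ 3) (at x)"
proof -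
  let ?q = "line_elem r x" and ?p = "deriv r x" and ?w = "deriv (deriv r) x"
  have q: "?q > 0" "?q^2 = 1 + ?p^2" by (simp_all add: line_elem_pos) (simp add: line_elem_def)
  have "((\<lambda>x. deriv r x / line_elem r x) has_real_derivative (?w * ?q - ?p * (?p * ?w / ?q)) / (?q * ?q)) (at x)"
    by (rule DERIV_divide[OF Ck4_derivs(2)[OF assms] line_elem_has_deriv[OF assms]]) (use q in auto)
  also have "(?w * ?q - ?p * (?p * ?w / ?q)) / (?q * ?q) = ?w * (?q^2 - ?p^2) / ?q ^ 3"
    using q(1) by (simp add: field_simps power2_eq_square power3_eq_cube)
  finally show ?thesis by (simp add: q(2))
qed

lemma mean_curv_has_derivs:
  assumes r: "r \<in> Ck_circle 4" and pos: "\<And>x. r x > 0"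
  shows "(mean_curv r has_real_derivative deriv (mean_curv r) x) (at x)"
    and "(deriv (mean_curv r) has_real_derivative deriv (deriv (mean_curv r)) x) (at x)"
proof -
  have nz: "r x \<noteq> 0" "line_elem r x \<noteq> 0" for x using pos[of x] line_elem_pos[of r x] by auto
  define D where "D = (\<lambda>x. - (deriv r x * line_elem r x + r x * (deriv r x * deriv (deriv r) x / line_elem r x)) / (r x * line_elem r x)^2
    - (deriv (deriv (deriv r)) x / line_elem r x ^ 3
       - 3 * deriv (deriv r) x * (deriv r x * deriv (deriv r) x / line_elem r x) / line_elem r x ^ 4))"
  have D: "(mean_curv r has_real_derivative D x) (at x)" for x
    unfolding mean_curv_line_elem[abs_def] D_def using nz
    by (auto intro!: derivative_eq_intros Ck4_derivs[OF r] line_elem_has_deriv[OF r])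
       (simp add: field_simps eval_nat_numeral)
  then have eq: "deriv (mean_curv r) = D" by (auto intro: DERIV_imp_deriv)
  show "(mean_curv r has_real_derivative deriv (mean_curv r) x) (at x)" using D eq by simp
  have "\<exists>E. (D has_real_derivative E) (at x)"
    unfolding D_def using nz
    by (auto intro!: exI derivative_eq_intros Ck4_derivs[OF r] line_elem_has_deriv[OF r])
  then show "(deriv (mean_curv r) has_real_derivative deriv (deriv (mean_curv r)) x) (at x)"
    unfolding eq by (auto simp: DERIV_imp_deriv)
qed

lemma flux_has_deriv:
  assumes r: "r \<in> Ck_circle 4" and pos: "\<And>x. r x > 0"
  shows "(flux r has_real_derivative r x * G_op r x) (at x)"
proof -
  have nz: "r x \<noteq> 0" "line_elem r x \<noteq> 0" for x using pos[of x] line_elem_pos[of r x] by auto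
  have "\<exists>E. (flux r has_real_derivative E) (at x)"
    unfolding flux_def using nz
    by (auto intro!: exI derivative_eq_intros Ck4_derivs[OF r] line_elem_has_deriv[OF r] mean_curv_has_derivs[OF assms])
  moreover have "r x * G_op r x = deriv (flux r) x"
    using nz by (simp add: G_op_def flux_def line_elem_def)
  ultimately show ?thesis by (auto simp: DERIV_imp_deriv)
qed

section \<open>Parity, periodicity and equilibria\<close>

lemma even_deriv:
  fixes f :: "real \<Rightarrow> real"
  assumes "\<And>x. f (- x) = f x" "\<And>x. (f has_real_derivative f' x) (at x)"
  shows "f' (- x) = - f' x"
proof -
  have "((\<lambda>x. f (- x)) has_real_derivative f' (- x) * (- 1)) (at x)"
    by (rule DERIV_chain'[where g = f, OF _ assms(2)]) (auto intro!: derivative_eq_intros)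
  then have "(f has_real_derivative - f' (- x)) (at x)" using assms(1) by simp
  from DERIV_unique[OF this assms(2)] show ?thesis by simp
qed

lemma odd_deriv:
  fixes f :: "real \<Rightarrow> real"
  assumes "\<And>x. f (- x) = - f x" "\<And>x. (f has_real_derivative f' x) (at x)"
  shows "f' (- x) = f' x"
proof -
  have "((\<lambda>x. - f (- x)) has_real_derivative - (f' (- x) * (- 1))) (at x)"
    by (intro DERIV_minus DERIV_chain'[where g = f, OF _ assms(2)]) (auto intro!: derivative_eq_intros)
  then have "(f has_real_derivative f' (- x)) (at x)" using assms(1) by simp
  from DERIV_unique[OF this assms(2)] show ?thesis by simp
qed

text \<open>Evenness fixes the constant of integration: the curvature of an even profile is even, so
  its derivative vanishes at 0. This is why primitives are normalized at 0 throughout.\<close>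

lemma flux_0:
  assumes r: "r \<in> Ck_circle 4" and pos: "\<And>x. r x > 0" and even: "\<And>x. r (- x) = r x"
  shows "flux r 0 = 0"
proof -
  have o: "deriv r (- x) = - deriv r x" for x
    using even_deriv[of r, OF even Ck4_derivs(1)[OF r]] .
  have e: "deriv (deriv r) (- x) = deriv (deriv r) x" for x
    using odd_deriv[of "deriv r", OF o Ck4_derivs(2)[OF r]] .
  have "mean_curv r (- x) = mean_curv r x" for x
    by (simp add: mean_curv_def even o e)
  from even_deriv[of "mean_curv r", OF this mean_curv_has_derivs(1)[OF r pos], of 0]
  have "deriv (mean_curv r) 0 = 0" by simp
  then show ?thesis by (simp add: flux_def)
qed

lemma flux_periodic:
  assumes per: "\<And>x. r (x + 2 * pi) = r x"
  shows "flux r (x + 2 * pi) = flux r x"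
proof -
  have 1: "deriv r (x + 2 * pi) = deriv r x" for x by (rule deriv_shift) (rule per)
  have 2: "deriv (deriv r) (x + 2 * pi) = deriv (deriv r) x" for x by (rule deriv_shift) (rule 1)
  have "mean_curv r (x + 2 * pi) = mean_curv r x" for x
    by (simp add: mean_curv_def per 1 2)
  then have "deriv (mean_curv r) (x + 2 * pi) = deriv (mean_curv r) x" for x by (rule deriv_shift)
  then show ?thesis by (simp add: flux_def line_elem_def per 1)
qed

lemma flux_pi: "r \<in> Ck_circle 4 \<Longrightarrow> flux r pi = flux r (- pi)"
  using flux_periodic[of r "- pi"] by (simp add: Ck_circle_def)

text \<open>The flux is periodic; geometrically, surface diffusion conserves the enclosed
  volume.\<close>

lemma r_G_integral:
  assumes r: "r \<in> Ck_circle 4" and pos: "\<And>x. r x > 0"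
  shows "((\<lambda>x. r x * G_op r x) has_integral 0) {-pi..pi}"
proof -
  have "((\<lambda>x. r x * G_op r x) has_integral flux r pi - flux r (- pi)) {-pi..pi}"
    by (rule has_integral_deriv_circle) (rule flux_has_deriv[OF assms])
  then show ?thesis by (simp add: flux_pi[OF r])
qed

lemma integral_pos_circle:
  fixes r :: "real \<Rightarrow> real"
  assumes cont: "continuous_on {-pi..pi} r" and pos: "\<And>x. r x > 0"
  shows "integral {-pi..pi} r > 0"
proof -
  have "integral {-pi..pi} r \<ge> 0"
    by (rule integral_nonneg) (use integrable_continuous_real[OF cont] pos in \<open>auto intro: less_imp_le\<close>)
  moreover have "integral {-pi..pi} r = 0 \<longleftrightarrow> (\<forall>x\<in>{-pi..pi}. r x = 0)"
    using pos by (intro integral_eq_0_iff cont) (auto intro: less_imp_le)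
  then have "integral {-pi..pi} r \<noteq> 0" using pos[of 0] by force
  ultimately show ?thesis by simp
qed

text \<open>A vanishing projection only says that G(r) is a constant m. Weighting with r > 0 and
  using volume conservation forces m = 0; the flux is then constant, and it vanishes at 0.\<close>

lemma equilibrium_mean_curv_const:
  assumes r: "r \<in> Ck_circle 4" and pos: "\<And>x. r x > 0" and even: "\<And>x. r (- x) = r x"
    and eq: "P0 (G_op r) = (\<lambda>x. 0)"
  shows "mean_curv r x = mean_curv r 0"
proof -
  define m where "m = 1 / (2 * pi) * integral {-pi..pi} (G_op r)"
  have G: "G_op r x = m" for x using fun_cong[OF eq, of x] by (simp add: P0_def m_def)
  have cont: "continuous_on {-pi..pi} r" using Ck_circle_continuous[OF r, of 0] by simp
  have "(r has_integral integral {-pi..pi} r) {-pi..pi}"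
    using cont integrable_continuous_real by blast
  then have "((\<lambda>x. r x * m) has_integral integral {-pi..pi} r * m) {-pi..pi}"
    by (rule has_integral_mult_left)
  moreover have "((\<lambda>x. r x * m) has_integral 0) {-pi..pi}"
    using r_G_integral[OF r pos] by (simp add: G)
  ultimately have "integral {-pi..pi} r * m = 0" by (rule has_integral_unique)
  moreover have "integral {-pi..pi} r \<noteq> 0"
    using integral_pos_circle[OF cont pos] by simp
  ultimately have "m = 0" by simp
  then have "(flux r has_real_derivative 0) (at x)" for x
    using flux_has_deriv[OF r pos, of x] by (simp add: G)
  then have "flux r x = flux r 0" for x by (intro DERIV_isconst_all) auto
  then have "flux r x = 0" for x using flux_0[OF r pos even] by simp
  then have "deriv (mean_curv r) x = 0" for x
    using pos[of x] line_elem_pos[of r x] by (metis divide_eq_0_iff flux_def less_irrefl mult_eq_0_iff)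
  then have "(mean_curv r has_real_derivative 0) (at x)" for x
    using mean_curv_has_derivs(1)[OF r pos, of x] by simp
  then show ?thesis by (intro DERIV_isconst_all) auto
qed

section \<open>The explicit lift\<close>

definition lift_mean :: "real \<Rightarrow> (real \<Rightarrow> real) \<Rightarrow> real" where
  "lift_mean lam \<sigma> = sqrt (1 / lam^2 - 1 / (2 * pi) * integral {-pi..pi} (\<lambda>x. (\<sigma> x)^2))"

text \<open>The lift differs from \<sigma> by a constant. As \<sigma> has mean zero, the volume
  constraint is a quadratic equation without linear term for the mean of the profile, and positivity
  of the profile selects the positive root.\<close>

lemma G_bar_dom_lift:
  assumes \<alpha>: "0 < \<alpha>" "\<alpha> < 1" and lam: "lam > 0" and dom: "\<sigma> \<in> G_bar_dom \<alpha> lam"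
  shows "G_bar \<alpha> \<sigma> lam = P0 (G_op (\<lambda>x. \<sigma> x + lift_mean lam \<sigma>))"
    and "\<sigma> x + lift_mean lam \<sigma> > 0" and "lift_mean lam \<sigma> > 0"
    and "(lift_mean lam \<sigma>)^2 = 1 / lam^2 - 1 / (2 * pi) * integral {-pi..pi} (\<lambda>x. (\<sigma> x)^2)"
proof -
  obtain f where lift: "is_lift \<alpha> lam \<sigma> f" and X: "\<sigma> \<in> little_holder0_even 4 \<alpha>"
    using dom by (auto simp: G_bar_dom_def)
  define a where "a = 1 / (2 * pi) * integral {-pi..pi} f + 1 / lam"
  have "P0 f = \<sigma>" using lift by (simp add: is_lift_def)
  then have f: "f x + 1 / lam = \<sigma> x + a" for x
    by (auto simp: P0_def a_def)
  have pos: "\<sigma> x + a > 0" for x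
    using lift f[of x] by (simp add: is_lift_def) (metis add.commute diff_less_eq uminus_add_conv_diff diff_0 less_iff_diff_less_0 minus_diff_eq)
  have cont: "continuous_on {-pi..pi} \<sigma>"
    using Ck_circle_continuous[OF little_holder0_evenD(2)[OF X \<alpha>], of 0] by simp
  have i0: "(\<sigma> has_integral 0) {-pi..pi}" by (rule little_holder0_evenD(4)[OF X \<alpha>])
  have c: "((\<lambda>x. c) has_integral (2 * pi * c)) {-pi..pi}" for c :: real
    using has_integral_const_real[of c "-pi" pi] by simp
  have i2: "((\<lambda>x. (\<sigma> x)^2) has_integral integral {-pi..pi} (\<lambda>x. (\<sigma> x)^2)) {-pi..pi}"
    by (intro integrable_integral integrable_continuous_real continuous_intros cont)
  have "((\<lambda>x. \<sigma> x + a) has_integral 0 + 2 * pi * a) {-pi..pi}"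
    by (rule has_integral_add[OF i0 c])
  then have "2 * pi * a > 0"
    using integral_pos_circle[of "\<lambda>x. \<sigma> x + a", OF continuous_on_add[OF cont continuous_on_const] pos]
    by (simp add: integral_unique)
  then have apos: "a > 0" by (simp add: zero_less_mult_iff)
  have "F_star lam f = integral {-pi..pi} (\<lambda>x. (\<sigma> x)^2 + (2 * a) * \<sigma> x + a^2)"
    unfolding F_star_def f by (simp add: power2_sum algebra_simps)
  also have "\<dots> = integral {-pi..pi} (\<lambda>x. (\<sigma> x)^2) + (2 * a) * 0 + 2 * pi * a^2"
    by (intro integral_unique has_integral_add i2 c has_integral_mult_right i0)
  finally have "F_star lam f = integral {-pi..pi} (\<lambda>x. (\<sigma> x)^2) + 2 * pi * a^2" by simp
  moreover have "F_star lam (\<lambda>x. 0) = 2 * pi * (1 / lam)^2"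
    using integral_unique[OF c[of "(1 / lam)^2"]] by (simp add: F_star_def)
  ultimately have a2: "a^2 = 1 / lam^2 - 1 / (2 * pi) * integral {-pi..pi} (\<lambda>x. (\<sigma> x)^2)"
    using lift by (simp add: is_lift_def field_simps)
  then have a: "lift_mean lam \<sigma> = a" using apos unfolding lift_mean_def a2[symmetric] by simp
  show "lift_mean lam \<sigma> > 0" "\<sigma> x + lift_mean lam \<sigma> > 0" using apos pos a by auto
  show "(lift_mean lam \<sigma>)^2 = 1 / lam^2 - 1 / (2 * pi) * integral {-pi..pi} (\<lambda>x. (\<sigma> x)^2)"
    using a a2 by simp
  show "G_bar \<alpha> \<sigma> lam = P0 (G_op (\<lambda>x. \<sigma> x + lift_mean lam \<sigma>))"
    by (simp add: G_bar_def lift_map_eq[OF lift] f a)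
qed

lemma Ck_circle_add_const:
  "f \<in> Ck_circle 4 \<Longrightarrow> (\<lambda>x. f x + c) \<in> Ck_circle 4"
  using Ck_circle_linear[of f 4 "\<lambda>x. c" 1 1] by (simp add: Ck_circle_def higher_deriv_const)

section \<open>The linearization at an equilibrium\<close>

text \<open>Integration from 0 has norm at most pi < 4 in the sup norm on the interval, hence the
  \<open>e / 4\<close>. Applied twice, it carries convergence from r G(r) to the flux and from there
  to the mean curvature.\<close>

lemma primitive_uniform_limit:
  fixes \<Phi> \<phi> :: "real \<Rightarrow> real \<Rightarrow> real"
  assumes "\<forall>\<^sub>F t in F. \<forall>x. (\<Phi> t has_real_derivative \<phi> t x) (at x)" "\<forall>\<^sub>F t in F. \<Phi> t 0 = 0"
    and "\<And>x. (\<Psi> has_real_derivative \<psi> x) (at x)" "\<Psi> 0 = 0"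
    and lim: "uniform_limit {-pi..pi} \<phi> \<psi> F"
  shows "uniform_limit {-pi..pi} \<Phi> \<Psi> F"
proof (rule uniform_limitI)
  fix e :: real assume e: "e > 0"
  then have e4: "e / 4 > 0" by simp
  show "\<forall>\<^sub>F t in F. \<forall>x\<in>{-pi..pi}. dist (\<Phi> t x) (\<Psi> x) < e"
    using assms(1,2) uniform_limitD[OF lim e4]
  proof eventually_elim
    case (elim t)
    show ?case
    proof
    fix x assume x: "x \<in> {-pi..pi}"
    have "norm ((\<Phi> t x - \<Psi> x) - (\<Phi> t 0 - \<Psi> 0)) \<le> e / 4 * norm (x - 0)"
    proof (rule field_differentiable_bound[of "{-pi..pi}"])
      show "((\<lambda>x. \<Phi> t x - \<Psi> x) has_real_derivative \<phi> t y - \<psi> y) (at y within {-pi..pi})" for y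
        using elim(1) assms(3) by (intro DERIV_diff) (auto intro: has_field_derivative_at_within)
      show "norm (\<phi> t y - \<psi> y) \<le> e / 4" if "y \<in> {-pi..pi}" for y
        using elim(3) that by (auto simp: dist_norm less_imp_le)
    qed (use x in auto)
    also have "\<dots> \<le> e / 4 * pi" using x e by (intro mult_left_mono) auto
    also have "\<dots> < e" using e pi_less_4 by (simp add: field_simps)
    finally show "dist (\<Phi> t x) (\<Psi> x) < e" using elim(2) assms(4) by (simp add: dist_norm)
    qed
  qed
qed

text \<open>The first variation of \<open>mean_curv\<close> at \<open>r\<close> in the direction
  \<open>v\<close>, as \<open>mean_curv_directional_deriv\<close> confirms.\<close>

definition linearized_mean_curv :: "(real \<Rightarrow> real) \<Rightarrow> (real \<Rightarrow> real) \<Rightarrow> real \<Rightarrow> real" where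
  "linearized_mean_curv r v = (\<lambda>x. - v x / ((r x)^2 * line_elem r x) - deriv r x * deriv v x / (r x * line_elem r x ^ 3)
     - deriv (deriv v) x / line_elem r x ^ 3 + 3 * deriv (deriv r) x * deriv r x * deriv v x / line_elem r x ^ 5)"

lemma ex_primitive:
  fixes f :: "real \<Rightarrow> real"
  assumes "continuous_on UNIV f"
  shows "\<exists>g. (\<forall>x. (g has_real_derivative f x) (at x)) \<and> g 0 = 0"
proof -
  have c: "continuous_on A f" for A using assms continuous_on_subset by blast
  define g where "g = (\<lambda>x. if x \<ge> 0 then integral {0..x} f else - integral {x..0} f)"
  have "(g has_real_derivative f x) (at x)" for x
  proof -
    \<comment> \<open>With a base point to the left of both \<open>x\<close> and 0, a single
      indefinite integral covers both branches of \<open>g\<close> near \<open>x\<close> and differs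
      from \<open>g\<close> by a constant.\<close>
    define a where "a = min x 0 - 1"
    define b where "b = max x 0 + 1"
    have d: "((\<lambda>y. integral {a..y} f) has_real_derivative f x) (at x within {a..b})"
      by (rule integral_has_real_derivative[OF c]) (auto simp: a_def b_def)
    have "x \<in> interior {a..b}" by (auto simp: a_def b_def)
    then have "((\<lambda>y. integral {a..y} f) has_real_derivative f x) (at x)"
      using d at_within_interior by metis
    then have d: "((\<lambda>y. integral {a..y} f - integral {a..0} f) has_real_derivative f x) (at x)"
      using DERIV_diff[of _ "f x" x UNIV "\<lambda>_. integral {a..0} f" 0] by simp
    have "integral {a..y} f - integral {a..0} f = g y" if "y \<in> {a<..<b}" for y
    proof (cases "y \<ge> 0")
      case True
      then have "integral {a..0} f + integral {0..y} f = integral {a..y} f"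
        by (intro Henstock_Kurzweil_Integration.integral_combine integrable_continuous_real c) (simp_all add: a_def)
      then show ?thesis using True by (simp add: g_def)
    next
      case False
      then have "integral {a..y} f + integral {y..0} f = integral {a..0} f"
        by (intro Henstock_Kurzweil_Integration.integral_combine integrable_continuous_real c) (use that in \<open>simp_all add: a_def\<close>)
      then show ?thesis using False by (simp add: g_def)
    qed
    then show ?thesis
      by (intro has_field_derivative_transform_within_open[OF d, of "{a<..<b}"]) (auto simp: a_def b_def)
  qed
  moreover have "g 0 = 0" by (simp add: g_def)
  ultimately show ?thesis by blast
qed

section \<open>First variation of curvature and the eigenvalue equation\<close>

lemma deriv_comb:
  assumes "f \<in> Ck_circle 4" "g \<in> Ck_circle 4"
  shows "deriv (\<lambda>x. f x + t * g x + c) = (\<lambda>x. deriv f x + t * deriv g x)"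
    and "deriv (deriv (\<lambda>x. f x + t * g x + c)) = (\<lambda>x. deriv (deriv f) x + t * deriv (deriv g) x)"
proof -
  show 1: "deriv (\<lambda>x. f x + t * g x + c) = (\<lambda>x. deriv f x + t * deriv g x)"
    by (auto intro!: ext DERIV_imp_deriv derivative_eq_intros Ck4_derivs(1)[OF assms(1)] Ck4_derivs(1)[OF assms(2)])
  show "deriv (deriv (\<lambda>x. f x + t * g x + c)) = (\<lambda>x. deriv (deriv f) x + t * deriv (deriv g) x)"
    unfolding 1
    by (auto intro!: ext DERIV_imp_deriv derivative_eq_intros Ck4_derivs(2)[OF assms(1)] Ck4_derivs(2)[OF assms(2)])
qed

text \<open>The shift \<open>b t\<close> models the mean of the lifted profile, which moves with t
  because of the volume constraint; its velocity is added to the direction \<open>g\<close>.\<close>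

lemma mean_curv_directional_deriv:
  assumes f: "f \<in> Ck_circle 4" and g: "g \<in> Ck_circle 4"
    and b: "(b has_real_derivative b') (at 0)" and nz: "f x + b 0 \<noteq> 0"
  shows "((\<lambda>t. mean_curv (\<lambda>x. f x + t * g x + b t) x) has_real_derivative
      linearized_mean_curv (\<lambda>x. f x + b 0) (\<lambda>x. g x + b') x) (at 0)"
proof -
  define q where "q = (\<lambda>t. sqrt (1 + (deriv f x + t * deriv g x)^2))"
  have pos: "1 + (deriv f x + t * deriv g x)^2 > 0" for t by (simp add: add_pos_nonneg)
  have q0: "q 0 > 0" using pos[of 0] by (simp add: q_def)
  have q: "(q has_real_derivative deriv f x * deriv g x / q 0) (at 0)"
    unfolding q_def using pos[of 0] by (auto intro!: derivative_eq_intros simp: field_simps)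
  have m: "mean_curv (\<lambda>x. f x + t * g x + b t) x
     = 1 / ((f x + t * g x + b t) * q t) - (deriv (deriv f) x + t * deriv (deriv g) x) / q t ^ 3" for t
    unfolding mean_curv_line_elem line_elem_def deriv_comb(2)[OF f g] unfolding deriv_comb(1)[OF f g] q_def by simp
  have d1: "deriv (\<lambda>x. f x + b 0) = deriv f" "deriv (deriv (\<lambda>x. f x + b 0)) = deriv (deriv f)"
    using deriv_comb[OF f g, of 0 "b 0"] by simp_all
  have d2: "deriv (\<lambda>x. g x + b') = deriv g" "deriv (deriv (\<lambda>x. g x + b')) = deriv (deriv g)"
    using deriv_comb[OF g g, of 0 b'] by simp_all
  have a0: "line_elem (\<lambda>x. f x + b 0) x = q 0" by (simp add: line_elem_def d1 q_def)
  have "((\<lambda>t. 1 / ((f x + t * g x + b t) * q t)) has_real_derivative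
      - ((g x + b') * q 0 + (f x + b 0) * (deriv f x * deriv g x / q 0)) / ((f x + b 0) * q 0)^2) (at 0)"
    using q0 nz by (auto intro!: derivative_eq_intros q b simp: power2_eq_square)
  moreover have "((\<lambda>t. (deriv (deriv f) x + t * deriv (deriv g) x) / q t ^ 3) has_real_derivative
      (deriv (deriv g) x * q 0 ^ 3 - deriv (deriv f) x * (3 * q 0 ^ 2 * (deriv f x * deriv g x / q 0))) / (q 0 ^ 3)^2) (at 0)"
    using q0 by (auto intro!: derivative_eq_intros q simp: power2_eq_square)
  moreover have "- ((g x + b') * q 0 + (f x + b 0) * (deriv f x * deriv g x / q 0)) / ((f x + b 0) * q 0)^2
     = - (g x + b') / ((f x + b 0)^2 * q 0) - deriv f x * deriv g x / ((f x + b 0) * q 0 ^ 3)"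
  proof -
    have "- (z * Q + Y * (w / Q)) / (Y * Q)^2 = - z / (Y^2 * Q) - w / (Y * Q ^ 3)"
      if "Y \<noteq> 0" "Q \<noteq> 0" for z Q Y w :: real
      using that by (simp add: field_simps eval_nat_numeral)
    from this[OF nz less_imp_neq[OF q0, symmetric]] show ?thesis .
  qed
  moreover have "(deriv (deriv g) x * q 0 ^ 3 - deriv (deriv f) x * (3 * q 0 ^ 2 * (deriv f x * deriv g x / q 0))) / (q 0 ^ 3)^2
     = deriv (deriv g) x / q 0 ^ 3 - 3 * deriv (deriv f) x * deriv f x * deriv g x / q 0 ^ 5"
    using q0 by (simp add: field_simps eval_nat_numeral)
  ultimately have "((\<lambda>t. 1 / ((f x + t * g x + b t) * q t) - (deriv (deriv f) x + t * deriv (deriv g) x) / q t ^ 3)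
      has_real_derivative linearized_mean_curv (\<lambda>x. f x + b 0) (\<lambda>x. g x + b') x) (at 0)"
    unfolding linearized_mean_curv_def d1 d2 a0 by (auto intro: DERIV_diff[THEN DERIV_cong])
  then show ?thesis unfolding m .
qed


text \<open>At an equilibrium the base value drops out of the Frechet estimate. Dividing by t along
  the ray and bounding the sup norm by \<open>holder_norm 0 \<alpha>\<close> makes the convergence
  uniform in x.\<close>

lemma frechet_directional:
  assumes \<alpha>: "0 < \<alpha>" "\<alpha> < 1"
    and A: "has_D1_G_bar \<alpha> \<sigma> lam A" and u: "u \<in> little_holder0_even 4 \<alpha>"
    and eq: "G_bar \<alpha> \<sigma> lam = (\<lambda>x. 0)"
  shows "\<forall>\<^sub>F t in at 0. (\<lambda>x. \<sigma> x + t * u x) \<in> G_bar_dom \<alpha> lam"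
    and "uniform_limit UNIV (\<lambda>t x. G_bar \<alpha> (\<lambda>x. \<sigma> x + t * u x) lam x / t) (A u) (at 0)"
proof -
  note frechet = A[unfolded has_D1_G_bar_def has_frechet_deriv_def bounded_linear_betw_def]
  let ?n = "holder_norm 4 \<alpha>" and ?X = "little_holder0_even 4 \<alpha>"
  have uh: "u \<in> holder_space 4 \<alpha>" by (rule little_holder0_evenD(1)[OF u \<alpha>])
  have n0: "0 \<le> ?n u" using holder_norm_bound[OF uh, of 0 0] by simp
  have tu: "(\<lambda>x. t * u x) \<in> ?X" for t
    by (rule little_holder0_even_scale[OF u])
  have key: "\<forall>\<^sub>F t in at 0. (\<lambda>x. \<sigma> x + t * u x) \<in> G_bar_dom \<alpha> lam
      \<and> (\<forall>x. \<bar>G_bar \<alpha> (\<lambda>x. \<sigma> x + t * u x) lam x / t - A u x\<bar> < e)" if e: "e > 0" for e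
  proof -
    \<comment> \<open>The added 1 covers the case where the norm of \<open>u\<close> is 0, here and
      in the radius \<open>d / (?n u + 1)\<close> below.\<close>
    define e' where "e' = e / (2 * (?n u + 1))"
    have "e * ?n u < e * (2 * (?n u + 1))"
      using e n0 by (intro mult_strict_left_mono) auto
    then have e': "e' > 0" "e' * ?n u < e"
      using e n0 by (auto simp: e'_def divide_less_eq)
    obtain d where d: "d > 0" and dd: "\<And>h. h \<in> ?X \<Longrightarrow> ?n h < d \<Longrightarrow>
        (\<lambda>x. \<sigma> x + h x) \<in> G_bar_dom \<alpha> lam
        \<and> holder_norm 0 \<alpha> (\<lambda>x. G_bar \<alpha> (\<lambda>y. \<sigma> y + h y) lam x - G_bar \<alpha> \<sigma> lam x - A h x) \<le> e' * ?n h"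
      using frechet e'(1) by blast
    have "\<forall>\<^sub>F t in at (0::real). \<bar>t\<bar> < d / (?n u + 1)"
      using d n0 by (auto simp: eventually_at intro!: exI[of _ "d / (?n u + 1)"])
    moreover have "\<forall>\<^sub>F t in at (0::real). t \<noteq> 0" by (simp add: eventually_at_filter)
    ultimately show ?thesis
    proof eventually_elim
      case (elim t)
      have nt: "?n (\<lambda>x. t * u x) \<le> \<bar>t\<bar> * ?n u" by (rule holder_norm_scale_le[OF uh])
      also have "\<dots> \<le> \<bar>t\<bar> * (?n u + 1)" by (intro mult_left_mono) auto
      also have "\<dots> < d" using elim n0 by (simp add: field_simps)
      finally have lt: "?n (\<lambda>x. t * u x) < d" .
      let ?\<sigma> = "\<lambda>x. \<sigma> x + t * u x"
      let ?E = "\<lambda>x. G_bar \<alpha> ?\<sigma> lam x - G_bar \<alpha> \<sigma> lam x - A (\<lambda>x. t * u x) x"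
      have dom: "?\<sigma> \<in> G_bar_dom \<alpha> lam" using dd[OF tu lt] by blast
      have E: "?E = (\<lambda>x. 1 * G_bar \<alpha> ?\<sigma> lam x + (- t) * A u x)"
        using frechet u eq by auto
      have "G_bar \<alpha> ?\<sigma> lam \<in> holder_space 0 \<alpha>" "A u \<in> holder_space 0 \<alpha>"
        using frechet u dom by (auto intro!: little_holder0_evenD(1)[OF _ \<alpha>])
      then have "?E \<in> holder_space 0 \<alpha>" unfolding E by (intro holder_space_linear)
      from holder_norm_bound[OF this, of 0]
      have E0: "\<bar>?E x\<bar> \<le> holder_norm 0 \<alpha> ?E" for x by simp
      have "holder_norm 0 \<alpha> ?E \<le> e' * ?n (\<lambda>x. t * u x)" using dd[OF tu lt] by blast
      also have "\<dots> \<le> e' * (\<bar>t\<bar> * ?n u)" using nt e' by (intro mult_left_mono) auto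
      also have "\<dots> = \<bar>t\<bar> * (e' * ?n u)" by simp
      also have "\<dots> < \<bar>t\<bar> * e" using e' elim by (intro mult_strict_left_mono) auto
      finally have lt_e: "holder_norm 0 \<alpha> ?E < \<bar>t\<bar> * e" .
      have E_lt: "\<bar>G_bar \<alpha> ?\<sigma> lam x - t * A u x\<bar> < \<bar>t\<bar> * e" for x
        using le_less_trans[OF E0[of x] lt_e] fun_cong[OF E, of x] by simp
      have "\<bar>G_bar \<alpha> ?\<sigma> lam x / t - A u x\<bar> < e" for x
      proof -
        have "G_bar \<alpha> ?\<sigma> lam x / t - A u x = (G_bar \<alpha> ?\<sigma> lam x - t * A u x) / t"
          using elim by (simp add: field_simps)
        also have "\<bar>\<dots>\<bar> = \<bar>G_bar \<alpha> ?\<sigma> lam x - t * A u x\<bar> / \<bar>t\<bar>" by simp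
        also have "\<dots> < e" using E_lt[of x] elim by (simp add: field_simps)
        finally show ?thesis .
      qed
      with dom show ?case by blast
    qed
  qed
  show "\<forall>\<^sub>F t in at 0. (\<lambda>x. \<sigma> x + t * u x) \<in> G_bar_dom \<alpha> lam"
    using key[of 1] by (auto elim: eventually_mono)
  show "uniform_limit UNIV (\<lambda>t x. G_bar \<alpha> (\<lambda>x. \<sigma> x + t * u x) lam x / t) (A u) (at 0)"
    unfolding uniform_limit_iff dist_real_def using key by (auto intro: eventually_mono)
qed

text \<open>The root is the Euclidean norm of the vector (1, y), so this is the reverse triangle
  inequality. The constant 1 is global, which lets uniform limits pass through the line element
  without any boundedness assumption.\<close>

lemma sqrt_one_plus_square_Lipschitz: "\<bar>sqrt (1 + y^2) - sqrt (1 + z^2)\<bar> \<le> \<bar>y - z\<bar>"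
proof -
  have "\<bar>norm (1::real, y) - norm (1::real, z)\<bar> \<le> norm ((1::real, y) - (1, z))"
    by (rule norm_triangle_ineq3)
  then show ?thesis by (simp add: norm_prod_def)
qed

lemma uniform_limit_sqrt_one_plus_square:
  fixes f :: "'b \<Rightarrow> 'a \<Rightarrow> real"
  assumes "uniform_limit X f g F"
  shows "uniform_limit X (\<lambda>t x. sqrt (1 + (f t x)^2)) (\<lambda>x. sqrt (1 + (g x)^2)) F"
proof (rule uniform_limitI)
  fix e :: real assume "e > 0"
  from uniform_limitD[OF assms this]
  show "\<forall>\<^sub>F t in F. \<forall>x\<in>X. dist (sqrt (1 + (f t x)^2)) (sqrt (1 + (g x)^2)) < e"
  proof eventually_elim
    case (elim t)
    show ?case
    proof
      fix x assume "x \<in> X"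
      then have "\<bar>f t x - g x\<bar> < e" using elim by (simp add: dist_real_def)
      then show "dist (sqrt (1 + (f t x)^2)) (sqrt (1 + (g x)^2)) < e"
        using sqrt_one_plus_square_Lipschitz[of "f t x" "g x"] by (simp add: dist_real_def)
    qed
  qed
qed

text \<open>
  Only the sup norm part of the Frechet derivative enters: it yields the uniform limit of the divided
  differences of \<open>r G(r)\<close>, which is integrated twice to reach the mean curvature. So the
  fourth-order operator is never differentiated.
\<close>

lemma eigen_equation:
  assumes \<alpha>: "0 < \<alpha>" "\<alpha> < 1" and lam: "lam > 0"
    and A: "has_D1_G_bar \<alpha> \<sigma> lam A" and eq: "G_bar \<alpha> \<sigma> lam = (\<lambda>x. 0)"
    and u: "u \<in> little_holder0_even 4 \<alpha>" and Au: "A u = (\<lambda>x. \<mu> * u x)"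
  defines "a \<equiv> lift_mean lam \<sigma>"
  defines "r \<equiv> \<lambda>x. \<sigma> x + a"
  defines "v \<equiv> \<lambda>x. u x - integral {-pi..pi} (\<lambda>x. \<sigma> x * u x) / (2 * pi * a)"
  shows "\<exists>R K. (\<forall>x. (R has_real_derivative r x * v x) (at x)) \<and> R 0 = 0
    \<and> (\<forall>x. (K has_real_derivative line_elem r x / r x * R x) (at x)) \<and> K 0 = 0
    \<and> (\<forall>x\<in>{-pi..pi}. linearized_mean_curv r v x = linearized_mean_curv r v 0 + \<mu> * K x)"
proof -
  have \<sigma>dom: "\<sigma> \<in> G_bar_dom \<alpha> lam"
    using A by (auto simp: has_D1_G_bar_def has_frechet_deriv_def)
  then have \<sigma>: "\<sigma> \<in> little_holder0_even 4 \<alpha>" by (simp add: G_bar_dom_def)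
  have \<sigma>k: "\<sigma> \<in> Ck_circle 4" and uk: "u \<in> Ck_circle 4"
    using little_holder0_evenD(2)[OF _ \<alpha>] \<sigma> u by auto
  have c\<sigma>: "continuous_on S \<sigma>" and cu: "continuous_on S u" for S
    using Ck_circle_continuous[OF \<sigma>k, of 0] Ck_circle_continuous[OF uk, of 0] by auto
  have rk: "r \<in> Ck_circle 4" unfolding r_def by (rule Ck_circle_add_const[OF \<sigma>k])
  have even: "\<sigma> (- x) = \<sigma> x" "u (- x) = u x" for x
    using little_holder0_evenD(3)[OF _ \<alpha>] \<sigma> u by auto
  have a: "a > 0" "a^2 = 1 / lam^2 - 1 / (2 * pi) * integral {-pi..pi} (\<lambda>x. (\<sigma> x)^2)"
    and rpos: "r x > 0" for x
    unfolding a_def r_def using G_bar_dom_lift[OF \<alpha> lam \<sigma>dom] by auto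
  define W where "W = integral {-pi..pi} (\<lambda>x. \<sigma> x * u x)"
  define b where "b = - W / (2 * pi * a)"
  have v: "v = (\<lambda>x. u x + b)" by (simp add: v_def b_def W_def)

  define \<sigma>t where "\<sigma>t = (\<lambda>t x. \<sigma> x + t * u x)"
  define am where "am = (\<lambda>t. lift_mean lam (\<sigma>t t))"
  define rt where "rt = (\<lambda>t x. \<sigma> x + t * u x + am t)"
  have am0: "am 0 = a" and rt0: "rt 0 = r" by (simp_all add: am_def \<sigma>t_def a_def rt_def r_def)
  \<comment> \<open>The mean of the lifted profile along the ray is the root of a quadratic
    polynomial in t with constant term a^2 > 0, hence differentiable at 0 with the derivative
    \<open>b\<close>.\<close>
  have am_eq: "am t = sqrt (a^2 - 1 / (2 * pi) * (2 * t * W + t^2 * integral {-pi..pi} (\<lambda>x. (u x)^2)))" for t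
  proof -
    have "integral {-pi..pi} (\<lambda>x. (\<sigma>t t x)^2)
      = integral {-pi..pi} (\<lambda>x. (\<sigma> x)^2 + (2 * t) * (\<sigma> x * u x) + t^2 * (u x)^2)"
      unfolding \<sigma>t_def by (simp add: power2_eq_square algebra_simps)
    also have "\<dots> = integral {-pi..pi} (\<lambda>x. (\<sigma> x)^2) + (2 * t) * W + t^2 * integral {-pi..pi} (\<lambda>x. (u x)^2)"
      unfolding W_def
      by (intro integral_unique has_integral_add has_integral_mult_right integrable_integral
          integrable_continuous_real continuous_intros c\<sigma> cu)
    finally show ?thesis by (simp add: am_def lift_mean_def a(2) field_simps)
  qed
  have am_deriv: "(am has_real_derivative b) (at 0)"
  proof -
    have "(am has_real_derivative - (W / pi) / (2 * sqrt (a^2))) (at 0)"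
      unfolding am_eq using a(1)
      by (auto intro!: derivative_eq_intros simp: field_simps)
    then show ?thesis using a(1) by (simp add: b_def ac_simps)
  qed
  have am_lim: "(am \<longlongrightarrow> a) (at 0)"
    using DERIV_isCont[OF am_deriv] am0 by (simp add: isCont_def)
  have rtk: "rt t \<in> Ck_circle 4" for t
    unfolding rt_def using Ck_circle_add_const[OF Ck_circle_linear[OF \<sigma>k uk, of 1 t], of "am t"] by simp
  have dom: "\<forall>\<^sub>F t in at (0::real). \<sigma>t t \<in> G_bar_dom \<alpha> lam"
    and lim: "uniform_limit UNIV (\<lambda>t x. G_bar \<alpha> (\<sigma>t t) lam x / t) (\<lambda>x. \<mu> * u x) (at 0)"
    using frechet_directional[OF \<alpha> A u eq] by (auto simp: \<sigma>t_def Au)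
  \<comment> \<open>The projection hides the mean \<open>m t\<close> of G. Its rate
    \<open>m t / t\<close> is recovered in \<open>m_lim\<close> from the periodicity of the
    flux.\<close>
  define m where "m = (\<lambda>t. 1 / (2 * pi) * integral {-pi..pi} (G_op (rt t)))"
  have good: "\<forall>\<^sub>F t in at (0::real). (\<forall>x. rt t x > 0) \<and> (\<forall>x. G_op (rt t) x = G_bar \<alpha> (\<sigma>t t) lam x + m t)"
    using dom
  proof eventually_elim
    case (elim t)
    have "rt t = (\<lambda>x. \<sigma>t t x + lift_mean lam (\<sigma>t t))"
      by (simp add: rt_def \<sigma>t_def am_def)
    then show ?case
      using G_bar_dom_lift(1,2)[OF \<alpha> lam elim] by (simp add: P0_def m_def)
  qed

  have cP: "continuous_on S P" if "\<And>x. (P has_real_derivative p x) (at x)" for P p :: "real \<Rightarrow> real" and S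
    using that by (meson DERIV_isCont continuous_at_imp_continuous_on)
  have bdd: "bounded (f ` {-pi..pi})" if "continuous_on {-pi..pi} f" for f :: "real \<Rightarrow> real"
    using that by (intro compact_imp_bounded compact_continuous_image) auto
  have c_lim: "uniform_limit S (\<lambda>t x. f t) (\<lambda>x. l) F" if "(f \<longlongrightarrow> l) F" for f :: "real \<Rightarrow> real" and l F and S :: "real set"
    using that by (auto simp: uniform_limit_iff tendsto_iff elim: eventually_mono)
  have id_lim: "((\<lambda>t. t) \<longlongrightarrow> 0) (at_within (0::real) UNIV)" by (rule tendsto_ident_at)

  obtain S where S: "\<And>x. (S has_real_derivative \<sigma> x) (at x)" "S 0 = 0"
    using ex_primitive[OF c\<sigma>] by blast
  obtain U where U: "\<And>x. (U has_real_derivative u x) (at x)" "U 0 = 0"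
    using ex_primitive[OF cu] by blast
  obtain Y where Y: "\<And>x. (Y has_real_derivative r x * u x) (at x)" "Y 0 = 0"
  proof -
    have "continuous_on UNIV (\<lambda>x. r x * u x)"
      unfolding r_def by (intro continuous_intros c\<sigma> cu)
    then show ?thesis using ex_primitive that by blast
  qed
  note ftc = has_integral_deriv_circle
  have i\<sigma>: "(\<sigma> has_integral 0) {-pi..pi}" "(u has_integral 0) {-pi..pi}"
    using little_holder0_evenD(4)[OF _ \<alpha>] \<sigma> u by auto
  have Spi: "S pi = S (-pi)" and Upi: "U pi = U (-pi)"
    using has_integral_unique[OF ftc[OF S(1)] i\<sigma>(1)] has_integral_unique[OF ftc[OF U(1)] i\<sigma>(2)] by auto
  have Ypi: "Y pi - Y (-pi) = W"
  proof (rule has_integral_unique[OF ftc[OF Y(1)]])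
    have "((\<lambda>x. \<sigma> x * u x) has_integral W) {-pi..pi}"
      unfolding W_def by (intro integrable_integral integrable_continuous_real continuous_intros c\<sigma> cu)
    then have "((\<lambda>x. \<sigma> x * u x + a * u x) has_integral W + a * 0) {-pi..pi}"
      by (intro has_integral_add has_integral_mult_right i\<sigma>)
    then show "((\<lambda>x. r x * u x) has_integral W) {-pi..pi}" by (simp add: r_def algebra_simps)
  qed
  define Z where "Z = (\<lambda>t x. S x + t * U x + am t * x)"
  have Z: "(Z t has_real_derivative rt t x) (at x)" "Z t 0 = 0" for t x
    unfolding Z_def rt_def by (auto intro!: derivative_eq_intros S U simp: S U)
  have Z0: "Z 0 = (\<lambda>x. S x + a * x)" by (simp add: Z_def am0)
  \<comment> \<open>Divided flux with the contribution of the unknown mean removed: its derivative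
    involves only \<open>G_bar\<close>, whose divided values have a known uniform limit.\<close>
  define \<Phi> where "\<Phi> = (\<lambda>t x. flux (rt t) x / t - m t / t * Z t x)"
  have rt_lim: "uniform_limit {-pi..pi} rt r (at 0)"
  proof -
    have "uniform_limit {-pi..pi} (\<lambda>t x. \<sigma> x + t * u x + am t) (\<lambda>x. \<sigma> x + 0 * u x + a) (at 0)"
      by (intro uniform_limit_add uniform_lim_mult c_lim am_lim id_lim uniform_limit_const bdd cu continuous_on_const)
    then show ?thesis by (simp add: rt_def[abs_def] r_def)
  qed
  have Z_lim: "uniform_limit {-pi..pi} Z (Z 0) (at 0)"
  proof -
    have "uniform_limit {-pi..pi} (\<lambda>t x. S x + t * U x + am t * x) (\<lambda>x. S x + 0 * U x + a * x) (at 0)"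
      by (intro uniform_limit_add uniform_lim_mult c_lim am_lim id_lim uniform_limit_const bdd cP[OF U(1)] continuous_on_const continuous_on_id)
    then show ?thesis by (simp add: Z_def[abs_def] am0)
  qed
  have \<Phi>_lim: "uniform_limit {-pi..pi} \<Phi> (\<lambda>x. \<mu> * Y x) (at 0)"
  proof (rule primitive_uniform_limit[where \<phi> = "\<lambda>t x. rt t x * (G_bar \<alpha> (\<sigma>t t) lam x / t)"])
    show "\<forall>\<^sub>F t in at (0::real). \<forall>x. (\<Phi> t has_real_derivative rt t x * (G_bar \<alpha> (\<sigma>t t) lam x / t)) (at x)"
      using good
    proof eventually_elim
      case (elim t)
      show ?case
      proof
        fix x
        have "(\<Phi> t has_real_derivative rt t x * G_op (rt t) x / t - m t / t * rt t x) (at x)"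
          unfolding \<Phi>_def using elim
          by (intro DERIV_diff DERIV_cdivide DERIV_cmult flux_has_deriv rtk Z) auto
        also have "rt t x * G_op (rt t) x / t - m t / t * rt t x = rt t x * (G_bar \<alpha> (\<sigma>t t) lam x / t)"
          using elim by (simp add: distrib_left add_divide_distrib)
        finally show "(\<Phi> t has_real_derivative rt t x * (G_bar \<alpha> (\<sigma>t t) lam x / t)) (at x)" .
      qed
    qed
    show "\<forall>\<^sub>F t in at (0::real). \<Phi> t 0 = 0"
      using good
    proof eventually_elim
      case (elim t)
      then have "flux (rt t) 0 = 0" by (intro flux_0 rtk) (auto simp: rt_def even)
      then show ?case by (simp add: \<Phi>_def Z)
    qed
    show "((\<lambda>x. \<mu> * Y x) has_real_derivative r x * (\<mu> * u x)) (at x)" for x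
      using DERIV_cmult[OF Y(1), of \<mu>] by (simp add: ac_simps)
    show "\<mu> * Y 0 = 0" by (simp add: Y)
    show "uniform_limit {-pi..pi} (\<lambda>t x. rt t x * (G_bar \<alpha> (\<sigma>t t) lam x / t)) (\<lambda>x. r x * (\<mu> * u x)) (at 0)"
      by (intro uniform_lim_mult rt_lim uniform_limit_on_subset[OF lim] bdd)
         (auto simp: r_def intro!: continuous_intros c\<sigma> cu)
  qed
  \<comment> \<open>The flux takes equal values at both ends of the period, so the jump of
    \<open>\<Phi> t\<close> is - (m t / t) times 2 pi am t. Passing to the limit on the left side
    determines the rate of the mean.\<close>
  have m_lim: "((\<lambda>t. m t / t) \<longlongrightarrow> \<mu> * b) (at 0)"
  proof -
    have "((\<lambda>t. - (\<Phi> t pi - \<Phi> t (-pi)) / (2 * pi * am t)) \<longlongrightarrow> - (\<mu> * Y pi - \<mu> * Y (-pi)) / (2 * pi * a)) (at 0)"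
      using a(1) by (intro tendsto_intros am_lim tendsto_uniform_limitI[OF \<Phi>_lim]) auto
    also have "- (\<mu> * Y pi - \<mu> * Y (-pi)) / (2 * pi * a) = \<mu> * b"
      using Ypi by (simp add: b_def flip: right_diff_distrib)
    finally show ?thesis
    proof (rule Lim_transform_eventually)
      show "\<forall>\<^sub>F t in at (0::real). - (\<Phi> t pi - \<Phi> t (-pi)) / (2 * pi * am t) = m t / t"
        using order_tendstoD(1)[OF am_lim a(1)]
      proof eventually_elim
        case (elim t)
        have "\<Phi> t pi - \<Phi> t (-pi) = - (m t / t * (Z t pi - Z t (-pi)))"
          using flux_pi[OF rtk, of t] by (simp add: \<Phi>_def right_diff_distrib)
        also have "Z t pi - Z t (-pi) = 2 * pi * am t"
          by (simp add: Z_def Spi Upi)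
        finally show ?case using elim by simp
      qed
    qed
  qed
  \<comment> \<open>The mean contributes \<mu> b to the limit and turns \<mu> u into \<mu> v; hence
    the limit of the divided flux is \<mu> times a primitive of r v.\<close>
  define R where "R = (\<lambda>x. Y x + b * (S x + a * x))"
  have R: "(R has_real_derivative r x * v x) (at x)" "R 0 = 0" for x
    unfolding R_def by (auto intro!: derivative_eq_intros Y S simp: Y S r_def v algebra_simps)
  have arck: "continuous_on X (line_elem r)" for X
    by (rule cP[OF line_elem_has_deriv[OF rk]])
  have "continuous_on UNIV (\<lambda>x. line_elem r x / r x * R x)"
    using rpos by (intro continuous_intros arck cP[OF R(1)] cP[OF Ck4_derivs(1)[OF rk]]) (metis less_irrefl)
  from ex_primitive[OF this] obtain K where
    K: "\<And>x. (K has_real_derivative line_elem r x / r x * R x) (at x)" "K 0 = 0" by blast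
  have flux_lim: "uniform_limit {-pi..pi} (\<lambda>t x. flux (rt t) x / t) (\<lambda>x. \<mu> * R x) (at 0)"
  proof -
    have "uniform_limit {-pi..pi} (\<lambda>t x. \<Phi> t x + m t / t * Z t x) (\<lambda>x. \<mu> * Y x + \<mu> * b * Z 0 x) (at 0)"
      by (intro uniform_limit_add uniform_lim_mult c_lim m_lim \<Phi>_lim Z_lim bdd cP[OF Z(1)] continuous_on_const)
    then show ?thesis by (simp add: \<Phi>_def R_def Z0 distrib_left mult.assoc)
  qed
  have arc_lim: "uniform_limit {-pi..pi} (\<lambda>t. line_elem (rt t)) (line_elem r) (at 0)"
  proof -
    have "uniform_limit {-pi..pi} (\<lambda>t x. deriv \<sigma> x + t * deriv u x) (\<lambda>x. deriv \<sigma> x + 0 * deriv u x) (at 0)"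
      by (intro uniform_limit_add uniform_lim_mult c_lim id_lim uniform_limit_const bdd cP[OF Ck4_derivs(2)[OF uk]] continuous_on_const)
    moreover have "deriv (rt t) = (\<lambda>x. deriv \<sigma> x + t * deriv u x)" for t
      unfolding rt_def by (rule deriv_comb[OF \<sigma>k uk])
    ultimately have "uniform_limit {-pi..pi} (\<lambda>t. deriv (rt t)) (deriv r) (at 0)"
      by (simp flip: rt0)
    then show ?thesis unfolding line_elem_def by (rule uniform_limit_sqrt_one_plus_square)
  qed
  have cr: "continuous_on X r" for X by (rule cP[OF Ck4_derivs(1)[OF rk]])
  obtain x0 where x0: "x0 \<in> {-pi..pi}" "\<And>x. x \<in> {-pi..pi} \<Longrightarrow> r x0 \<le> r x"
    using continuous_attains_inf[of "{-pi..pi}" r] cr by auto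
  have H'_lim: "uniform_limit {-pi..pi} (\<lambda>t x. line_elem (rt t) x / rt t x * (flux (rt t) x / t)) (\<lambda>x. line_elem r x / r x * (\<mu> * R x)) (at 0)"
    using rpos[of x0]
    by (intro uniform_lim_mult uniform_lim_divide[where b = "r x0"] arc_lim rt_lim flux_lim bdd continuous_intros cr arck cP[OF R(1)])
       (use x0(2) rpos in \<open>auto simp: less_imp_neq[symmetric] abs_of_pos\<close>)
  \<comment> \<open>Second integration: the mean curvature has the derivative q / r times the flux,
    and subtracting its value at 0 fixes the constant.\<close>
  have H_lim: "uniform_limit {-pi..pi} (\<lambda>t x. (mean_curv (rt t) x - mean_curv (rt t) 0) / t) (\<lambda>x. \<mu> * K x) (at 0)"
  proof (rule primitive_uniform_limit[OF _ _ _ _ H'_lim])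
    show "\<forall>\<^sub>F t in at (0::real). \<forall>x. ((\<lambda>x. (mean_curv (rt t) x - mean_curv (rt t) 0) / t) has_real_derivative
        line_elem (rt t) x / rt t x * (flux (rt t) x / t)) (at x)"
      using good
    proof eventually_elim
      case (elim t)
      show ?case
      proof
        fix x
        have "((\<lambda>x. (mean_curv (rt t) x - mean_curv (rt t) 0) / t) has_real_derivative
          (deriv (mean_curv (rt t)) x - 0) / t) (at x)"
          by (intro DERIV_cdivide DERIV_diff mean_curv_has_derivs rtk DERIV_const) (use elim in auto)
        moreover have "rt t x \<noteq> 0" "line_elem (rt t) x \<noteq> 0" using elim line_elem_pos[of "rt t" x] by (auto simp: less_imp_neq[symmetric])
        then have "line_elem (rt t) x / rt t x * (flux (rt t) x / t) = (deriv (mean_curv (rt t)) x - 0) / t"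
          by (simp add: flux_def)
        ultimately show "((\<lambda>x. (mean_curv (rt t) x - mean_curv (rt t) 0) / t) has_real_derivative
          line_elem (rt t) x / rt t x * (flux (rt t) x / t)) (at x)" by simp
      qed
    qed
    show "((\<lambda>x. \<mu> * K x) has_real_derivative line_elem r x / r x * (\<mu> * R x)) (at x)" for x
      using DERIV_cmult[OF K(1), of \<mu>] by (simp add: ac_simps)
  qed (auto simp: K)
  \<comment> \<open>At t = 0 the curvature difference between \<open>x\<close> and 0 vanishes, which
    makes the quotient in \<open>H_lim\<close> a difference quotient.\<close>
  have const: "mean_curv r x = mean_curv r 0" for x
    using eq G_bar_dom_lift(1)[OF \<alpha> lam \<sigma>dom]
    by (intro equilibrium_mean_curv_const rk rpos) (auto simp: r_def even a_def)
  have dH: "((\<lambda>t. mean_curv (rt t) x) has_real_derivative linearized_mean_curv r v x) (at 0)" for x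
    using mean_curv_directional_deriv[OF \<sigma>k uk am_deriv, of x] rpos[of x]
    unfolding rt_def r_def v am0 by auto
  have "linearized_mean_curv r v x = linearized_mean_curv r v 0 + \<mu> * K x" if x: "x \<in> {-pi..pi}" for x
  proof -
    have "((\<lambda>t. mean_curv (rt t) x - mean_curv (rt t) 0) has_real_derivative
      linearized_mean_curv r v x - linearized_mean_curv r v 0) (at 0)"
      by (intro DERIV_diff dH)
    then have "((\<lambda>t. (mean_curv (rt t) x - mean_curv (rt t) 0) / t) \<longlongrightarrow>
      linearized_mean_curv r v x - linearized_mean_curv r v 0) (at 0)"
      unfolding has_field_derivative_iff using const[of x] by (simp add: rt0)
    from tendsto_unique[OF _ this tendsto_uniform_limitI[OF H_lim x]] show ?thesis by simp
  qed
  with R K show ?thesis by blast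
qed

section \<open>Uniform convergence of families and a perturbed oscillator\<close>

text \<open>Bundling continuity with uniform convergence gives closure under products, quotients
  with nonvanishing limit, and integration: limits are bounded on the compact interval, and the
  members are integrable for s near 0.\<close>

definition ulim :: "(real \<Rightarrow> real \<Rightarrow> real) \<Rightarrow> (real \<Rightarrow> real) \<Rightarrow> bool" where
  "ulim f g \<longleftrightarrow> uniform_limit {-pi..pi} f g (at 0)
     \<and> (\<forall>\<^sub>F s in at 0. continuous_on {-pi..pi} (f s)) \<and> continuous_on {-pi..pi} g"

lemma ulim_bounded: "ulim f g \<Longrightarrow> bounded (g ` {-pi..pi})"
  unfolding ulim_def by (intro compact_imp_bounded compact_continuous_image) auto

lemma ulim_fun: "continuous_on {-pi..pi} g \<Longrightarrow> ulim (\<lambda>s. g) g"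
  by (simp add: ulim_def uniform_limit_const)

lemma ulim_scalar: "(f \<longlongrightarrow> l) (at 0) \<Longrightarrow> ulim (\<lambda>s x. f s) (\<lambda>x. l)"
  by (auto simp: ulim_def uniform_limit_iff tendsto_iff elim: eventually_mono)

lemma ulim_add:
  assumes "ulim f F" "ulim g G" shows "ulim (\<lambda>s x. f s x + g s x) (\<lambda>x. F x + G x)"
  using assms unfolding ulim_def
  by (auto intro!: uniform_limit_add continuous_intros elim: eventually_elim2)

lemma ulim_diff:
  assumes "ulim f F" "ulim g G" shows "ulim (\<lambda>s x. f s x - g s x) (\<lambda>x. F x - G x)"
  using assms unfolding ulim_def
  by (auto intro!: uniform_limit_minus continuous_intros elim: eventually_elim2)

lemma ulim_mult:
  assumes "ulim f F" "ulim g G" shows "ulim (\<lambda>s x. f s x * g s x) (\<lambda>x. F x * G x)"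
  using assms ulim_bounded[OF assms(1)] ulim_bounded[OF assms(2)] unfolding ulim_def
  by (auto intro!: uniform_lim_mult continuous_intros elim: eventually_elim2)

lemma ulim_minus:
  assumes "ulim f F" shows "ulim (\<lambda>s x. - f s x) (\<lambda>x. - F x)"
  using ulim_mult[OF ulim_fun[OF continuous_on_const, of "- 1"] assms] by simp

lemma ulim_power:
  assumes "ulim f F" shows "ulim (\<lambda>s x. f s x ^ n) (\<lambda>x. F x ^ n)"
proof (induction n)
  case 0
  then show ?case by (simp add: ulim_fun)
next
  case (Suc n)
  then show ?case using ulim_mult[OF assms Suc] by simp
qed

text \<open>By compactness the modulus of \<open>G\<close> has a positive minimum b. It is the lower
  bound for uniform division and also keeps \<open>g s\<close> away from 0 once \<open>g s\<close>
  is within b of \<open>G\<close>.\<close>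

lemma ulim_divide:
  assumes f: "ulim f F" and g: "ulim g G" and nz: "\<And>x. x \<in> {-pi..pi} \<Longrightarrow> G x \<noteq> 0"
  shows "ulim (\<lambda>s x. f s x / g s x) (\<lambda>x. F x / G x)"
proof -
  have "continuous_on {-pi..pi} (\<lambda>x. \<bar>G x\<bar>)" using g unfolding ulim_def by (auto intro: continuous_intros)
  from continuous_attains_inf[OF _ _ this] obtain x0 where
    x0: "x0 \<in> {-pi..pi}" "\<And>x. x \<in> {-pi..pi} \<Longrightarrow> \<bar>G x0\<bar> \<le> \<bar>G x\<bar>" by auto
  define b where "b = \<bar>G x0\<bar>"
  have b: "b > 0" "\<And>x. x \<in> {-pi..pi} \<Longrightarrow> b \<le> \<bar>G x\<bar>" using x0 nz by (auto simp: b_def)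
  have "\<forall>\<^sub>F s in at 0. \<forall>x\<in>{-pi..pi}. \<bar>g s x - G x\<bar> < b"
    using g b(1) unfolding ulim_def uniform_limit_iff dist_real_def by blast
  then have "\<forall>\<^sub>F s in at 0. \<forall>x\<in>{-pi..pi}. g s x \<noteq> 0"
    by eventually_elim (use b(2) in \<open>force\<close>)
  then have "\<forall>\<^sub>F s in at 0. continuous_on {-pi..pi} (\<lambda>x. f s x / g s x)"
    using f[unfolded ulim_def, THEN conjunct2, THEN conjunct1] g[unfolded ulim_def, THEN conjunct2, THEN conjunct1]
    by eventually_elim (auto intro!: continuous_intros)
  moreover have "uniform_limit {-pi..pi} (\<lambda>s x. f s x / g s x) (\<lambda>x. F x / G x) (at 0)"
    using f g ulim_bounded[OF f] b unfolding ulim_def by (intro uniform_lim_divide[where b = b]) auto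
  moreover have "continuous_on {-pi..pi} (\<lambda>x. F x / G x)"
    using f g nz unfolding ulim_def by (auto intro!: continuous_intros)
  ultimately show ?thesis by (simp add: ulim_def)
qed

lemma ulim_sqrt_one_plus_square:
  assumes "ulim p P" shows "ulim (\<lambda>s x. sqrt (1 + (p s x)^2)) (\<lambda>x. sqrt (1 + (P x)^2))"
proof -
  have "uniform_limit {-pi..pi} (\<lambda>s x. sqrt (1 + (p s x)^2)) (\<lambda>x. sqrt (1 + (P x)^2)) (at 0)"
    using assms unfolding ulim_def by (intro uniform_limit_sqrt_one_plus_square) auto
  moreover have "\<forall>\<^sub>F s in at 0. continuous_on {-pi..pi} (\<lambda>x. sqrt (1 + (p s x)^2))"
    using assms[unfolded ulim_def, THEN conjunct2, THEN conjunct1]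
    by eventually_elim (intro continuous_intros)
  ultimately show ?thesis using assms by (auto simp: ulim_def intro!: continuous_intros)
qed

text \<open>Lets the rules \<open>ulim_arith\<close> build the limit from the shape of the family;
  only afterwards is it compared with the intended limit.\<close>

lemma ulim_cong:
  assumes "ulim f G" "\<And>x. x \<in> {-pi..pi} \<Longrightarrow> G x = F x" shows "ulim f F"
  using assms uniform_limit_cong'[of "{-pi..pi}" f f G F "at 0"] continuous_on_cong[OF refl, of "{-pi..pi}" G F]
  by (simp add: ulim_def)

lemma ulim_integral:
  assumes "ulim f F" shows "((\<lambda>s. integral {-pi..pi} (f s)) \<longlongrightarrow> integral {-pi..pi} F) (at 0)"
proof -
  have c: "\<forall>\<^sub>F s in at 0. continuous_on {-pi..pi} (f s)" and F: "continuous_on {-pi..pi} F"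
    and lim: "uniform_limit {-pi..pi} f F (at 0)"
    using assms by (auto simp: ulim_def)
  show ?thesis
  proof (rule tendstoI)
    fix e :: real assume e: "e > 0"
    \<comment> \<open>The interval has length 2 pi < 8.\<close>
    then have e8: "e / 8 > 0" by simp
    show "\<forall>\<^sub>F s in at 0. dist (integral {-pi..pi} (f s)) (integral {-pi..pi} F) < e"
      using c uniform_limitD[OF lim e8]
    proof eventually_elim
      case (elim s)
      have i: "f s integrable_on {-pi..pi}" "F integrable_on {-pi..pi}"
        using elim F by (auto intro: integrable_continuous_real)
      have "norm (integral {-pi..pi} (\<lambda>x. f s x - F x)) \<le> e / 8 * (pi - (-pi))"
        by (rule integral_bound) (use elim F in \<open>auto intro!: continuous_intros simp: dist_norm less_imp_le\<close>)
      also have "\<dots> < e" using e pi_less_4 by (simp add: field_simps)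
      finally show ?case by (simp add: integral_diff[OF i] dist_norm)
    qed
  qed
qed

lemma ulim_primitive:
  assumes "ulim f g" "\<forall>\<^sub>F s in at 0. \<forall>x. (F s has_real_derivative f s x) (at x)" "\<forall>\<^sub>F s in at 0. F s 0 = 0"
    and G: "\<And>x. (G has_real_derivative g x) (at x)" "G 0 = 0"
  shows "ulim F G"
  unfolding ulim_def
proof (intro conjI)
  show "uniform_limit {-pi..pi} F G (at 0)"
    by (rule primitive_uniform_limit[OF assms(2,3) G]) (use assms(1) in \<open>simp add: ulim_def\<close>)
  show "\<forall>\<^sub>F s in at 0. continuous_on {-pi..pi} (F s)"
    using assms(2) by eventually_elim (auto intro!: continuous_at_imp_continuous_on intro: DERIV_isCont)
  show "continuous_on {-pi..pi} G"
    using G(1) by (auto intro!: continuous_at_imp_continuous_on intro: DERIV_isCont)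
qed

lemma ulim_eventually_less:
  assumes "ulim f (\<lambda>x. 0)" "e > 0" shows "\<forall>\<^sub>F s in at 0. \<forall>x\<in>{-pi..pi}. \<bar>f s x\<bar> < e"
  using assms unfolding ulim_def uniform_limit_iff dist_real_def by simp

lemma ulim_continuousD:
  assumes "ulim f F" shows "\<forall>\<^sub>F s in at 0. continuous_on {-pi..pi} (f s)"
  using assms by (simp add: ulim_def)

lemmas ulim_arith = ulim_add ulim_diff ulim_mult ulim_minus ulim_power ulim_divide ulim_sqrt_one_plus_square

section \<open>Trigonometric integrals and the oscillator estimate\<close>

lemma deriv_bound_from_0:
  fixes f :: "real \<Rightarrow> real"
  assumes "\<And>x. (f has_real_derivative f' x) (at x)" "f 0 = 0"
    and "\<And>x. x \<in> {-pi..pi} \<Longrightarrow> \<bar>f' x\<bar> \<le> B" and x: "x \<in> {-pi..pi}"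
  shows "\<bar>f x\<bar> \<le> 4 * B"
proof -
  have B: "B \<ge> 0" using assms(3)[of 0] by fastforce
  have "norm (f x - f 0) \<le> B * norm (x - 0)"
    by (rule field_differentiable_bound[of "{-pi..pi}" f f'])
       (use assms in \<open>auto intro: has_field_derivative_at_within\<close>)
  also have "\<dots> \<le> B * 4" using x pi_less_4 B by (intro mult_left_mono) auto
  finally show ?thesis using assms(2) by simp
qed

text \<open>Explicit primitives. Apart from a term linear in x, every summand contains the factor
  sin (l x), which vanishes at both end points; the linear term alone gives the value.\<close>

lemma trig_integrals:
  assumes l: "l \<ge> (1::nat)"
  defines "c \<equiv> \<lambda>x. cos (real l * x)"
  shows "(c has_integral 0) {-pi..pi}"
    "((\<lambda>x. (c x) ^ 2) has_integral pi) {-pi..pi}"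
    "((\<lambda>x. (c x) ^ 3) has_integral 0) {-pi..pi}"
    "((\<lambda>x. (c x) ^ 4) has_integral 3 * pi / 4) {-pi..pi}"
proof -
  define S where "S = (\<lambda>x. sin (real l * x))"
  have Spi: "S pi = 0" "S (-pi) = 0" by (simp_all add: S_def sin_npi sin_npi2)
  note ftc = has_integral_deriv_circle
  have sq: "S x * S x = 1 - c x * c x" for x
    using sin_cos_squared_add[of "real l * x"] by (simp add: S_def c_def power2_eq_square)
  have dS: "(S has_real_derivative real l * c x) (at x)" for x
    unfolding S_def c_def by (auto intro!: derivative_eq_intros)
  have dc: "(c has_real_derivative - real l * S x) (at x)" for x
    unfolding S_def c_def by (auto intro!: derivative_eq_intros)
  have l0: "real l \<noteq> 0" using l by simp
  have "((\<lambda>x. S x / l) has_real_derivative c x) (at x)" for x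
    using l0 by (auto intro!: derivative_eq_intros dS)
  from ftc[OF this] show "(c has_integral 0) {-pi..pi}" by (simp add: Spi)
  have d1: "((\<lambda>x. S x * c x) has_real_derivative real l * (c x * c x - S x * S x)) (at x)" for x
    by (auto intro!: derivative_eq_intros dS dc simp: algebra_simps)
  have d2: "((\<lambda>x. S x * (c x)^2) has_real_derivative real l * (c x ^ 3 - 2 * c x * (S x * S x))) (at x)" for x
    by (auto intro!: derivative_eq_intros dS dc simp: algebra_simps power2_eq_square power3_eq_cube)
  have d3: "((\<lambda>x. S x * c x ^ 3) has_real_derivative real l * (c x ^ 4 - 3 * (c x)^2 * (S x * S x))) (at x)" for x
    by (auto intro!: derivative_eq_intros dS dc simp: algebra_simps power2_eq_square power3_eq_cube power4_eq_xxxx)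
  have "((\<lambda>x. 1 / 2 * x + 1 / (2 * l) * (S x * c x)) has_real_derivative
      1 / 2 * 1 + 1 / (2 * l) * (real l * (c x * c x - S x * S x))) (at x)" for x
    by (intro DERIV_add DERIV_cmult d1 DERIV_ident)
  moreover have "1 / 2 * 1 + 1 / (2 * l) * (real l * (c x * c x - S x * S x)) = (c x)^2" for x
    using l0 by (simp add: sq power2_eq_square field_simps)
  ultimately have "((\<lambda>x. 1 / 2 * x + 1 / (2 * l) * (S x * c x)) has_real_derivative (c x)^2) (at x)" for x
    by simp
  from ftc[OF this] show "((\<lambda>x. (c x) ^ 2) has_integral pi) {-pi..pi}" by (simp add: Spi)
  have "((\<lambda>x. 1 / (3 * l) * (S x * (c x)^2) + 2 / (3 * l) * S x) has_real_derivative
      1 / (3 * l) * (real l * (c x ^ 3 - 2 * c x * (S x * S x))) + 2 / (3 * l) * (real l * c x)) (at x)" for x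
    by (intro DERIV_add DERIV_cmult d2 dS)
  moreover have "1 / (3 * l) * (real l * (c x ^ 3 - 2 * c x * (S x * S x))) + 2 / (3 * l) * (real l * c x) = (c x)^3" for x
  proof -
    have "1 / (3 * l) * (real l * A) = A / 3" "2 / (3 * l) * (real l * B) = 2 * B / 3" for A B
      using l0 by simp_all
    then show ?thesis by (simp only: sq) (simp add: power3_eq_cube field_simps)
  qed
  ultimately have "((\<lambda>x. 1 / (3 * l) * (S x * (c x)^2) + 2 / (3 * l) * S x) has_real_derivative (c x)^3) (at x)" for x
    by simp
  from ftc[OF this] show "((\<lambda>x. (c x) ^ 3) has_integral 0) {-pi..pi}" by (simp add: Spi)
  have "((\<lambda>x. 3 / 8 * x + 1 / (4 * l) * (S x * (c x)^3) + 3 / (8 * l) * (S x * c x)) has_real_derivative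
      3 / 8 * 1 + 1 / (4 * l) * (real l * (c x ^ 4 - 3 * (c x)^2 * (S x * S x)))
      + 3 / (8 * l) * (real l * (c x * c x - S x * S x))) (at x)" for x
    by (intro DERIV_add DERIV_cmult d1 d3 DERIV_ident)
  moreover have "3 / 8 * 1 + 1 / (4 * l) * (real l * (c x ^ 4 - 3 * (c x)^2 * (S x * S x)))
      + 3 / (8 * l) * (real l * (c x * c x - S x * S x)) = (c x)^4" for x
  proof -
    have "1 / (4 * l) * (real l * A) = A / 4" "3 / (8 * l) * (real l * B) = 3 * B / 8" for A B
      using l0 by simp_all
    then show ?thesis by (simp only: sq) (simp add: power2_eq_square power4_eq_xxxx field_simps)
  qed
  ultimately have "((\<lambda>x. 3 / 8 * x + 1 / (4 * l) * (S x * (c x)^3) + 3 / (8 * l) * (S x * c x)) has_real_derivative (c x)^4) (at x)" for x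
    by simp
  from ftc[OF this] show "((\<lambda>x. (c x) ^ 4) has_integral 3 * pi / 4) {-pi..pi}" by (simp add: Spi)
qed

text \<open>
  The smallness of \<open>\<integral>v\<close> is what controls the constant \<open>k\<close>, since
  \<open>v = v(0) cos (l x) - (k / l\<^sup>2) (1 - cos (l x))\<close> solves the unperturbed equation.
\<close>

lemma perturbed_oscillator:
  fixes v v1 v2 :: "real \<Rightarrow> real"
  assumes l: "l \<ge> (1::nat)"
    and v: "\<And>x. (v has_real_derivative v1 x) (at x)" and v1: "\<And>x. (v1 has_real_derivative v2 x) (at x)"
    and "v1 0 = 0"
    and e: "\<And>x. x \<in> {-pi..pi} \<Longrightarrow> \<bar>v2 x + (real l)^2 * v x + k\<bar> \<le> e"
    and I: "(v has_integral I) {-pi..pi}" "\<bar>I\<bar> \<le> e" and x: "x \<in> {-pi..pi}"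
  shows "\<bar>v x - v 0 * cos (l * x)\<bar> \<le> 40 * (real l)^2 * e"
    and "\<bar>v1 x + v 0 * l * sin (l * x)\<bar> \<le> 40 * (real l)^2 * e"
    and "\<bar>v2 x + v 0 * (real l)^2 * cos (l * x)\<bar> \<le> 40 * (real l)^2 * e"
proof -
  define m where "m = real l"
  have m: "m \<ge> 1" using l by (simp add: m_def)
  have m0: "m \<noteq> 0" and m2: "m \<le> m^2" "1 \<le> m^2" using m by (auto intro!: self_le_power one_le_power)
  have e0: "0 \<le> e" using I(2) by linarith
  define \<kappa> where "\<kappa> = k / m^2"
  have k: "k = m^2 * \<kappa>" using m0 by (simp add: \<kappa>_def)
  \<comment> \<open>Subtracts the exact solution of the unperturbed equation with the same initial
    data, so that \<open>z\<close> and \<open>z1\<close> vanish at 0 and z'' + m^2 z is the small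
    residual.\<close>
  define z where "z = (\<lambda>x. v x - v 0 * cos (m * x) + \<kappa> * (1 - cos (m * x)))"
  define z1 where "z1 = (\<lambda>x. v1 x + v 0 * m * sin (m * x) + \<kappa> * m * sin (m * x))"
  define z2 where "z2 = (\<lambda>x. v2 x + v 0 * m^2 * cos (m * x) + \<kappa> * m^2 * cos (m * x))"
  have dz: "(z has_real_derivative z1 x) (at x)" for x
    unfolding z_def z1_def by (auto intro!: derivative_eq_intros v)
  have dz1: "(z1 has_real_derivative z2 x) (at x)" for x
    unfolding z1_def z2_def by (auto intro!: derivative_eq_intros v1 simp: power2_eq_square)
  have z00: "z 0 = 0" "z1 0 = 0" using assms(4) by (simp_all add: z_def z1_def)
  have res: "z2 x + m^2 * z x = v2 x + m^2 * v x + k" for x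
    by (simp add: z_def z2_def k algebra_simps)
  have ze: "\<bar>z2 x + m^2 * z x\<bar> \<le> e" if "x \<in> {-pi..pi}" for x
    unfolding res using e[OF that] by (simp add: m_def)
  \<comment> \<open>Variation of constants: \<open>P\<close> and \<open>Q\<close> are the
    phase-plane coordinates (z', m z) in a rotating frame. Their derivatives are the residual times
    a sine or cosine, so they stay below 4 e.\<close>
  define P where "P = (\<lambda>x. z1 x * sin (m * x) - m * z x * cos (m * x))"
  define Q where "Q = (\<lambda>x. z1 x * cos (m * x) + m * z x * sin (m * x))"
  have dP: "(P has_real_derivative (z2 x + m^2 * z x) * sin (m * x)) (at x)" for x
    unfolding P_def by (auto intro!: derivative_eq_intros dz dz1 simp: algebra_simps power2_eq_square)
  have dQ: "(Q has_real_derivative (z2 x + m^2 * z x) * cos (m * x)) (at x)" for x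
    unfolding Q_def by (auto intro!: derivative_eq_intros dz dz1 simp: algebra_simps power2_eq_square)
  have tb: "\<bar>y * sin t\<bar> \<le> B" "\<bar>y * cos t\<bar> \<le> B" if "\<bar>y\<bar> \<le> B" for y t B :: real
    using that mult_mono[OF that abs_sin_le_one[of t]] mult_mono[OF that abs_cos_le_one[of t]]
    by (auto simp: abs_mult)
  have Pb: "\<bar>P x\<bar> \<le> 4 * e" if "x \<in> {-pi..pi}" for x
    by (rule deriv_bound_from_0[OF dP _ _ that]) (auto simp: P_def z00 intro!: tb ze)
  have Qb: "\<bar>Q x\<bar> \<le> 4 * e" if "x \<in> {-pi..pi}" for x
    by (rule deriv_bound_from_0[OF dQ _ _ that]) (auto simp: Q_def z00 intro!: tb ze)
  have sc: "sin (m * x) * sin (m * x) = 1 - cos (m * x) * cos (m * x)" for x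
    using sin_cos_squared_add[of "m * x"] by (simp add: power2_eq_square)
  have z1_eq: "z1 x = P x * sin (m * x) + Q x * cos (m * x)" for x
    unfolding P_def Q_def using sc[of x] by algebra
  have z1b: "\<bar>z1 x\<bar> \<le> 8 * e" if "x \<in> {-pi..pi}" for x
    using z1_eq[of x] tb(1)[OF Pb[OF that], of "m * x"] tb(2)[OF Qb[OF that], of "m * x"] by linarith
  have mz_eq: "m * z x = Q x * sin (m * x) - P x * cos (m * x)" for x
    unfolding P_def Q_def using sc[of x] by algebra
  have mzb: "\<bar>m * z x\<bar> \<le> 8 * e" if "x \<in> {-pi..pi}" for x
    using mz_eq[of x] tb(1)[OF Qb[OF that], of "m * x"] tb(2)[OF Pb[OF that], of "m * x"] by linarith
  have zb: "\<bar>z x\<bar> \<le> 8 * e" if "x \<in> {-pi..pi}" for x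
  proof -
    have "1 * \<bar>z x\<bar> \<le> m * \<bar>z x\<bar>" using m by (intro mult_right_mono) auto
    then show ?thesis using mzb[OF that] m by (simp add: abs_mult)
  qed
  have ci: "((\<lambda>x. cos (m * x)) has_integral 0) {-pi..pi}"
    using trig_integrals(1)[OF l] by (simp add: m_def)
  have "((\<lambda>x. 1) has_integral 2 * pi) {-pi..pi}"
    using has_integral_const_real[of "1::real" "-pi" pi] by simp
  \<comment> \<open>The cosines have mean zero, so the integral of \<open>z\<close> is I + 2 pi
    \<kappa>; since \<open>z\<close> and \<open>I\<close> are small, so is \<kappa>.\<close>
  then have zi: "(z has_integral I - v 0 * 0 + \<kappa> * (2 * pi - 0)) {-pi..pi}"
    unfolding z_def by (intro has_integral_add has_integral_diff has_integral_mult_right I ci)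
  have "norm (I - v 0 * 0 + \<kappa> * (2 * pi - 0)) \<le> 8 * e * measure lborel (cbox (-pi) pi)"
    by (rule has_integral_bound[of "8 * e" z]) (use zi zb e0 in \<open>auto simp: cbox_interval\<close>)
  then have "\<bar>I + 2 * pi * \<kappa>\<bar> \<le> 16 * pi * e" by (simp add: algebra_simps)
  then have "\<bar>2 * pi * \<kappa>\<bar> \<le> e + 16 * pi * e" using I(2) by linarith
  also have "\<dots> \<le> 2 * pi * (9 * e)"
  proof -
    have "1 * e \<le> 2 * pi * e" using e0 pi_gt3 by (intro mult_right_mono) auto
    then show ?thesis by simp
  qed
  finally have kb: "\<bar>\<kappa>\<bar> \<le> 9 * e" by (simp add: abs_mult)
  have kb2: "\<bar>k\<bar> \<le> m^2 * (9 * e)"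
    using mult_left_mono[OF kb, of "m^2"] by (simp add: k abs_mult)
  have kb1: "\<bar>\<kappa> * m\<bar> \<le> m * (9 * e)" using mult_left_mono[OF kb, of m] m by (simp add: abs_mult mult.commute)
  have b1: "e \<le> m^2 * e" "m * e \<le> m^2 * e" using m2 e0 mult_right_mono[of 1 "m^2" e] mult_right_mono[of m "m^2" e] by auto
  have "v x - v 0 * cos (m * x) = z x - \<kappa> + \<kappa> * cos (m * x)"
    by (simp add: z_def algebra_simps)
  \<comment> \<open>8 from \<open>z\<close> and twice 9 from \<kappa>. The worst of the three bounds
    is the last, with 1 + 26 + 9 = 36 times m^2 e, which the constant 40 covers.\<close>
  then have B0: "\<bar>v x - v 0 * cos (m * x)\<bar> \<le> 26 * e"
    using zb[OF x] kb tb(2)[OF kb, of "m * x"] by linarith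
  then show "\<bar>v x - v 0 * cos (l * x)\<bar> \<le> 40 * (real l)^2 * e"
    using b1 e0 unfolding m_def by linarith
  have "v1 x + v 0 * m * sin (m * x) = z1 x - \<kappa> * m * sin (m * x)" by (simp add: z1_def)
  then have "\<bar>v1 x + v 0 * m * sin (m * x)\<bar> \<le> 8 * e + m * (9 * e)"
    using z1b[OF x] tb(1)[OF kb1, of "m * x"] by linarith
  then show "\<bar>v1 x + v 0 * l * sin (l * x)\<bar> \<le> 40 * (real l)^2 * e"
    using b1 e0 unfolding m_def by linarith
  have "v2 x + v 0 * m^2 * cos (m * x) = (v2 x + m^2 * v x + k) - m^2 * (v x - v 0 * cos (m * x)) - k"
    by (simp add: algebra_simps)
  moreover have "\<bar>m^2 * (v x - v 0 * cos (m * x))\<bar> \<le> m^2 * (26 * e)"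
    unfolding abs_mult using B0 by (intro mult_mono) auto
  ultimately have "\<bar>v2 x + v 0 * m^2 * cos (m * x)\<bar> \<le> e + m^2 * (26 * e) + m^2 * (9 * e)"
    using e[OF x] kb2 unfolding m_def[symmetric] by linarith
  then show "\<bar>v2 x + v 0 * (real l)^2 * cos (l * x)\<bar> \<le> 40 * (real l)^2 * e"
    using b1 e0 unfolding m_def by linarith
qed

lemmas has_integral_arith = has_integral_add has_integral_diff has_integral_mult_right has_integral_mult_left
  has_integral_divide integrable_integral integrable_continuous_real continuous_intros

section \<open>Expansion along the branch\<close>

text \<open>The hypothesis says j = 1 / (a + s e) for i = 1 / a, in the form of a fixed-point
  equation. Iterating it yields the geometric series with exact remainder, free of division, so
  polynomial algebra suffices.\<close>

lemma inverse_expansion: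
  fixes i j s e :: real
  assumes j: "j = i - s * e * i * j"
  shows "j = i - s * e * i^2 + s^2 * e^2 * i ^ 3 - s ^ 3 * e ^ 3 * i ^ 3 * j"
    and "j^2 = i^2 - 2 * s * e * i ^ 3 + s^2 * e^2 * (3 * i^2 * j^2 + 2 * s * e * i ^ 3 * j^2)"
  using j by algebra+

text \<open>
  In the following identities \<open>i = 1/a\<close>, \<open>j = 1/r\<close>, \<open>Q = 1/q\<close> and \<open>Q3 = 1/q\<^sup>3\<close> with
  \<open>r = a + s e\<close> and \<open>q\<^sup>2 = 1 + s\<^sup>2 e1\<^sup>2\<close>; the remainders are kept exact.
\<close>

lemma weak_form_expansion:
  fixes i j s e :: real
  assumes j: "j = i - s * e * i * j" and Q: "Q = 1 - s^2 * e1^2 * G" and G: "G = 1 / 2 - s^2 * e1^2 * G2"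
    and e: "e = c + s * u" "e1 = c1 + s * u1"
  shows "c * j * Q + c1 * (s * e1) * Q = c * i + s * (c1^2 - c^2 * i^2)
     + s^2 * (u1 * c1 - u * c * i^2 + c ^ 3 * i ^ 3 - c * c1^2 * i / 2)
     + s ^ 3 * ((2 * c^2 * u + s * c * u^2) * i ^ 3 - (2 * c * c1 * u1 + s * c * u1^2) * i / 2
         - c * e ^ 3 * i ^ 3 * j + c * e1^2 * e * G * i * j - c1 * e1 ^ 3 * G + s * c * e1 ^ 4 * G2 * i)"
proof -
  have 1: "c * j * Q + c1 * (s * e1) * Q
    = c * j - s^2 * e1^2 * G * c * j + c1 * s * e1 - c1 * s ^ 3 * e1 ^ 3 * G"
    unfolding Q by algebra
  have 2: "s^2 * e1^2 * G * c * j = s^2 * e1^2 * c * i * G - s ^ 3 * e1^2 * e * c * i * j * G"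
    using j by algebra
  have 3: "s^2 * e1^2 * c * i * G = s^2 * e1^2 * c * i / 2 - s ^ 4 * e1 ^ 4 * G2 * c * i"
    by (subst G) (simp add: algebra_simps power2_eq_square power4_eq_xxxx)
  have 4: "c * j = c * i - s * c * e * i^2 + s^2 * c * e^2 * i ^ 3 - s ^ 3 * c * e ^ 3 * i ^ 3 * j"
    using inverse_expansion(1)[OF j] by algebra
  have 5: "s * c * e * i^2 = s * c^2 * i^2 + s^2 * c * u * i^2" unfolding e by algebra
  have 6: "s^2 * c * e^2 * i ^ 3 = s^2 * c ^ 3 * i ^ 3 + s ^ 3 * (2 * c^2 * u + s * c * u^2) * i ^ 3" unfolding e by algebra
  have 7: "s^2 * e1^2 * c * i / 2 = s^2 * c * c1^2 * i / 2 + s ^ 3 * (2 * c * c1 * u1 + s * c * u1^2) * i / 2"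
    unfolding e by (simp add: field_simps power2_eq_square power3_eq_cube)
  have 8: "c1 * s * e1 = s * c1^2 + s^2 * u1 * c1" unfolding e by algebra
  have "c * j * Q + c1 * (s * e1) * Q
    = (c * i - (s * c^2 * i^2 + s^2 * c * u * i^2) + (s^2 * c ^ 3 * i ^ 3 + s ^ 3 * (2 * c^2 * u + s * c * u^2) * i ^ 3)
       - s ^ 3 * c * e ^ 3 * i ^ 3 * j)
      - ((s^2 * c * c1^2 * i / 2 + s ^ 3 * (2 * c * c1 * u1 + s * c * u1^2) * i / 2)
         - s ^ 4 * e1 ^ 4 * G2 * c * i - s ^ 3 * e1^2 * e * c * i * j * G)
      + (s * c1^2 + s^2 * u1 * c1) - c1 * s ^ 3 * e1 ^ 3 * G"
    by (rule trans[OF 1]) (simp only: 2 3 4 5 6 7 8)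
  then show ?thesis by (simp add: field_simps power2_eq_square power3_eq_cube power4_eq_xxxx)
qed

text \<open>The terms of size s \<open>w\<close> are kept apart from the s^2 remainder because
  \<open>w\<close> will only be known to tend to 0; they are dealt with after integration.\<close>

lemma linearized_weak_form_expansion:
  fixes i j s e :: real
  assumes j: "j = i - s * e * i * j" and Q: "Q = 1 - s^2 * e1^2 * G" and Q3: "Q3 = 1 - s^2 * e1^2 * G3"
    and e: "e = c + s * u" "e1 = c1 + s * u1" and v: "v = c + w" "v1 = c1 + w1"
  shows "- (v * c * (j^2 * Q)) - s * e1 * v1 * c * (j * Q3) + v1 * c1 * Q3
     = v1 * c1 - v * c * i^2 + s * (2 * c ^ 3 * i ^ 3 - c * c1^2 * i) + s * (2 * c^2 * w * i ^ 3 - c * c1 * w1 * i)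
     + s^2 * (2 * u * v * c * i ^ 3 - u1 * v1 * c * i
        - e^2 * (3 * i^2 * j^2 + 2 * s * e * i ^ 3 * j^2) * v * c + e1^2 * G * v * c * j^2
        + e1 * e * v1 * c * i * j + s * e1 ^ 3 * G3 * v1 * c * j - e1^2 * G3 * v1 * c1)"
proof -
  let ?E = "3 * i^2 * j^2 + 2 * s * e * i ^ 3 * j^2"
  have 1: "v * c * (j^2 * Q) = v * c * i^2 - 2 * s * e * v * c * i ^ 3 + s^2 * e^2 * ?E * v * c - s^2 * e1^2 * G * v * c * j^2"
    using inverse_expansion(2)[OF j] unfolding Q by algebra
  have 2: "s * e1 * v1 * c * (j * Q3) = s * e1 * v1 * c * i - s^2 * e1 * e * v1 * c * i * j - s ^ 3 * e1 ^ 3 * G3 * v1 * c * j"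
    using j unfolding Q3 by algebra
  have 3: "s * e * v * c = s * c ^ 3 + s * c^2 * w + s^2 * u * v * c"
    unfolding e v by algebra
  have 4: "s * e1 * v1 * c = s * c * c1^2 + s * c * c1 * w1 + s^2 * u1 * v1 * c"
    unfolding e v by algebra
  show ?thesis
    unfolding 1 2 using 3 4 unfolding Q3 by algebra
qed

text \<open>Since p^2 = (q - 1) (q + 1), the factor q + 1 cancels and the remainders are exact
  quotients. At q = 1 they equal 1/2, 3/8 and 3/2, up to sign the Taylor coefficients of (1 +
  y)^(-1/2) and (1 + y)^(-3/2) in y = p^2.\<close>

lemma line_elem_expansions:
  fixes q p :: real
  assumes q: "q \<ge> 1" "q^2 = 1 + p^2"
  shows "1 / q = 1 - p^2 * (1 / (q * (q + 1)))"
    and "1 / (q * (q + 1)) = 1 / 2 - p^2 * ((q + 2) / (2 * q * (q + 1)^2))"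
    and "1 / q ^ 3 = 1 - p^2 * ((q^2 + q + 1) / (q ^ 3 * (q + 1)))"
proof -
  have p: "p^2 = (q - 1) * (q + 1)" using q(2) by (simp add: algebra_simps power2_eq_square)
  have nz: "q \<noteq> 0" "q + 1 \<noteq> 0" using q by auto
  have cancel: "(q - 1) * (q + 1) * (A / (B * (q + 1))) = (q - 1) * A / B" for A B
  proof -
    have "(q - 1) * (q + 1) * (A / (B * (q + 1))) = ((q - 1) * A) * (q + 1) / (B * (q + 1))"
      by (simp add: ac_simps)
    also have "\<dots> = (q - 1) * A / B" by (rule mult_divide_mult_cancel_right[OF nz(2)])
    finally show ?thesis .
  qed
  show "1 / q = 1 - p^2 * (1 / (q * (q + 1)))"
    unfolding p cancel using nz by (simp add: field_simps)
  have "p^2 * ((q + 2) / (2 * q * (q + 1)^2)) = (q - 1) * (q + 2) / (2 * q * (q + 1))"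
  proof -
    have B: "2 * q * (q + 1)^2 = (2 * q * (q + 1)) * (q + 1)" by (simp add: power2_eq_square)
    show ?thesis unfolding p B by (rule cancel)
  qed
  also have "1 / 2 - \<dots> = (q * (q + 1) - (q - 1) * (q + 2)) / (2 * q * (q + 1))"
    using nz by (simp add: diff_divide_distrib)
  also have "q * (q + 1) - (q - 1) * (q + 2) = 2" by (simp add: algebra_simps)
  finally show "1 / (q * (q + 1)) = 1 / 2 - p^2 * ((q + 2) / (2 * q * (q + 1)^2))" by simp
  have "1 - (q - 1) * (q^2 + q + 1) / q ^ 3 = (q ^ 3 - (q - 1) * (q^2 + q + 1)) / q ^ 3"
    using nz by (simp add: diff_divide_distrib)
  also have "q ^ 3 - (q - 1) * (q^2 + q + 1) = 1" by (simp add: algebra_simps power2_eq_square power3_eq_cube)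
  finally show "1 / q ^ 3 = 1 - p^2 * ((q^2 + q + 1) / (q ^ 3 * (q + 1)))"
    unfolding p cancel by simp
qed

text \<open>What the expansion needs from the branch, detached from the Hoelder spaces: a mean-zero
  periodic corrector that converges uniformly together with two derivatives.\<close>

locale bifurcating_profile =
  fixes l :: nat and a :: "real \<Rightarrow> real" and u u1 u2 :: "real \<Rightarrow> real \<Rightarrow> real" and u0 u01 u02 :: "real \<Rightarrow> real"
  assumes l: "l \<ge> 1"
    and a_lim: "(a \<longlongrightarrow> 1 / l) (at 0)"
    and u_lim: "ulim u u0" "ulim u1 u01" "ulim u2 u02"
    and du: "\<And>s x. (u s has_real_derivative u1 s x) (at x)" "\<And>s x. (u1 s has_real_derivative u2 s x) (at x)"
    and u_per: "\<And>s. u s pi = u s (- pi)"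
    and u_mean: "\<And>s. (u s has_integral 0) {-pi..pi}"
begin

definition c :: "real \<Rightarrow> real" where "c = (\<lambda>x. cos (real l * x))"
definition c1 :: "real \<Rightarrow> real" where "c1 = (\<lambda>x. - real l * sin (real l * x))"
abbreviation (input) z :: "real \<Rightarrow> real \<Rightarrow> real" where "z s x \<equiv> c x + s * u s x"
abbreviation (input) z1 :: "real \<Rightarrow> real \<Rightarrow> real" where "z1 s x \<equiv> c1 x + s * u1 s x"
definition r :: "real \<Rightarrow> real \<Rightarrow> real" where "r = (\<lambda>s x. a s + s * z s x)"
text \<open>The names anticipate \<open>deriv_r\<close>: \<open>p\<close> and \<open>p1\<close> are
  the first two derivatives of the profile \<open>r\<close>, and \<open>q\<close> is its line
  element.\<close>

definition p :: "real \<Rightarrow> real \<Rightarrow> real" where "p = (\<lambda>s x. s * z1 s x)"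
definition p1 :: "real \<Rightarrow> real \<Rightarrow> real" where "p1 = (\<lambda>s x. s * (- ((real l)^2) * c x + s * u2 s x))"
definition q :: "real \<Rightarrow> real \<Rightarrow> real" where "q = (\<lambda>s x. sqrt (1 + (p s x)^2))"
definition \<tau> :: "real \<Rightarrow> real" where "\<tau> = (\<lambda>s. 1 / (a s)^2 - (real l)^2)"

section \<open>Limits and integrals for the profile\<close>

lemma l_pos: "real l > 0" using l by simp

lemma l_nz [simp]: "l \<noteq> 0" "0 < l" using l by auto

lemma cont_c: "continuous_on A c" "continuous_on A c1"
  unfolding c_def c1_def by (intro continuous_intros)+

lemma c1_sq: "(c1 x)^2 = (real l)^2 * (1 - (c x)^2)"
  by (simp add: c_def c1_def power_mult_distrib sin_squared_eq)

lemma q_sq: "q s x \<ge> 1" "(q s x)^2 = 1 + (p s x)^2"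
  by (simp_all add: q_def)

lemma ulim_s: "ulim (\<lambda>s x. s) (\<lambda>x. 0)" by (rule ulim_scalar) (rule tendsto_ident_at)
lemma ulim_a: "ulim (\<lambda>s x. a s) (\<lambda>x. 1 / l)" by (rule ulim_scalar) (rule a_lim)
lemma ulim_c: "ulim (\<lambda>s x. c x) c" "ulim (\<lambda>s x. c1 x) c1"
  using ulim_fun[of c] ulim_fun[of c1] cont_c by auto
lemma ulim_num: "ulim (\<lambda>s x. 1) (\<lambda>x. 1)" "ulim (\<lambda>s x. numeral n) (\<lambda>x. numeral n)" "ulim (\<lambda>s x. real l) (\<lambda>x. real l)"
  by (rule ulim_fun, rule continuous_on_const)+

lemmas ulim_atoms = ulim_s ulim_a ulim_c ulim_num u_lim

lemma ulim_e: "ulim (\<lambda>s x. c x + s * u s x) c" "ulim (\<lambda>s x. c1 x + s * u1 s x) c1"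
proof -
  show "ulim (\<lambda>s x. c x + s * u s x) c"
    by (rule ulim_cong, (rule ulim_atoms ulim_arith | (simp; fail))+)
  show "ulim (\<lambda>s x. c1 x + s * u1 s x) c1"
    by (rule ulim_cong, (rule ulim_atoms ulim_arith | (simp; fail))+)
qed

lemma ulim_r: "ulim r (\<lambda>x. 1 / l)"
  unfolding r_def by (rule ulim_cong, (rule ulim_e ulim_atoms ulim_arith | (simp; fail))+)

lemma ulim_p: "ulim p (\<lambda>x. 0)"
  unfolding p_def by (rule ulim_cong, (rule ulim_e ulim_atoms ulim_arith | (simp; fail))+)

lemma ulim_p1: "ulim p1 (\<lambda>x. 0)"
  unfolding p1_def by (rule ulim_cong, (rule ulim_e ulim_atoms ulim_arith | (simp; fail))+)

lemma ulim_q: "ulim q (\<lambda>x. 1)"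
  unfolding q_def by (rule ulim_cong, (rule ulim_p ulim_atoms ulim_arith | (simp; fail))+)

lemmas ulim_base = ulim_r ulim_p ulim_p1 ulim_q ulim_e ulim_atoms

lemma r_nz: "\<forall>\<^sub>F s in at 0. \<forall>x\<in>{-pi..pi}. r s x \<noteq> 0"
proof -
  have "ulim (\<lambda>s x. r s x - 1 / l) (\<lambda>x. 0)"
    by (rule ulim_cong, (rule ulim_base ulim_fun continuous_on_const ulim_arith | (simp; fail))+)
  from ulim_eventually_less[OF this, of "1 / l"] l_pos show ?thesis
    by (auto elim!: eventually_mono)
qed

lemma a_nz: "\<forall>\<^sub>F s in at 0. a s \<noteq> 0"
  using tendsto_imp_eventually_ne[OF a_lim, of 0] l_pos by simp

lemma int_c:
  "(c has_integral 0) {-pi..pi}" "((\<lambda>x. (c x)^2) has_integral pi) {-pi..pi}"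
  "((\<lambda>x. (c x) ^ 3) has_integral 0) {-pi..pi}" "((\<lambda>x. (c x) ^ 4) has_integral 3 * pi / 4) {-pi..pi}"
  "((\<lambda>x. (c1 x)^2) has_integral (real l)^2 * pi) {-pi..pi}"
  "((\<lambda>x. c x * (c1 x)^2) has_integral 0) {-pi..pi}"
  "((\<lambda>x. (c x)^2 * (c1 x)^2) has_integral (real l)^2 * pi / 4) {-pi..pi}"
  "((\<lambda>x. (c1 x) ^ 4) has_integral 3 * (real l) ^ 4 * pi / 4) {-pi..pi}"
proof -
  note t = trig_integrals[OF l, folded c_def]
  show t1: "(c has_integral 0) {-pi..pi}" and t2: "((\<lambda>x. (c x)^2) has_integral pi) {-pi..pi}"
    and t3: "((\<lambda>x. (c x) ^ 3) has_integral 0) {-pi..pi}" and t4: "((\<lambda>x. (c x) ^ 4) has_integral 3 * pi / 4) {-pi..pi}"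
    using t by (simp_all add: c_def)
  have one: "((\<lambda>x. 1::real) has_integral 2 * pi) {-pi..pi}"
    using has_integral_const_real[of "1::real" "-pi" pi] by simp
  have "((\<lambda>x. (real l)^2 * (1 - (c x)^2)) has_integral (real l)^2 * (2 * pi - pi)) {-pi..pi}"
    by (intro has_integral_mult_right has_integral_diff one t2)
  then show "((\<lambda>x. (c1 x)^2) has_integral (real l)^2 * pi) {-pi..pi}" by (simp add: c1_sq)
  have "((\<lambda>x. (real l)^2 * (c x - (c x) ^ 3)) has_integral (real l)^2 * (0 - 0)) {-pi..pi}"
    by (intro has_integral_mult_right has_integral_diff t1 t3)
  then show "((\<lambda>x. c x * (c1 x)^2) has_integral 0) {-pi..pi}"
    unfolding c1_sq by (simp add: algebra_simps power2_eq_square power3_eq_cube)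
  have "((\<lambda>x. (real l)^2 * ((c x)^2 - (c x) ^ 4)) has_integral (real l)^2 * (pi - 3 * pi / 4)) {-pi..pi}"
    by (intro has_integral_mult_right has_integral_diff t2 t4)
  then show "((\<lambda>x. (c x)^2 * (c1 x)^2) has_integral (real l)^2 * pi / 4) {-pi..pi}"
    unfolding c1_sq by (simp add: algebra_simps power2_eq_square power4_eq_xxxx)
  have "((\<lambda>x. (real l) ^ 4 * (1 - 2 * (c x)^2 + (c x) ^ 4)) has_integral (real l) ^ 4 * (2 * pi - 2 * pi + 3 * pi / 4)) {-pi..pi}"
    by (intro has_integral_mult_right has_integral_diff has_integral_add one t2 t4)
  moreover have "(c1 x) ^ 4 = (real l) ^ 4 * (1 - 2 * (c x)^2 + (c x) ^ 4)" for x
  proof -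
    have "(c1 x) ^ 4 = ((c1 x)^2)^2" by simp
    then show ?thesis unfolding c1_sq by (simp add: power2_eq_square power4_eq_xxxx algebra_simps)
  qed
  ultimately have "((\<lambda>x. (c1 x) ^ 4) has_integral (real l) ^ 4 * (2 * pi - 2 * pi + 3 * pi / 4)) {-pi..pi}"
    by simp
  then show "((\<lambda>x. (c1 x) ^ 4) has_integral 3 * (real l) ^ 4 * pi / 4) {-pi..pi}"
    by (simp add: algebra_simps)
qed

lemma c_has_deriv:
  "(c has_real_derivative c1 x) (at x)" "(c1 has_real_derivative - ((real l)^2) * c x) (at x)"
  unfolding c_def c1_def by (auto intro!: derivative_eq_intros simp: power2_eq_square)

text \<open>Both boundary terms carry the factor \<open>c1\<close>, which vanishes at the end
  points. The second identity rests on (c c1)' = l^2 (1 - 2 c^2) and leaves the plain integral of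
  \<open>f\<close>, which is 0 for the corrector and of order s for the eigenfunction.\<close>

lemma integral_parts:
  assumes f: "\<And>x. (f has_real_derivative f1 x) (at x)" and per: "f pi = f (-pi)"
    and f1: "continuous_on {-pi..pi} f1"
  shows "integral {-pi..pi} (\<lambda>x. f1 x * c1 x) = (real l)^2 * integral {-pi..pi} (\<lambda>x. f x * c x)"
    and "integral {-pi..pi} (\<lambda>x. c x * c1 x * f1 x)
      = (real l)^2 * (2 * integral {-pi..pi} (\<lambda>x. (c x)^2 * f x) - integral {-pi..pi} f)"
proof -
  have cf: "continuous_on {-pi..pi} f" using f by (meson DERIV_isCont continuous_at_imp_continuous_on)
  have c1_pi: "c1 pi = 0" "c1 (-pi) = 0" by (simp_all add: c1_def sin_npi)
  have "((\<lambda>x. f x * c1 x) has_real_derivative f1 x * c1 x - (real l)^2 * (f x * c x)) (at x)" for x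
    by (auto intro!: derivative_eq_intros f c_has_deriv)
  from has_integral_deriv_circle[OF this]
  have "integral {-pi..pi} (\<lambda>x. f1 x * c1 x - (real l)^2 * (f x * c x)) = 0"
    by (simp add: c1_pi integral_unique)
  moreover have "integral {-pi..pi} (\<lambda>x. f1 x * c1 x - (real l)^2 * (f x * c x))
    = integral {-pi..pi} (\<lambda>x. f1 x * c1 x) - integral {-pi..pi} (\<lambda>x. (real l)^2 * (f x * c x))"
    by (intro integral_diff integrable_continuous_real continuous_intros cf f1 cont_c)
  ultimately show "integral {-pi..pi} (\<lambda>x. f1 x * c1 x) = (real l)^2 * integral {-pi..pi} (\<lambda>x. f x * c x)"
    by simp
  have "((\<lambda>x. f x * (c x * c1 x)) has_real_derivative
      c x * c1 x * f1 x + ((c1 x)^2 - (real l)^2 * (c x)^2) * f x) (at x)" for x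
    by (auto intro!: derivative_eq_intros f c_has_deriv simp: algebra_simps power2_eq_square)
  moreover have "((c1 x)^2 - (real l)^2 * (c x)^2) * f x = - ((real l)^2 * (2 * ((c x)^2 * f x) - f x))" for x
    unfolding c1_sq by (simp add: algebra_simps)
  ultimately have "((\<lambda>x. f x * (c x * c1 x)) has_real_derivative
      c x * c1 x * f1 x - (real l)^2 * (2 * ((c x)^2 * f x) - f x)) (at x)" for x
    by simp
  from has_integral_deriv_circle[OF this]
  have "integral {-pi..pi} (\<lambda>x. c x * c1 x * f1 x - (real l)^2 * (2 * ((c x)^2 * f x) - f x)) = 0"
    by (simp add: c1_pi integral_unique)
  moreover have "integral {-pi..pi} (\<lambda>x. c x * c1 x * f1 x - (real l)^2 * (2 * ((c x)^2 * f x) - f x))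
    = integral {-pi..pi} (\<lambda>x. c x * c1 x * f1 x) - integral {-pi..pi} (\<lambda>x. (real l)^2 * (2 * ((c x)^2 * f x) - f x))"
    by (intro integral_diff integrable_continuous_real continuous_intros cf f1 cont_c)
  moreover have "integral {-pi..pi} (\<lambda>x. 2 * ((c x)^2 * f x) - f x)
     = integral {-pi..pi} (\<lambda>x. 2 * ((c x)^2 * f x)) - integral {-pi..pi} f"
    by (intro integral_diff integrable_continuous_real continuous_intros cf cont_c)
  ultimately show "integral {-pi..pi} (\<lambda>x. c x * c1 x * f1 x)
      = (real l)^2 * (2 * integral {-pi..pi} (\<lambda>x. (c x)^2 * f x) - integral {-pi..pi} f)"
    by simp
qed

text \<open>The limits \<open>u0\<close> and \<open>u01\<close> are not assumed to be related by
  differentiation, so the integration by parts is done for \<open>u s\<close> and passed to the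
  limit. This is the identity that removes the corrector from both asymptotic coefficients.\<close>

lemma u0_integral_parts: "integral {-pi..pi} (\<lambda>x. c x * c1 x * u01 x) = 2 * (real l)^2 * integral {-pi..pi} (\<lambda>x. (c x)^2 * u0 x)"
proof (rule tendsto_unique)
  show "((\<lambda>s. integral {-pi..pi} (\<lambda>x. c x * c1 x * u1 s x)) \<longlongrightarrow> integral {-pi..pi} (\<lambda>x. c x * c1 x * u01 x)) (at 0)"
    by (rule ulim_integral) (rule ulim_base ulim_arith | (simp; fail))+
  have "((\<lambda>s. 2 * (real l)^2 * integral {-pi..pi} (\<lambda>x. (c x)^2 * u s x)) \<longlongrightarrow> 2 * (real l)^2 * integral {-pi..pi} (\<lambda>x. (c x)^2 * u0 x)) (at 0)"
    by (intro tendsto_mult_left ulim_integral) (rule ulim_base ulim_arith | (simp; fail))+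
  then show "((\<lambda>s. integral {-pi..pi} (\<lambda>x. c x * c1 x * u1 s x)) \<longlongrightarrow> 2 * (real l)^2 * integral {-pi..pi} (\<lambda>x. (c x)^2 * u0 x)) (at 0)"
  proof (rule Lim_transform_eventually)
    show "\<forall>\<^sub>F s in at 0. 2 * (real l)^2 * integral {-pi..pi} (\<lambda>x. (c x)^2 * u s x) = integral {-pi..pi} (\<lambda>x. c x * c1 x * u1 s x)"
      using ulim_continuousD[OF u_lim(2)]
      by eventually_elim (simp add: integral_parts(2)[OF du(1) u_per] integral_unique[OF u_mean])
  qed
qed simp

definition J :: "real \<Rightarrow> real \<Rightarrow> real" where "J = (\<lambda>s x. 1 / (q s x * (q s x + 1)))"
definition J2 :: "real \<Rightarrow> real \<Rightarrow> real" where "J2 = (\<lambda>s x. (q s x + 2) / (2 * q s x * (q s x + 1)^2))"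
definition J3 :: "real \<Rightarrow> real \<Rightarrow> real" where "J3 = (\<lambda>s x. ((q s x)^2 + q s x + 1) / (q s x ^ 3 * (q s x + 1)))"

lemma ulim_J: "ulim J (\<lambda>x. 1 / 2)" "ulim J2 (\<lambda>x. 3 / 8)" "ulim J3 (\<lambda>x. 3 / 2)"
proof -
  show "ulim J (\<lambda>x. 1 / 2)" unfolding J_def
    by (rule ulim_cong, (rule ulim_base ulim_arith | (simp; fail))+)
  show "ulim J2 (\<lambda>x. 3 / 8)" unfolding J2_def
    by (rule ulim_cong, (rule ulim_base ulim_arith | (simp; fail))+)
  show "ulim J3 (\<lambda>x. 3 / 2)" unfolding J3_def
    by (rule ulim_cong, (rule ulim_base ulim_arith | (simp; fail))+)
qed

lemma J_eqs:
  "1 / q s x = 1 - s^2 * (z1 s x)^2 * J s x"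
  "J s x = 1 / 2 - s^2 * (z1 s x)^2 * J2 s x"
  "1 / q s x ^ 3 = 1 - s^2 * (z1 s x)^2 * J3 s x"
  unfolding J_def J2_def J3_def power_mult_distrib[symmetric] p_def[symmetric]
  using line_elem_expansions[OF q_sq[of s x]] by (simp_all add: p_def)

lemma inverse_r: "a s \<noteq> 0 \<Longrightarrow> r s x \<noteq> 0 \<Longrightarrow>
   1 / r s x = 1 / a s - s * z s x * (1 / a s) * (1 / r s x)"
  by (simp add: field_simps) (simp add: r_def algebra_simps)

lemma ulim_integrable: "ulim f F \<Longrightarrow> \<forall>\<^sub>F s in at 0. f s integrable_on {-pi..pi}"
  by (auto dest!: ulim_continuousD elim!: eventually_mono intro: integrable_continuous_real)

text \<open>After integration the order s^0 vanishes, the order s gives - pi \<tau>, and by parts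
  the order s^2 gives - \<tau> U. So \<tau> (pi + s U) equals s^2 times the integral of
  \<open>D\<close> exactly, and no rate for \<tau> has to be known beforehand.\<close>

lemma tau_asymptotics:
  assumes weak: "\<forall>\<^sub>F s in at 0. ((\<lambda>x. c x / (r s x * q s x) + c1 x * p s x / q s x) has_integral 0) {-pi..pi}"
  shows "((\<lambda>s. \<tau> s / s^2) \<longlongrightarrow> - (real l ^ 4)) (at 0)"
proof -
  define D where "D = (\<lambda>s x. (2 * (c x)^2 * u s x + s * c x * (u s x)^2) * (1 / a s) ^ 3
     - (2 * c x * c1 x * u1 s x + s * c x * (u1 s x)^2) * (1 / a s) / 2
     - c x * z s x ^ 3 * (1 / a s) ^ 3 * (1 / r s x)
     + c x * (z1 s x)^2 * z s x * J s x * (1 / a s) * (1 / r s x)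
     - c1 x * z1 s x ^ 3 * J s x + s * c x * z1 s x ^ 4 * J2 s x * (1 / a s))"
  define L where "L = (\<lambda>x. 2 * real l ^ 3 * ((c x)^2 * u0 x) - real l * (c x * c1 x * u01 x)
     - real l ^ 4 * (c x) ^ 4 + (real l)^2 / 2 * ((c x)^2 * (c1 x)^2) - 1 / 2 * (c1 x) ^ 4)"
  have ulim_D: "ulim D L"
    unfolding D_def L_def
    by (rule ulim_cong, (rule ulim_base ulim_J ulim_arith | (simp; fail))+)
       (use l_pos in \<open>auto simp: field_simps eval_nat_numeral\<close>)
  have cu0: "continuous_on {-pi..pi} u0" "continuous_on {-pi..pi} u01"
    using u_lim by (auto simp: ulim_def)
  have "(L has_integral 2 * real l ^ 3 * integral {-pi..pi} (\<lambda>x. (c x)^2 * u0 x)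
      - real l * integral {-pi..pi} (\<lambda>x. c x * c1 x * u01 x)
      - real l ^ 4 * (3 * pi / 4) + (real l)^2 / 2 * ((real l)^2 * pi / 4) - 1 / 2 * (3 * (real l) ^ 4 * pi / 4)) {-pi..pi}"
    unfolding L_def
    by (intro has_integral_arith int_c cont_c cu0)
  \<comment> \<open>The two corrector integrals cancel, and - 3/4 + 1/8 - 3/8 = - 1.\<close>
  then have "integral {-pi..pi} L = - pi * real l ^ 4"
    unfolding u0_integral_parts by (subst integral_unique) (auto simp: field_simps eval_nat_numeral)
  then have D_lim: "((\<lambda>s. integral {-pi..pi} (D s)) \<longlongrightarrow> - pi * real l ^ 4) (at 0)"
    using ulim_integral[OF ulim_D] by simp
  define U where "U = (\<lambda>s. integral {-pi..pi} (\<lambda>x. u s x * c x))"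
  have U_lim: "(U \<longlongrightarrow> integral {-pi..pi} (\<lambda>x. u0 x * c x)) (at 0)"
    unfolding U_def by (rule ulim_integral) (rule ulim_base ulim_arith | (simp; fail))+
  have "((\<lambda>s. integral {-pi..pi} (D s) / (pi + s * U s)) \<longlongrightarrow> (- pi * real l ^ 4) / (pi + 0 * integral {-pi..pi} (\<lambda>x. u0 x * c x))) (at 0)"
    by (intro tendsto_intros D_lim U_lim) simp
  then have "((\<lambda>s. integral {-pi..pi} (D s) / (pi + s * U s)) \<longlongrightarrow> - (real l ^ 4)) (at 0)" by simp
  then show ?thesis
  proof (rule Lim_transform_eventually)
    have "((\<lambda>s. pi + s * U s) \<longlongrightarrow> pi + 0 * integral {-pi..pi} (\<lambda>x. u0 x * c x)) (at 0)"
      by (intro tendsto_intros U_lim)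
    then have "\<forall>\<^sub>F s in at 0. pi + s * U s \<noteq> 0" by (rule tendsto_imp_eventually_ne) simp
    moreover have "\<forall>\<^sub>F s in at (0::real). s \<noteq> 0" by (simp add: eventually_at_filter)
    ultimately show "\<forall>\<^sub>F s in at 0. integral {-pi..pi} (D s) / (pi + s * U s) = \<tau> s / s^2"
      using weak r_nz a_nz ulim_integrable[OF ulim_D] ulim_continuousD[OF u_lim(1)] ulim_continuousD[OF u_lim(2)]
    proof eventually_elim
      case (elim s)
      define i where "i = 1 / a s"
      let ?f = "\<lambda>x. c x * i + s * ((c1 x)^2 - (c x)^2 * i^2)
         + s^2 * (u1 s x * c1 x - u s x * c x * i^2 + (c x) ^ 3 * i ^ 3 - c x * (c1 x)^2 * i / 2)
         + s ^ 3 * D s x"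
      have eq: "c x / (r s x * q s x) + c1 x * p s x / q s x
        = ?f x" if "x \<in> {-pi..pi}" for x
        using weak_form_expansion[OF inverse_r J_eqs(1,2) refl refl, of s x] elim that
        by (simp add: D_def i_def p_def)
      have "(?f has_integral
         0 * i + s * ((real l)^2 * pi - pi * i^2) + s^2 * (integral {-pi..pi} (\<lambda>x. u1 s x * c1 x)
           - U s * i^2 + 0 * i ^ 3 - 0 * i / 2) + s ^ 3 * integral {-pi..pi} (D s)) {-pi..pi}" (is "(_ has_integral ?y) _")
        unfolding U_def
        by (intro has_integral_arith int_c cont_c elim)
      moreover have "(?f has_integral 0) {-pi..pi}"
        using elim(3) by (rule has_integral_eq[rotated]) (rule eq)
      ultimately have "?y = 0"
        by (rule has_integral_unique)
      moreover have "integral {-pi..pi} (\<lambda>x. u1 s x * c1 x) = (real l)^2 * U s"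
        unfolding U_def by (rule integral_parts(1)[OF du(1) u_per]) (use elim in simp)
      moreover have "i^2 = \<tau> s + (real l)^2" by (simp add: \<tau>_def i_def power_one_over)
      ultimately have "s * ((real l)^2 * pi - pi * (\<tau> s + (real l)^2)) + s^2 * ((real l)^2 * U s - U s * (\<tau> s + (real l)^2))
          + s ^ 3 * integral {-pi..pi} (D s) = 0"
        by simp
      then have "s * (s^2 * integral {-pi..pi} (D s)) = s * (\<tau> s * (pi + s * U s))"
        by (simp add: algebra_simps power2_eq_square power3_eq_cube)
      then have "s^2 * integral {-pi..pi} (D s) = \<tau> s * (pi + s * U s)" using elim by simp
      then show ?case using elim by (simp add: field_simps)
    qed
  qed
qed

text \<open>The integrand left when the linearized curvature is multiplied by \<open>c\<close> and
  its second-order terms are integrated by parts; only \<open>v\<close> and \<open>v1\<close>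
  occur.\<close>

definition weak_linearization :: "real \<Rightarrow> (real \<Rightarrow> real) \<Rightarrow> (real \<Rightarrow> real) \<Rightarrow> real \<Rightarrow> real" where
  "weak_linearization s v v1 x = - (v x * c x / ((r s x)^2 * q s x)) - p s x * v1 x * c x / (r s x * q s x ^ 3)
     + v1 x * c1 x / q s x ^ 3"

text \<open>In the limit the right side is \<mu> times - pi / l^2. On the left, at order s^2, -
  \<tau> contributes pi l^4, the constraint contributes - pi l^4 through the integral of
  \<open>w\<close>, and \<open>D\<close> contributes - 3 pi l^4; the quotient is 3 l^6.\<close>

lemma eigenvalue_asymptotics:
  fixes w w1 K :: "real \<Rightarrow> real \<Rightarrow> real" and \<mu> :: "real \<Rightarrow> real"
  assumes tau: "((\<lambda>s. \<tau> s / s^2) \<longlongrightarrow> - (real l ^ 4)) (at 0)"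
    and w: "ulim w (\<lambda>x. 0)" "ulim w1 (\<lambda>x. 0)"
    and K: "ulim K (\<lambda>x. (1 - c x) / (real l)^2)"
    and ev: "\<forall>\<^sub>F s in at 0. (\<forall>x. (w s has_real_derivative w1 s x) (at x)) \<and> w s pi = w s (-pi)
      \<and> ((\<lambda>x. r s x * (c x + w s x)) has_integral 0) {-pi..pi}
      \<and> (weak_linearization s (\<lambda>x. c x + w s x) (\<lambda>x. c1 x + w1 s x) has_integral \<mu> s * integral {-pi..pi} (\<lambda>x. K s x * c x)) {-pi..pi}"
  shows "((\<lambda>s. \<mu> s / s^2) \<longlongrightarrow> 3 * real l ^ 6) (at 0)"
proof -
  define D where "D = (\<lambda>s x. 2 * u s x * (c x + w s x) * c x * (1 / a s) ^ 3 - u1 s x * (c1 x + w1 s x) * c x * (1 / a s)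
     - (z s x)^2 * (3 * (1 / a s)^2 * (1 / r s x)^2 + 2 * s * z s x * (1 / a s) ^ 3 * (1 / r s x)^2) * (c x + w s x) * c x
     + (z1 s x)^2 * J s x * (c x + w s x) * c x * (1 / r s x)^2
     + z1 s x * z s x * (c1 x + w1 s x) * c x * (1 / a s) * (1 / r s x)
     + s * z1 s x ^ 3 * J3 s x * (c1 x + w1 s x) * c x * (1 / r s x)
     - (z1 s x)^2 * J3 s x * (c1 x + w1 s x) * c1 x)"
  define L where "L = (\<lambda>x. 2 * real l ^ 3 * ((c x)^2 * u0 x) - real l * (c x * c1 x * u01 x)
     - 3 * real l ^ 4 * (c x) ^ 4 + 3 / 2 * (real l)^2 * ((c x)^2 * (c1 x)^2) - 3 / 2 * (c1 x) ^ 4)"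
  note base = w ulim_base ulim_J
  have ulim_D: "ulim D L"
    unfolding D_def L_def
    by (rule ulim_cong, (rule base ulim_arith | (simp; fail))+)
       (auto simp: field_simps eval_nat_numeral)
  have cu0: "continuous_on {-pi..pi} u0" "continuous_on {-pi..pi} u01"
    using u_lim by (auto simp: ulim_def)
  have "(L has_integral 2 * real l ^ 3 * integral {-pi..pi} (\<lambda>x. (c x)^2 * u0 x)
      - real l * integral {-pi..pi} (\<lambda>x. c x * c1 x * u01 x)
      - 3 * real l ^ 4 * (3 * pi / 4) + 3 / 2 * (real l)^2 * ((real l)^2 * pi / 4) - 3 / 2 * (3 * (real l) ^ 4 * pi / 4)) {-pi..pi}"
    unfolding L_def
    by (intro has_integral_arith int_c cont_c cu0)
  \<comment> \<open>The corrector integrals cancel as before, and - 9/4 + 3/8 - 9/8 = - 3.\<close>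
  then have "integral {-pi..pi} L = - 3 * pi * real l ^ 4"
    unfolding u0_integral_parts by (subst integral_unique) (auto simp: field_simps eval_nat_numeral)
  then have D_lim: "((\<lambda>s. integral {-pi..pi} (D s)) \<longlongrightarrow> - 3 * pi * real l ^ 4) (at 0)"
    using ulim_integral[OF ulim_D] by simp

  define E where "E = (\<lambda>s. integral {-pi..pi} (\<lambda>x. z s x * (c x + w s x)))"
  define V where "V = (\<lambda>s. integral {-pi..pi} (\<lambda>x. w s x * c x))"
  define Z where "Z = (\<lambda>s. integral {-pi..pi} (\<lambda>x. (c x)^2 * w s x))"
  define k where "k = (\<lambda>s. integral {-pi..pi} (\<lambda>x. K s x * c x))"
  have "ulim (\<lambda>s x. z s x * (c x + w s x)) (\<lambda>x. (c x)^2)"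
    by (rule ulim_cong, (rule base ulim_arith | (simp; fail))+) (simp add: power2_eq_square)
  from ulim_integral[OF this] have E_lim: "(E \<longlongrightarrow> pi) (at 0)"
    unfolding E_def using int_c(2) by (simp add: integral_unique)
  have "ulim (\<lambda>s x. w s x * c x) (\<lambda>x. 0)"
    by (rule ulim_cong, (rule base ulim_arith | (simp; fail))+)
  from ulim_integral[OF this] have V_lim: "(V \<longlongrightarrow> 0) (at 0)" unfolding V_def by simp
  have "ulim (\<lambda>s x. (c x)^2 * w s x) (\<lambda>x. 0)"
    by (rule ulim_cong, (rule base ulim_arith | (simp; fail))+)
  from ulim_integral[OF this] have Z_lim: "(Z \<longlongrightarrow> 0) (at 0)" unfolding Z_def by simp
  have k_int: "integral {-pi..pi} (\<lambda>x. 1 / (real l)^2 * (c x - (c x)^2)) = 1 / (real l)^2 * (0 - pi)"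
    by (intro integral_unique has_integral_mult_right has_integral_diff int_c)
  have "ulim (\<lambda>s x. K s x * c x) (\<lambda>x. 1 / (real l)^2 * (c x - (c x)^2))"
    by (rule ulim_cong, (rule K base ulim_arith | (simp; fail))+) (simp add: power2_eq_square field_simps)
  from ulim_integral[OF this] have "(k \<longlongrightarrow> integral {-pi..pi} (\<lambda>x. 1 / (real l)^2 * (c x - (c x)^2))) (at 0)"
    unfolding k_def .
  then have k_lim: "(k \<longlongrightarrow> - pi / (real l)^2) (at 0)" unfolding k_int by simp

  let ?g = "\<lambda>s. (- (\<tau> s / s^2) * (pi + V s) + 2 * (1 / a s) * (\<tau> s / s^2) * s * Z s - (real l)^2 * (1 / a s)^2 * E s + integral {-pi..pi} (D s)) / k s"
  have "(?g
     \<longlongrightarrow> (- (- (real l ^ 4)) * (pi + 0) + 2 * (1 / (1 / l)) * (- (real l ^ 4)) * 0 * 0 - (real l)^2 * (1 / (1 / l))^2 * pi + (- 3 * pi * real l ^ 4)) / (- pi / (real l)^2)) (at 0)" (is "(_ \<longlongrightarrow> ?y) _")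
    by (intro tendsto_intros tau V_lim Z_lim E_lim k_lim D_lim a_lim tendsto_ident_at) auto
  also have "?y
    = 3 * real l ^ 6"
    by (simp add: field_simps eval_nat_numeral)
  finally show ?thesis
  proof (rule Lim_transform_eventually)
    have "\<forall>\<^sub>F s in at 0. k s \<noteq> 0" by (rule tendsto_imp_eventually_ne[OF k_lim]) simp
    moreover have "\<forall>\<^sub>F s in at (0::real). s \<noteq> 0" by (simp add: eventually_at_filter)
    ultimately show "\<forall>\<^sub>F s in at 0. ?g s = \<mu> s / s^2"
      using ev r_nz a_nz ulim_integrable[OF ulim_D] ulim_continuousD[OF u_lim(1)] ulim_continuousD[OF u_lim(2)]
        ulim_continuousD[OF w(1)] ulim_continuousD[OF w(2)]
    proof eventually_elim
      case (elim s)
      define i where "i = 1 / a s"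
      let ?f = "\<lambda>x. (c1 x)^2 + w1 s x * c1 x - ((c x)^2 + w s x * c x) * i^2
         + s * (2 * (c x) ^ 3 * i ^ 3 - c x * (c1 x)^2 * i) + s * (2 * ((c x)^2 * w s x) * i ^ 3 - c x * c1 x * w1 s x * i)
         + s^2 * D s x"
      have dw: "(w s has_real_derivative w1 s x) (at x)" for x using elim by blast
      have wper: "w s pi = w s (-pi)" using elim by blast
      have eq: "weak_linearization s (\<lambda>x. c x + w s x) (\<lambda>x. c1 x + w1 s x) x
         = ?f x" if "x \<in> {-pi..pi}" for x
      proof -
        have "a s \<noteq> 0" "r s x \<noteq> 0" using elim that by auto
        note expand = linearized_weak_form_expansion[OF inverse_r[OF this] J_eqs(1,3) refl refl refl refl]
        have "weak_linearization s (\<lambda>x. c x + w s x) (\<lambda>x. c1 x + w1 s x) x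
          = - ((c x + w s x) * c x * ((1 / r s x)^2 * (1 / q s x)))
            - s * z1 s x * (c1 x + w1 s x) * c x * (1 / r s x * (1 / q s x ^ 3))
            + (c1 x + w1 s x) * c1 x * (1 / q s x ^ 3)"
          by (simp add: weak_linearization_def p_def power_one_over)
        also have "\<dots> = (c1 x + w1 s x) * c1 x - (c x + w s x) * c x * i^2
            + s * (2 * (c x) ^ 3 * i ^ 3 - c x * (c1 x)^2 * i)
            + s * (2 * (c x)^2 * w s x * i ^ 3 - c x * c1 x * w1 s x * i) + s^2 * D s x"
          unfolding D_def i_def by (rule expand)
        finally show ?thesis by (simp add: algebra_simps power2_eq_square)
      qed
      have "(?f has_integral
          (real l)^2 * pi + integral {-pi..pi} (\<lambda>x. w1 s x * c1 x) - (pi + V s) * i^2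
         + s * (2 * 0 * i ^ 3 - 0 * i) + s * (2 * Z s * i ^ 3 - integral {-pi..pi} (\<lambda>x. c x * c1 x * w1 s x) * i)
         + s^2 * integral {-pi..pi} (D s)) {-pi..pi}" (is "(_ has_integral ?y) _")
        unfolding V_def Z_def
        by (intro has_integral_arith int_c cont_c elim)
      moreover have "(?f has_integral \<mu> s * k s) {-pi..pi}"
      proof (rule has_integral_eq[rotated])
        show "(weak_linearization s (\<lambda>x. c x + w s x) (\<lambda>x. c1 x + w1 s x) has_integral \<mu> s * k s) {-pi..pi}"
          using elim unfolding k_def by blast
      qed (rule eq)
      ultimately have "?y = \<mu> s * k s"
        by (rule has_integral_unique)
      moreover have "integral {-pi..pi} (\<lambda>x. w1 s x * c1 x) = (real l)^2 * V s"
        unfolding V_def by (rule integral_parts(1)[OF dw wper]) (use elim in simp)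
      moreover have "integral {-pi..pi} (\<lambda>x. c x * c1 x * w1 s x) = (real l)^2 * (2 * Z s - integral {-pi..pi} (w s))"
        unfolding Z_def by (rule integral_parts(2)[OF dw wper]) (use elim in simp)
      \<comment> \<open>The constraint on r v gains a power of s here, which turns the surviving s
        \<open>w\<close> term into one of order s^2.\<close>
      moreover have "integral {-pi..pi} (w s) = - s * i * E s"
      proof -
        have "((\<lambda>x. a s * (c x + w s x) + s * (z s x * (c x + w s x))) has_integral
           a s * (0 + integral {-pi..pi} (w s)) + s * E s) {-pi..pi}"
          unfolding E_def
          by (intro has_integral_arith int_c cont_c elim)
        moreover have "((\<lambda>x. a s * (c x + w s x) + s * (z s x * (c x + w s x))) has_integral 0) {-pi..pi}"
          using elim by (simp add: r_def algebra_simps)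
        ultimately have "a s * (0 + integral {-pi..pi} (w s)) + s * E s = 0" by (rule has_integral_unique)
        then show ?thesis using elim by (simp add: i_def field_simps eq_neg_iff_add_eq_0)
      qed
      moreover have i2: "i^2 = \<tau> s + (real l)^2" by (simp add: \<tau>_def i_def power_one_over)
      moreover have "i ^ 3 = i * i^2" by (simp add: power2_eq_square power3_eq_cube)
      ultimately have "(real l)^2 * pi + (real l)^2 * V s - (pi + V s) * (\<tau> s + (real l)^2)
         + s * (2 * Z s * (i * (\<tau> s + (real l)^2)) - (real l)^2 * (2 * Z s - (- s * i * E s)) * i)
         + s^2 * integral {-pi..pi} (D s) = \<mu> s * k s"
        by simp
      moreover define T where "T = \<tau> s / s^2"
      then have "\<tau> s = s^2 * T" using elim by simp
      ultimately have "\<mu> s * k s = s^2 * (- T * (pi + V s) + 2 * i * T * s * Z s - (real l)^2 * i^2 * E s + integral {-pi..pi} (D s))"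
        by (simp add: algebra_simps power2_eq_square)
      then have "(- T * (pi + V s) + 2 * i * T * s * Z s - (real l)^2 * i^2 * E s + integral {-pi..pi} (D s)) = \<mu> s * k s / s^2"
        using elim by simp
      then show ?case using elim unfolding T_def i_def by simp
    qed
  qed
qed

text \<open>\<open>v1\<close> and \<open>v2\<close> stand for \<open>v'\<close> and \<open>v''\<close>.\<close>

definition linearization :: "real \<Rightarrow> (real \<Rightarrow> real) \<Rightarrow> (real \<Rightarrow> real) \<Rightarrow> (real \<Rightarrow> real) \<Rightarrow> real \<Rightarrow> real" where
  "linearization s v v1 v2 x = - v x / ((r s x)^2 * q s x) - p s x * v1 x / (r s x * q s x ^ 3)
     - v2 x / q s x ^ 3 + 3 * p1 s x * p s x * v1 x / q s x ^ 5"

text \<open>\<open>R\<close> and \<open>K\<close> are the two successive primitives in the integrated eigenvalue equation.\<close>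

definition eigen_data where
  "eigen_data s \<kappa> v v1 v2 R K k \<longleftrightarrow>
     (\<forall>x. (v has_real_derivative v1 x) (at x)) \<and> (\<forall>x. (v1 has_real_derivative v2 x) (at x))
     \<and> continuous_on {-pi..pi} v2 \<and> v1 0 = 0 \<and> v1 pi = 0 \<and> v1 (-pi) = 0 \<and> v pi = v (-pi)
     \<and> (\<forall>x. (R has_real_derivative r s x * v x) (at x)) \<and> R 0 = 0
     \<and> (\<forall>x. (K has_real_derivative q s x / r s x * R x) (at x)) \<and> K 0 = 0
     \<and> (\<forall>x\<in>{-pi..pi}. linearization s v v1 v2 x = k + \<kappa> * K x)
     \<and> ((\<lambda>x. r s x * v x) has_integral 0) {-pi..pi} \<and> (\<exists>x\<in>{-pi..pi}. v x \<noteq> 0)"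

section \<open>Eigenfunctions are close to the cosine\<close>

lemma eigen_data_scale:
  assumes "eigen_data s \<kappa> v v1 v2 R K k" "b \<noteq> 0"
  shows "eigen_data s \<kappa> (\<lambda>x. b * v x) (\<lambda>x. b * v1 x) (\<lambda>x. b * v2 x) (\<lambda>x. b * R x) (\<lambda>x. b * K x) (b * k)"
proof -
  have "linearization s (\<lambda>x. b * v x) (\<lambda>x. b * v1 x) (\<lambda>x. b * v2 x) x = b * linearization s v v1 v2 x" for x
    unfolding linearization_def by (simp add: algebra_simps)
  moreover have "((\<lambda>x. b * R x) has_real_derivative r s x * (b * v x)) (at x)" for x
    using assms DERIV_cmult[of R "r s x * v x" x UNIV b] by (simp add: eigen_data_def ac_simps)
  moreover have "((\<lambda>x. b * K x) has_real_derivative q s x / r s x * (b * R x)) (at x)" for x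
    using assms DERIV_cmult[of K "q s x / r s x * R x" x UNIV b] by (simp add: eigen_data_def ac_simps)
  moreover have "((\<lambda>x. r s x * (b * v x)) has_integral 0) {-pi..pi}"
    using assms has_integral_mult_right[of "\<lambda>x. r s x * v x" 0 "{-pi..pi}" b] by (simp add: eigen_data_def ac_simps)
  ultimately show ?thesis
    using assms unfolding eigen_data_def
    by (auto intro!: DERIV_cmult continuous_intros simp: distrib_left)
qed

text \<open>With N a bound for \<open>v\<close>, \<open>v1\<close> and \<open>v2\<close>, the
  equation reads v'' + l^2 v + k = O(t N) for small t, and \<open>perturbed_oscillator\<close> puts
  \<open>v\<close> within d N of v(0) c. For small d this bounds N by a multiple of |v(0)|, so v(0)
  is nonzero. The neighbourhood of s = 0 is the same for all eigen data.\<close>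

lemma eigenfunction_close:
  assumes \<mu>: "(\<mu> \<longlongrightarrow> 0) (at 0)" and e: "e > 0"
  shows "\<forall>\<^sub>F s in at 0. \<forall>v v1 v2 R K k. eigen_data s (\<mu> s) v v1 v2 R K k \<longrightarrow>
    v 0 \<noteq> 0 \<and> (\<forall>x\<in>{-pi..pi}. \<bar>v x - v 0 * c x\<bar> \<le> e * \<bar>v 0\<bar> \<and> \<bar>v1 x - v 0 * c1 x\<bar> \<le> e * \<bar>v 0\<bar>)"
proof -
  define m where "m = real l"
  have m: "m \<ge> 1" using l by (simp add: m_def)
  have m2: "m \<le> m^2" "1 \<le> m^2" using m by (auto intro!: self_le_power one_le_power)
  \<comment> \<open>With d at most 1/6, the error 3 d N in the bound for N is at most N / 2 and is
    absorbed, leaving N at most 6 m^2 |v(0)|; the second entry then makes d N at most e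
    |v(0)|.\<close>
  define d where "d = min (1 / 6) (e / (6 * m^2))"
  have d: "d > 0" "d \<le> 1 / 6" "d * (6 * m^2) \<le> e"
  proof -
    show "d > 0" "d \<le> 1 / 6" using e m by (auto simp: d_def)
    have "d * (6 * m^2) \<le> e / (6 * m^2) * (6 * m^2)" using m by (intro mult_right_mono) (auto simp: d_def)
    then show "d * (6 * m^2) \<le> e" using m by simp
  qed
  \<comment> \<open>320 = 40 * 8: the 40 is the constant of \<open>perturbed_oscillator\<close>, and
    the 8 bounds 2 pi in \<open>Ib\<close>; the residual, with four terms of size t N, fits as
    well.\<close>
  define t where "t = d / (320 * m^2)"
  have t: "t > 0" "40 * m^2 * (8 * t) = d" using d m by (auto simp: t_def)
  have "ulim (\<lambda>s x. real l ^ 2 - 1 / ((r s x)^2 * q s x)) (\<lambda>x. 0)"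
    by (rule ulim_cong, (rule ulim_base ulim_arith | (simp; fail))+) (simp add: power_one_over)
  note A1 = ulim_eventually_less[OF this t(1)]
  have "ulim (\<lambda>s x. 3 * p1 s x * p s x / q s x ^ 5 - p s x / (r s x * q s x ^ 3)) (\<lambda>x. 0)"
    by (rule ulim_cong, (rule ulim_base ulim_arith | (simp; fail))+)
  note A2 = ulim_eventually_less[OF this t(1)]
  have "ulim (\<lambda>s x. 1 - 1 / q s x ^ 3) (\<lambda>x. 0)"
    by (rule ulim_cong, (rule ulim_base ulim_arith | (simp; fail))+)
  note A3 = ulim_eventually_less[OF this t(1)]
  have "ulim (\<lambda>s x. r s x / a s - 1) (\<lambda>x. 0)"
    by (rule ulim_cong, (rule ulim_base ulim_arith | (simp; fail))+)
  note A4 = ulim_eventually_less[OF this t(1)]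
  have "ulim (\<lambda>s x. r s x - 1 / real l) (\<lambda>x. 0)"
    by (rule ulim_cong, (rule ulim_base ulim_arith | (simp; fail))+)
  note A5 = ulim_eventually_less[OF this zero_less_one]
  have "ulim (\<lambda>s x. q s x / r s x - real l) (\<lambda>x. 0)"
    by (rule ulim_cong, (rule ulim_base ulim_arith | (simp; fail))+)
  note A6 = ulim_eventually_less[OF this zero_less_one]
  \<comment> \<open>32 (m + 1) N bounds \<open>K\<close>: two integrations from 0 cost a factor 4
    each, with r at most 2 and q / r at most m + 1.\<close>
  have "t / (32 * (m + 1)) > 0" using t m by simp
  then have "\<forall>\<^sub>F s in at 0. \<bar>\<mu> s\<bar> < t / (32 * (m + 1))"
    using tendstoD[OF \<mu>] by (simp add: dist_real_def)
  then show ?thesis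
    using A1 A2 A3 A4 A5 A6 a_nz ulim_continuousD[OF ulim_r]
  proof (eventually_elim, intro allI impI)
    case (elim s)
    fix v v1 v2 R K :: "real \<Rightarrow> real" and k
    assume "eigen_data s (\<mu> s) v v1 v2 R K k"
    note ed = this[unfolded eigen_data_def]
    have dv: "(v has_real_derivative v1 x) (at x)" and dv1: "(v1 has_real_derivative v2 x) (at x)"
      and dR: "(R has_real_derivative r s x * v x) (at x)" and dK: "(K has_real_derivative q s x / r s x * R x) (at x)" for x
      using ed by auto
    have cv: "continuous_on {-pi..pi} v" "continuous_on {-pi..pi} v1" "continuous_on {-pi..pi} v2"
      using dv dv1 ed by (auto intro!: continuous_at_imp_continuous_on intro: DERIV_isCont)
    \<comment> \<open>The second derivative belongs in the maximum because the coefficient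
      perturbation in \<open>res\<close> also multiplies \<open>v2\<close>.\<close>
    define h where "h = (\<lambda>x. \<bar>v x\<bar> + \<bar>v1 x\<bar> + \<bar>v2 x\<bar>)"
    have "continuous_on {-pi..pi} h" unfolding h_def by (intro continuous_intros cv)
    from continuous_attains_sup[OF _ _ this] obtain x0
      where x0: "x0 \<in> {-pi..pi}" "\<And>x. x \<in> {-pi..pi} \<Longrightarrow> h x \<le> h x0" by auto
    define N where "N = h x0"
    have N: "\<bar>v x\<bar> \<le> N" "\<bar>v1 x\<bar> \<le> N" "\<bar>v2 x\<bar> \<le> N" if "x \<in> {-pi..pi}" for x
      using x0(2)[OF that] unfolding h_def N_def by linarith+
    have N0: "N > 0"
    proof -
      obtain x where "x \<in> {-pi..pi}" "v x \<noteq> 0" using ed by blast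
      then show ?thesis using N(1)[of x] by linarith
    qed
    have Rb: "\<bar>R x\<bar> \<le> 4 * (2 * N)" if "x \<in> {-pi..pi}" for x
    proof (rule deriv_bound_from_0[OF dR _ _ that])
      show "\<bar>r s x * v x\<bar> \<le> 2 * N" if "x \<in> {-pi..pi}" for x
      proof -
        have "1 / real l \<le> 1" using l by simp
        then have "\<bar>r s x\<bar> \<le> 2" using elim(6) that l_pos by (smt (verit) divide_pos_pos)
        then show ?thesis using N(1)[OF that] unfolding abs_mult by (intro mult_mono) auto
      qed
    qed (use ed in auto)
    have Kb: "\<bar>K x\<bar> \<le> 4 * ((m + 1) * (4 * (2 * N)))" if "x \<in> {-pi..pi}" for x
    proof (rule deriv_bound_from_0[OF dK _ _ that])
      show "\<bar>q s x / r s x * R x\<bar> \<le> (m + 1) * (4 * (2 * N))" if "x \<in> {-pi..pi}" for x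
      proof -
        have "\<bar>q s x / r s x - m\<bar> < 1" using elim(7) that by (simp add: m_def)
        then have "\<bar>q s x / r s x\<bar> \<le> m + 1" using m by linarith
        then show ?thesis using Rb[OF that] m unfolding abs_mult[of "q s x / r s x"] by (intro mult_mono) auto
      qed
    qed (use ed in auto)
    have muK: "\<bar>\<mu> s * K x\<bar> \<le> t * N" if "x \<in> {-pi..pi}" for x
    proof -
      have "\<bar>\<mu> s * K x\<bar> \<le> t / (32 * (m + 1)) * (4 * ((m + 1) * (4 * (2 * N))))"
        unfolding abs_mult using elim(1) Kb[OF that] t m by (intro mult_mono) auto
      also have "\<dots> = t * N" using m by (simp add: field_simps)
      finally show ?thesis .
    qed
    have res: "\<bar>v2 x + (real l)^2 * v x + k\<bar> \<le> 8 * t * N" if x: "x \<in> {-pi..pi}" for x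
    proof -
      have "linearization s v v1 v2 x = k + \<mu> s * K x" using ed x by blast
      then have "v2 x + (real l)^2 * v x + k = (real l ^ 2 - 1 / ((r s x)^2 * q s x)) * v x
          + (3 * p1 s x * p s x / q s x ^ 5 - p s x / (r s x * q s x ^ 3)) * v1 x
          + (1 - 1 / q s x ^ 3) * v2 x - \<mu> s * K x"
        by (simp add: linearization_def algebra_simps)
      moreover have "\<bar>(real l ^ 2 - 1 / ((r s x)^2 * q s x)) * v x\<bar> \<le> t * N"
        unfolding abs_mult using elim(2) x N[OF x] t by (intro mult_mono) (auto intro: less_imp_le)
      moreover have "\<bar>(3 * p1 s x * p s x / q s x ^ 5 - p s x / (r s x * q s x ^ 3)) * v1 x\<bar> \<le> t * N"
        using elim(3) x N[OF x] t unfolding abs_mult[of _ "v1 x"] by (intro mult_mono) (auto intro: less_imp_le)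
      moreover have "\<bar>(1 - 1 / q s x ^ 3) * v2 x\<bar> \<le> t * N"
        unfolding abs_mult using elim(4) x N[OF x] t by (intro mult_mono) (auto intro: less_imp_le)
      moreover have "t * N > 0" using t N0 by simp
      ultimately show ?thesis using muK[OF x] unfolding mult.assoc by linarith
    qed
    have vi: "(v has_integral integral {-pi..pi} v) {-pi..pi}"
      using cv(1) by (intro integrable_integral integrable_continuous_real)
    \<comment> \<open>As r v has integral 0 and r / a tends to 1 uniformly, the integral of
      \<open>v\<close> itself is small compared with N.\<close>
    have Ib: "\<bar>integral {-pi..pi} v\<bar> \<le> 8 * t * N"
    proof -
      have "((\<lambda>x. 1 / a s * (r s x * v x) - v x) has_integral 1 / a s * 0 - integral {-pi..pi} v) {-pi..pi}"
        using ed by (intro has_integral_diff has_integral_mult_right vi) blast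
      then have i: "((\<lambda>x. (r s x / a s - 1) * v x) has_integral - integral {-pi..pi} v) {-pi..pi}"
        by (simp add: algebra_simps)
      have "norm (- integral {-pi..pi} v) \<le> t * N * measure lborel (cbox (-pi) pi)"
      proof (rule has_integral_bound)
        show "0 \<le> t * N" using t N0 by simp
        show "((\<lambda>x. (r s x / a s - 1) * v x) has_integral - integral {-pi..pi} v) (cbox (-pi) pi)"
          using i by (simp add: cbox_interval)
        show "norm ((r s x / a s - 1) * v x) \<le> t * N" if "x \<in> cbox (-pi) pi" for x
          unfolding real_norm_def abs_mult using elim(5) that N(1)[of x] t
          by (intro mult_mono) (auto simp: cbox_interval intro: less_imp_le)
      qed
      then have "\<bar>integral {-pi..pi} v\<bar> \<le> (t * N) * (2 * pi)" by simp
      also have "\<dots> \<le> (t * N) * 8" using t N0 pi_less_4 by (intro mult_left_mono) auto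
      finally show ?thesis by simp
    qed
    have v10: "v1 0 = 0" using ed by blast
    note osc = perturbed_oscillator[OF l dv dv1 v10 _ vi Ib]
    have dN: "40 * (real l)^2 * (8 * t * N) = d * N" using t(2) by (simp add: m_def)
    have B: "\<bar>v x - v 0 * c x\<bar> \<le> d * N" "\<bar>v1 x - v 0 * c1 x\<bar> \<le> d * N" "\<bar>v2 x + v 0 * (m^2 * c x)\<bar> \<le> d * N"
      if "x \<in> {-pi..pi}" for x
    proof -
      have "\<bar>v x - v 0 * cos (real l * x)\<bar> \<le> d * N" "\<bar>v1 x + v 0 * real l * sin (real l * x)\<bar> \<le> d * N"
        "\<bar>v2 x + v 0 * (real l)^2 * cos (real l * x)\<bar> \<le> d * N"
        unfolding dN[symmetric] by (rule osc[OF res that]; assumption)+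
      then show "\<bar>v x - v 0 * c x\<bar> \<le> d * N" "\<bar>v1 x - v 0 * c1 x\<bar> \<le> d * N" "\<bar>v2 x + v 0 * (m^2 * c x)\<bar> \<le> d * N"
        by (simp_all add: c_def c1_def m_def mult.assoc)
    qed
    have cb: "\<bar>v 0 * c x\<bar> \<le> m^2 * \<bar>v 0\<bar>" "\<bar>v 0 * c1 x\<bar> \<le> m^2 * \<bar>v 0\<bar>" "\<bar>v 0 * (m^2 * c x)\<bar> \<le> m^2 * \<bar>v 0\<bar>" for x
    proof -
      have c: "\<bar>c x\<bar> \<le> 1" by (simp add: c_def)
      have "\<bar>c1 x\<bar> = m * \<bar>sin (real l * x)\<bar>" by (simp add: c1_def m_def abs_mult)
      also have "\<dots> \<le> m * 1" using m by (intro mult_left_mono) auto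
      finally have c1: "\<bar>c1 x\<bar> \<le> m^2" using m2 by simp
      show "\<bar>v 0 * c x\<bar> \<le> m^2 * \<bar>v 0\<bar>"
        using mult_mono[of "\<bar>c x\<bar>" "m^2" "\<bar>v 0\<bar>" "\<bar>v 0\<bar>"] c m2 by (simp add: abs_mult mult.commute)
      show "\<bar>v 0 * c1 x\<bar> \<le> m^2 * \<bar>v 0\<bar>"
        using mult_mono[of "\<bar>c1 x\<bar>" "m^2" "\<bar>v 0\<bar>" "\<bar>v 0\<bar>"] c1 by (simp add: abs_mult mult.commute)
      have "m^2 * \<bar>c x\<bar> \<le> m^2 * 1" using c by (intro mult_left_mono) auto
      then show "\<bar>v 0 * (m^2 * c x)\<bar> \<le> m^2 * \<bar>v 0\<bar>"
        using mult_mono[of "m^2 * \<bar>c x\<bar>" "m^2" "\<bar>v 0\<bar>" "\<bar>v 0\<bar>"] by (simp add: abs_mult mult.commute)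
    qed
    have "N \<le> 3 * (m^2 * \<bar>v 0\<bar>) + 3 * (d * N)"
    proof -
      have "\<bar>v x0\<bar> \<le> m^2 * \<bar>v 0\<bar> + d * N" "\<bar>v1 x0\<bar> \<le> m^2 * \<bar>v 0\<bar> + d * N" "\<bar>v2 x0\<bar> \<le> m^2 * \<bar>v 0\<bar> + d * N"
        using B[OF x0(1)] cb[of x0] by linarith+
      then show ?thesis by (simp add: N_def h_def)
    qed
    moreover have "d * N \<le> 1 / 6 * N" using d N0 by (intro mult_right_mono) auto
    ultimately have N6: "N \<le> 6 * (m^2 * \<bar>v 0\<bar>)" by linarith
    have "d * N \<le> d * (6 * (m^2 * \<bar>v 0\<bar>))" using d N6 by (intro mult_left_mono) auto
    also have "\<dots> = d * (6 * m^2) * \<bar>v 0\<bar>" by simp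
    also have "\<dots> \<le> e * \<bar>v 0\<bar>" using d by (intro mult_right_mono) auto
    finally have "d * N \<le> e * \<bar>v 0\<bar>" .
    moreover have "v 0 \<noteq> 0" using N6 N0 by auto
    ultimately show "v 0 \<noteq> 0 \<and> (\<forall>x\<in>{-pi..pi}. \<bar>v x - v 0 * c x\<bar> \<le> e * \<bar>v 0\<bar> \<and> \<bar>v1 x - v 0 * c1 x\<bar> \<le> e * \<bar>v 0\<bar>)"
      using B by (meson order_trans)
  qed
qed

section \<open>Weak form and sign of the eigenvalue\<close>

lemma p_has_deriv: "(p s has_real_derivative p1 s x) (at x)"
  unfolding p_def p1_def c1_def c_def
  by (auto intro!: derivative_eq_intros du simp: power2_eq_square)

lemma q_has_deriv: "(q s has_real_derivative p s x * p1 s x / q s x) (at x)"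
proof -
  have "1 + (p s x)^2 > 0" by (simp add: add_pos_nonneg)
  then show ?thesis
    unfolding q_def by (auto intro!: derivative_eq_intros p_has_deriv simp: field_simps)
qed

lemma r_has_deriv: "(r s has_real_derivative p s x) (at x)"
  unfolding r_def p_def c1_def c_def
  by (auto intro!: derivative_eq_intros du simp: algebra_simps)

lemma deriv_r: "deriv (r s) = p s" "deriv (deriv (r s)) = p1 s" "line_elem (r s) = q s"
proof -
  show 1: "deriv (r s) = p s" by (rule ext DERIV_imp_deriv r_has_deriv)+
  show "deriv (deriv (r s)) = p1 s" unfolding 1 by (rule ext DERIV_imp_deriv p_has_deriv)+
  show "line_elem (r s) = q s" by (rule ext) (simp add: line_elem_def q_def 1)
qed

lemma linearization_deriv: "linearization s v (deriv v) (deriv (deriv v)) = linearized_mean_curv (r s) v"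
  unfolding linearized_mean_curv_def deriv_r(2,3) unfolding deriv_r(1)
  by (rule ext) (simp add: linearization_def)

text \<open>Multiply the equation by \<open>c\<close> and add the exact derivative of v1 c / q^3:
  the second-order terms disappear, the boundary terms vanish with \<open>v1\<close>, and the
  constant \<open>k\<close> drops out because \<open>c\<close> has mean zero.\<close>

lemma eigen_weak_form:
  assumes ed: "eigen_data s \<kappa> v v1 v2 R K k"
  shows "(weak_linearization s v v1 has_integral \<kappa> * integral {-pi..pi} (\<lambda>x. K x * c x)) {-pi..pi}"
proof -
  note e = ed[unfolded eigen_data_def]
  have q0: "q s x \<noteq> 0" for x using q_sq(1)[of s x] by auto
  have q3: "((\<lambda>x. q s x ^ 3) has_real_derivative 3 * q s x * (p s x * p1 s x)) (at x)" for x
    using q0[of x] by (auto intro!: derivative_eq_intros q_has_deriv simp: power2_eq_square)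
  have "((\<lambda>x. v1 x / q s x ^ 3 * c x) has_real_derivative
      (v2 x * q s x ^ 3 - v1 x * (3 * q s x * (p s x * p1 s x))) / (q s x ^ 3 * q s x ^ 3) * c x + c1 x * (v1 x / q s x ^ 3)) (at x)" for x
    by (intro DERIV_mult DERIV_divide q3 c_has_deriv(1)) (use e q0 in auto)
  moreover have "(v2 x * q s x ^ 3 - v1 x * (3 * q s x * (p s x * p1 s x))) / (q s x ^ 3 * q s x ^ 3)
     = v2 x / q s x ^ 3 - 3 * p1 s x * p s x * v1 x / q s x ^ 5" for x
  proof -
    have "(V2 * Q ^ 3 - V * (3 * Q * A)) / (Q ^ 3 * Q ^ 3) = V2 / Q ^ 3 - 3 * A * V / Q ^ 5"
      if Q: "Q \<noteq> 0" for V2 Q V A :: real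
    proof -
      have "V2 * Q ^ 3 / (Q ^ 3 * Q ^ 3) = V2 / Q ^ 3"
        by (rule mult_divide_mult_cancel_right) (use Q in simp)
      moreover have "Q * (3 * A * V) / (Q * Q ^ 5) = 3 * A * V / Q ^ 5"
        by (rule mult_divide_mult_cancel_left) (rule Q)
      then have "V * (3 * Q * A) / (Q ^ 3 * Q ^ 3) = 3 * A * V / Q ^ 5"
        by (simp add: eval_nat_numeral ac_simps)
      ultimately show ?thesis by (simp add: diff_divide_distrib)
    qed
    from this[OF q0, of "v2 x" x "v1 x" "p s x * p1 s x"] show ?thesis by (simp add: ac_simps)
  qed
  ultimately have d: "((\<lambda>x. v1 x / q s x ^ 3 * c x) has_real_derivative
      (v2 x / q s x ^ 3 - 3 * p1 s x * p s x * v1 x / q s x ^ 5) * c x + c1 x * (v1 x / q s x ^ 3)) (at x)" for x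
    by (simp only:)
  have "((\<lambda>x. (v2 x / q s x ^ 3 - 3 * p1 s x * p s x * v1 x / q s x ^ 5) * c x + c1 x * (v1 x / q s x ^ 3)) has_integral
      v1 pi / q s pi ^ 3 * c pi - v1 (-pi) / q s (-pi) ^ 3 * c (-pi)) {-pi..pi}"
    by (rule has_integral_deriv_circle) (rule d)
  then have 1: "((\<lambda>x. (v2 x / q s x ^ 3 - 3 * p1 s x * p s x * v1 x / q s x ^ 5) * c x + c1 x * (v1 x / q s x ^ 3)) has_integral 0) {-pi..pi}"
    using e by simp
  have cK: "continuous_on {-pi..pi} K" using e by (auto intro!: continuous_at_imp_continuous_on intro: DERIV_isCont)
  have "((\<lambda>x. k * c x + \<kappa> * (K x * c x)) has_integral k * 0 + \<kappa> * integral {-pi..pi} (\<lambda>x. K x * c x)) {-pi..pi}"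
    by (intro has_integral_arith int_c cK cont_c)
  from has_integral_add[OF this 1]
  have 2: "((\<lambda>x. k * c x + \<kappa> * (K x * c x) + ((v2 x / q s x ^ 3 - 3 * p1 s x * p s x * v1 x / q s x ^ 5) * c x + c1 x * (v1 x / q s x ^ 3))) has_integral
      \<kappa> * integral {-pi..pi} (\<lambda>x. K x * c x)) {-pi..pi}" by simp
  show ?thesis
  proof (rule has_integral_eq[OF _ 2])
    fix x assume "x \<in> {-pi..pi}"
    then have "linearization s v v1 v2 x = k + \<kappa> * K x" using e by blast
    then have "(k + \<kappa> * K x) * c x = linearization s v v1 v2 x * c x" by simp
    then show "k * c x + \<kappa> * (K x * c x) + ((v2 x / q s x ^ 3 - 3 * p1 s x * p s x * v1 x / q s x ^ 5) * c x + c1 x * (v1 x / q s x ^ 3))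
      = weak_linearization s v v1 x"
      by (simp add: linearization_def weak_linearization_def algebra_simps)
  qed
qed

text \<open>Eigen data are normalized by v(0) = 1 and chosen for each s separately, with no
  regularity in s. That the choices converge to \<open>c\<close> follows from
  \<open>eigenfunction_close\<close>, which holds for all eigen data at once.\<close>

lemma eigenvalue_positive:
  assumes tau: "((\<lambda>s. \<tau> s / s^2) \<longlongrightarrow> - (real l ^ 4)) (at 0)"
    and \<mu>: "(\<mu> \<longlongrightarrow> 0) (at 0)"
    and ex: "\<forall>\<^sub>F s in at 0. \<exists>v v1 v2 R K k. eigen_data s (\<mu> s) v v1 v2 R K k"
  shows "\<forall>\<^sub>F s in at 0. \<mu> s > 0"
proof -
  have "\<forall>\<^sub>F s in at 0. \<exists>v v1 v2 R K k. eigen_data s (\<mu> s) v v1 v2 R K k \<and> v 0 = 1"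
    using ex eigenfunction_close[OF \<mu> zero_less_one]
  proof eventually_elim
    case (elim s)
    then obtain v v1 v2 R K k where ed: "eigen_data s (\<mu> s) v v1 v2 R K k" by blast
    then have v0: "v 0 \<noteq> 0" using elim(2) by blast
    have "eigen_data s (\<mu> s) (\<lambda>x. 1 / v 0 * v x) (\<lambda>x. 1 / v 0 * v1 x) (\<lambda>x. 1 / v 0 * v2 x) (\<lambda>x. 1 / v 0 * R x) (\<lambda>x. 1 / v 0 * K x) (1 / v 0 * k)"
      by (rule eigen_data_scale[OF ed]) (use v0 in simp)
    moreover have "1 / v 0 * v 0 = 1" using v0 by simp
    ultimately show ?case by (intro exI conjI) assumption+
  qed
  \<comment> \<open>One tuple, so that a single choice yields six mutually compatible
    components.\<close>
  moreover define P where "P = (\<lambda>s X. case X of (v, v1, v2, R, K, k) \<Rightarrow> eigen_data s (\<mu> s) v v1 v2 R K k \<and> v 0 = 1)"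
  ultimately have "\<forall>\<^sub>F s in at 0. \<exists>X. P s X" by (simp add: P_def)
  then have PX: "\<forall>\<^sub>F s in at 0. P s (SOME X. P s X)" by (auto elim!: eventually_mono intro: someI)
  define v v1 v2 R K k where
    "v = (\<lambda>s. fst (SOME X. P s X))" and "v1 = (\<lambda>s. fst (snd (SOME X. P s X)))"
    and "v2 = (\<lambda>s. fst (snd (snd (SOME X. P s X))))" and "R = (\<lambda>s. fst (snd (snd (snd (SOME X. P s X)))))"
    and "K = (\<lambda>s. fst (snd (snd (snd (snd (SOME X. P s X))))))" and "k = (\<lambda>s. snd (snd (snd (snd (snd (SOME X. P s X))))))"
  have ed: "\<forall>\<^sub>F s in at 0. eigen_data s (\<mu> s) (v s) (v1 s) (v2 s) (R s) (K s) (k s) \<and> v s 0 = 1"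
    using PX by eventually_elim (simp add: P_def v_def v1_def v2_def R_def K_def k_def case_prod_beta)
  define w w1 where "w = (\<lambda>s x. v s x - c x)" and "w1 = (\<lambda>s x. v1 s x - c1 x)"
  have dw: "\<forall>\<^sub>F s in at 0. (\<forall>x. (w s has_real_derivative w1 s x) (at x))
      \<and> (\<forall>x. (w1 s has_real_derivative v2 s x - - ((real l)^2) * c x) (at x))"
    using ed
  proof eventually_elim
    case (elim s)
    show ?case unfolding w_def w1_def
      by (intro conjI allI DERIV_diff c_has_deriv) (use elim in \<open>auto simp: eigen_data_def\<close>)
  qed
  have close: "\<forall>\<^sub>F s in at 0. \<forall>x\<in>{-pi..pi}. \<bar>w s x\<bar> < e \<and> \<bar>w1 s x\<bar> < e" if "e > 0" for e
  proof -
    from that have "e / 2 > 0" by simp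
    from ed eigenfunction_close[OF \<mu> this] show ?thesis
    proof eventually_elim
      case (elim s)
      then have "\<forall>x\<in>{-pi..pi}. \<bar>v s x - v s 0 * c x\<bar> \<le> e / 2 * \<bar>v s 0\<bar> \<and> \<bar>v1 s x - v s 0 * c1 x\<bar> \<le> e / 2 * \<bar>v s 0\<bar>"
        by blast
      moreover have "v s 0 = 1" using elim by blast
      ultimately show ?case using that by (fastforce simp: w_def w1_def)
    qed
  qed
  have ulim_w: "ulim w (\<lambda>x. 0)" "ulim w1 (\<lambda>x. 0)"
  proof -
    have "\<forall>\<^sub>F s in at 0. continuous_on {-pi..pi} (w s)" "\<forall>\<^sub>F s in at 0. continuous_on {-pi..pi} (w1 s)"
      using dw by (auto elim!: eventually_mono intro!: continuous_at_imp_continuous_on intro: DERIV_isCont)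
    moreover have "uniform_limit {-pi..pi} w (\<lambda>x. 0) (at 0)" "uniform_limit {-pi..pi} w1 (\<lambda>x. 0) (at 0)"
      unfolding uniform_limit_iff dist_real_def by (auto intro: eventually_mono[OF close])
    ultimately show "ulim w (\<lambda>x. 0)" "ulim w1 (\<lambda>x. 0)" by (simp_all add: ulim_def)
  qed
  have "ulim (\<lambda>s x. c x + w s x) c"
    by (rule ulim_cong, (rule ulim_w ulim_base ulim_arith | (simp; fail))+)
  then have ulim_v: "ulim v c" by (simp add: w_def)
  have "ulim (\<lambda>s x. r s x * v s x) (\<lambda>x. 1 / real l * c x)"
    by (rule ulim_cong, (rule ulim_v ulim_base ulim_arith | (simp; fail))+)
  then have ulim_R: "ulim R (\<lambda>x. 1 / (real l)^2 * sin (real l * x))"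
  proof (rule ulim_primitive)
    show "\<forall>\<^sub>F s in at 0. \<forall>x. (R s has_real_derivative r s x * v s x) (at x)" "\<forall>\<^sub>F s in at 0. R s 0 = 0"
      using ed by (auto simp: eigen_data_def elim!: eventually_mono)
    show "((\<lambda>x. 1 / (real l)^2 * sin (real l * x)) has_real_derivative 1 / real l * c x) (at x)" for x
      by (auto intro!: derivative_eq_intros simp: c_def power2_eq_square)
  qed simp
  have "ulim (\<lambda>s x. q s x / r s x * R s x) (\<lambda>x. real l * (1 / (real l)^2 * sin (real l * x)))"
    by (rule ulim_cong, (rule ulim_R ulim_base ulim_arith | (simp; fail))+)
  then have ulim_K: "ulim K (\<lambda>x. (1 - c x) / (real l)^2)"
  proof (rule ulim_primitive)
    show "\<forall>\<^sub>F s in at 0. \<forall>x. (K s has_real_derivative q s x / r s x * R s x) (at x)" "\<forall>\<^sub>F s in at 0. K s 0 = 0"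
      using ed by (auto simp: eigen_data_def elim!: eventually_mono)
    show "((\<lambda>x. (1 - c x) / (real l)^2) has_real_derivative real l * (1 / (real l)^2 * sin (real l * x))) (at x)" for x
      using DERIV_cdivide[OF DERIV_diff[OF DERIV_const[of 1] c_has_deriv(1)[of x]], of "(real l)^2"] by (simp add: c1_def)
  qed (simp add: c_def)
  have vw: "v s x = c x + w s x" "v1 s x = c1 x + w1 s x" for s x by (simp_all add: w_def w1_def)
  have "((\<lambda>s. \<mu> s / s^2) \<longlongrightarrow> 3 * real l ^ 6) (at 0)"
  proof (rule eigenvalue_asymptotics[OF tau ulim_w ulim_K])
    show "\<forall>\<^sub>F s in at 0. (\<forall>x. (w s has_real_derivative w1 s x) (at x)) \<and> w s pi = w s (-pi)
      \<and> ((\<lambda>x. r s x * (c x + w s x)) has_integral 0) {-pi..pi}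
      \<and> (weak_linearization s (\<lambda>x. c x + w s x) (\<lambda>x. c1 x + w1 s x) has_integral \<mu> s * integral {-pi..pi} (\<lambda>x. K s x * c x)) {-pi..pi}"
      using ed dw
    proof eventually_elim
      case (elim s)
      then have e: "eigen_data s (\<mu> s) (v s) (v1 s) (v2 s) (R s) (K s) (k s)" by blast
      have "w s pi = w s (-pi)" using e by (simp add: eigen_data_def w_def c_def)
      moreover have "((\<lambda>x. r s x * v s x) has_integral 0) {-pi..pi}" using e by (simp add: eigen_data_def)
      ultimately show ?case
        using elim eigen_weak_form[OF e] by (simp flip: vw)
    qed
  qed
  then have "\<forall>\<^sub>F s in at 0. \<mu> s / s^2 > 0" by (rule order_tendstoD) simp
  then show ?thesis by eventually_elim (simp add: zero_less_divide_iff)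
qed

end

section \<open>The Crandall--Rabinowitz curve\<close>

text \<open>Cauchy estimate: bounded terms at \<open>s1\<close> dominate the tail at
  \<open>s\<close> by a geometric series of ratio at most 1/2, hence the factor 2.\<close>

lemma power_series_tail_bound:
  fixes b :: "nat \<Rightarrow> real"
  assumes S: "(\<lambda>n. s ^ n * b n) sums S" and s1: "s1 > 0" and M: "\<And>n. \<bar>s1 ^ n * b n\<bar> \<le> M" and s: "\<bar>s\<bar> \<le> s1 / 2"
  shows "\<bar>S - (\<Sum>n<k. s ^ n * b n)\<bar> \<le> 2 * M * (\<bar>s\<bar> / s1) ^ k"
proof -
  define y where "y = \<bar>s\<bar> / s1"
  have y: "0 \<le> y" "y \<le> 1 / 2" using s s1 by (auto simp: y_def field_simps)
  have M0: "0 \<le> M" using M[of 0] by linarith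
  have le: "\<bar>s ^ n * b n\<bar> \<le> M * y ^ n" for n
  proof -
    have "\<bar>s ^ n * b n\<bar> = \<bar>s1 ^ n * b n\<bar> * y ^ n"
      using s1 by (simp add: y_def abs_mult power_abs power_divide)
    then show ?thesis using M[of n] y by (simp add: mult_right_mono)
  qed
  have g: "(\<lambda>n. M * y ^ k * y ^ n) sums (M * y ^ k * (1 / (1 - y)))"
    using y by (intro sums_mult geometric_sums) auto
  have "(\<lambda>n. s ^ (n + k) * b (n + k)) sums (S - (\<Sum>n<k. s ^ n * b n))"
    using sums_split_initial_segment[OF S] .
  then have "\<bar>S - (\<Sum>n<k. s ^ n * b n)\<bar> \<le> M * y ^ k * (1 / (1 - y))"
  proof (rule norm_sums_le[where 'a = real, unfolded real_norm_def, OF _ g])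
    show "\<bar>s ^ (n + k) * b (n + k)\<bar> \<le> M * y ^ k * y ^ n" for n
      using le[of "n + k"] by (simp add: power_add mult.assoc mult.commute[of "y ^ n"])
  qed
  also have "\<dots> \<le> M * y ^ k * 2"
    using y M0 by (intro mult_left_mono) (auto simp: field_simps)
  finally show ?thesis by (simp add: y_def)
qed

lemma higher_deriv_sum:
  assumes "f \<in> Ck_circle k" "\<And>n. g n \<in> Ck_circle k" "j \<le> k"
  shows "(\<lambda>x. f x - (\<Sum>n<N::nat. t n * g n x)) \<in> Ck_circle k
    \<and> (deriv ^^ j) (\<lambda>x. f x - (\<Sum>n<N. t n * g n x)) = (\<lambda>x. (deriv ^^ j) f x - (\<Sum>n<N. t n * (deriv ^^ j) (g n) x))"
proof (induction N)
  case (Suc N)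
  have eq: "(\<lambda>x. f x - (\<Sum>n<Suc N. t n * g n x)) = (\<lambda>x. 1 * (f x - (\<Sum>n<N. t n * g n x)) + (- t N) * g N x)"
    by (auto simp: algebra_simps)
  show ?case
    unfolding eq using Suc Ck_circle_linear[OF conjunct1[OF Suc] assms(2), of 1 "- t N" N]
      higher_deriv_linear[OF conjunct1[OF Suc] assms(2,3), of 1 "- t N" N]
    by (auto simp: algebra_simps)
qed (use assms in auto)

lemma holder_space_sum:
  assumes "f \<in> holder_space k \<alpha>" "\<And>n. g n \<in> holder_space k \<alpha>"
  shows "(\<lambda>x. f x - (\<Sum>n<N::nat. t n * g n x)) \<in> holder_space k \<alpha>"
proof (induction N)
  case (Suc N)
  have eq: "(\<lambda>x. f x - (\<Sum>n<Suc N. t n * g n x)) = (\<lambda>x. 1 * (f x - (\<Sum>n<N. t n * g n x)) + (- t N) * g N x)"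
    by (auto simp: algebra_simps)
  show ?case unfolding eq by (rule holder_space_linear[OF Suc assms(2)])
qed (use assms in auto)

text \<open>Norm convergence of the series of the curve gives termwise series for all derivatives up
  to order 4, with coefficient bounds uniform in x. The value at s = 0 makes the zeroth coefficient
  vanish and the tangent direction makes the first one cos (l x), so \<rho> / s^2 - cos (l x) / s
  tends to the second coefficient at rate |s|.\<close>

lemma branch_expansion:
  assumes \<alpha>: "0 < \<alpha>" "\<alpha> < 1" and br: "bifurcation_branch \<alpha> l \<delta> \<rho> lam"
  shows "\<exists>u u0. (\<forall>s. u s \<in> Ck_circle 4 \<and> (u s has_integral 0) {-pi..pi}) \<and> u0 \<in> Ck_circle 4
    \<and> (\<forall>s. 0 < \<bar>s\<bar> \<and> \<bar>s\<bar> < \<delta> \<longrightarrow> \<rho> s = (\<lambda>x. s * (cos (real l * x) + s * u s x)))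
    \<and> (\<forall>j\<le>4. \<exists>C. \<forall>\<^sub>F s in at 0. \<forall>x. \<bar>(deriv ^^ j) (u s) x - (deriv ^^ j) u0 x\<bar> \<le> C * \<bar>s\<bar>)"
proof -
  let ?X = "little_holder0_even 4 \<alpha>" and ?n = "holder_norm 4 \<alpha>" and ?cos = "\<lambda>x. cos (real l * x)"
  have \<delta>: "\<delta> > 0" and ana: "analytic_curve_on ?X ?n {-\<delta><..<\<delta>} \<rho>" and \<rho>0: "\<rho> 0 = (\<lambda>x. 0)"
    and tangent: "((\<lambda>s. ?n (\<lambda>x. (\<rho> s x - \<rho> 0 x) / s - ?cos x)) \<longlongrightarrow> 0) (at 0)"
    using br by (auto simp: bifurcation_branch_def)
  have \<rho>X: "\<rho> s \<in> ?X" if "\<bar>s\<bar> < \<delta>" for s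
    using ana that by (auto simp: analytic_curve_on_def abs_less_iff)
  have "0 \<in> {-\<delta><..<\<delta>}" using \<delta> by simp
  then obtain b R where R: "R > 0" and bX: "\<And>n::nat. b n \<in> ?X"
    and conv: "\<And>s. s \<in> {-\<delta><..<\<delta>} \<Longrightarrow> \<bar>s - 0\<bar> < R \<Longrightarrow>
           (\<lambda>N. ?n (\<lambda>x. \<rho> s x - (\<Sum>n<N. (s - 0) ^ n * b n x))) \<longlonglongrightarrow> 0"
    using ana unfolding analytic_curve_on_def by blast
  define R' where "R' = min R \<delta>"
  have R': "R' > 0" using R \<delta> by (simp add: R'_def)
  have lim: "(\<lambda>N. ?n (\<lambda>x. \<rho> s x - (\<Sum>n<N. s ^ n * b n x))) \<longlonglongrightarrow> 0" if "\<bar>s\<bar> < R'" for s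
    using conv[of s] that by (auto simp: R'_def abs_less_iff)
  have bh: "b n \<in> holder_space 4 \<alpha>" and bk: "b n \<in> Ck_circle 4" for n
    using little_holder0_evenD[OF bX \<alpha>] by auto
  have \<rho>h: "\<rho> s \<in> holder_space 4 \<alpha>" and \<rho>k: "\<rho> s \<in> Ck_circle 4" if "\<bar>s\<bar> < \<delta>" for s
    using little_holder0_evenD[OF \<rho>X[OF that] \<alpha>] by auto
  have err: "\<bar>(deriv ^^ j) (\<rho> s) x - (\<Sum>n<N. s ^ n * (deriv ^^ j) (b n) x)\<bar> \<le> ?n (\<lambda>x. \<rho> s x - (\<Sum>n<N. s ^ n * b n x))"
    if "\<bar>s\<bar> < R'" "j \<le> 4" for s j x N
  proof -
    have s: "\<bar>s\<bar> < \<delta>" using that by (simp add: R'_def)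
    have "(\<lambda>x. \<rho> s x - (\<Sum>n<N. s ^ n * b n x)) \<in> holder_space 4 \<alpha>"
      by (rule holder_space_sum[OF \<rho>h[OF s] bh])
    from holder_norm_bound[OF this that(2), of x] show ?thesis
      using higher_deriv_sum[OF \<rho>k[OF s] bk that(2), where N = N and t = "\<lambda>n. s ^ n"] by simp
  qed
  have sums: "(\<lambda>n. s ^ n * (deriv ^^ j) (b n) x) sums (deriv ^^ j) (\<rho> s) x" if "\<bar>s\<bar> < R'" "j \<le> 4" for s j x
  proof -
    have "(\<lambda>N. (deriv ^^ j) (\<rho> s) x - (\<Sum>n<N. s ^ n * (deriv ^^ j) (b n) x)) \<longlonglongrightarrow> 0"
      by (rule Lim_null_comparison[OF _ lim[OF that(1)]]) (use err[OF that] in auto)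
    then have "(\<lambda>N. (deriv ^^ j) (\<rho> s) x - ((deriv ^^ j) (\<rho> s) x - (\<Sum>n<N. s ^ n * (deriv ^^ j) (b n) x))) \<longlonglongrightarrow> (deriv ^^ j) (\<rho> s) x - 0"
      by (intro tendsto_intros)
    then show ?thesis by (simp add: sums_def)
  qed
  define s1 where "s1 = R' / 2"
  have s1: "s1 > 0" "\<bar>s1\<bar> < R'" using R' by (auto simp: s1_def)
  obtain B where B: "\<And>N. \<bar>?n (\<lambda>x. \<rho> s1 x - (\<Sum>n<N. s1 ^ n * b n x))\<bar> \<le> B"
    using convergent_imp_Bseq[OF convergentI[OF lim[OF s1(2)]]] by (auto simp: Bseq_def)
  \<comment> \<open>Each term is a difference of two consecutive truncation errors, both at most
    \<open>B\<close>.\<close>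
  have bound: "\<bar>s1 ^ n * (deriv ^^ j) (b n) x\<bar> \<le> 2 * B" if "j \<le> 4" for n j x
    using err[OF s1(2) that, of x n] err[OF s1(2) that, of x "Suc n"] B[of n] B[of "Suc n"]
    by simp
  have tail: "\<bar>(deriv ^^ j) (\<rho> s) x - (\<Sum>n<k. s ^ n * (deriv ^^ j) (b n) x)\<bar> \<le> 2 * (2 * B) * (\<bar>s\<bar> / s1) ^ k"
    if "\<bar>s\<bar> \<le> s1 / 2" "j \<le> 4" for s j x k
    by (rule power_series_tail_bound[OF sums s1(1) bound]) (use that s1 in auto)
  have b0: "b 0 = (\<lambda>x. 0)"
  proof
    fix x
    have "(\<lambda>n. 0 ^ n * b n x) sums \<rho> 0 x" using sums[of 0 0 x] R' by simp
    moreover have "(\<lambda>n. 0 ^ n * b n x) sums b 0 x"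
      using powser_sums_zero[of "\<lambda>n. b n x"] by (simp add: mult.commute)
    ultimately show "b 0 x = 0" using sums_unique2 \<rho>0 by metis
  qed
  have b0d: "(deriv ^^ j) (b 0) x = 0" for j x unfolding b0 by (simp add: higher_deriv_const)
  have small: "\<forall>\<^sub>F s in at (0::real). 0 < \<bar>s\<bar> \<and> \<bar>s\<bar> \<le> s1 / 2 \<and> \<bar>s\<bar> < \<delta>"
    unfolding eventually_at using s1 \<delta> by (intro exI[of _ "min (s1 / 2) \<delta>"]) auto
  have b1: "b 1 = ?cos"
  proof
    fix x
    have "((\<lambda>s. \<rho> s x / s - ?cos x) \<longlongrightarrow> 0) (at 0)"
    proof (rule Lim_null_comparison[OF _ tangent])
      show "\<forall>\<^sub>F s in at 0. norm (\<rho> s x / s - ?cos x) \<le> ?n (\<lambda>x. (\<rho> s x - \<rho> 0 x) / s - ?cos x)"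
        using small
      proof eventually_elim
        case (elim s)
        have eq: "(\<lambda>x. (\<rho> s x - \<rho> 0 x) / s - ?cos x) = (\<lambda>x. (1 / s) * \<rho> s x + (- 1) * ?cos x)"
          by (simp add: \<rho>0)
        have "(\<lambda>x. (1 / s) * \<rho> s x + (- 1) * ?cos x) \<in> holder_space 4 \<alpha>"
          using elim by (intro holder_space_linear \<rho>h holder_space_cos \<alpha>) auto
        from holder_norm_bound[OF this, of 0 x] show ?case unfolding eq by simp
      qed
    qed
    then have "((\<lambda>s. \<rho> s x / s - ?cos x + ?cos x) \<longlongrightarrow> 0 + ?cos x) (at 0)" by (intro tendsto_intros)
    then have 1: "((\<lambda>s. \<rho> s x / s) \<longlongrightarrow> ?cos x) (at 0)" by simp
    have "((\<lambda>s. \<rho> s x / s - b 1 x) \<longlongrightarrow> 0) (at 0)"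
    proof (rule Lim_null_comparison)
      show "\<forall>\<^sub>F s in at 0. norm (\<rho> s x / s - b 1 x) \<le> 2 * (2 * B) / s1^2 * \<bar>s\<bar>"
        using small
      proof eventually_elim
        case (elim s)
        have "\<bar>\<rho> s x - s * b 1 x\<bar> \<le> 2 * (2 * B) * (\<bar>s\<bar> / s1) ^ 2"
          using tail[of s 0 x 2] elim by (simp add: numeral_2_eq_2 b0)
        moreover have "\<rho> s x / s - b 1 x = (\<rho> s x - s * b 1 x) / s" using elim by (simp add: field_simps)
        ultimately have "norm (\<rho> s x / s - b 1 x) \<le> 2 * (2 * B) * (\<bar>s\<bar> / s1) ^ 2 / \<bar>s\<bar>"
          using elim by (simp add: divide_right_mono)
        also have "\<dots> = 2 * (2 * B) / s1^2 * \<bar>s\<bar>"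
        proof -
          have key: "2 * (2 * B) * (t / s1) ^ 2 / t = 2 * (2 * B) / s1^2 * t" if "t \<noteq> 0" for t
            using that by (simp add: power_divide power2_eq_square)
          show ?thesis by (rule key) (use elim in simp)
        qed
        finally show ?case .
      qed
      have "((\<lambda>s. 2 * (2 * B) / s1^2 * \<bar>s\<bar>) \<longlongrightarrow> 2 * (2 * B) / s1^2 * \<bar>0\<bar>) (at 0)" by (intro tendsto_intros) (use s1 in auto)
      then show "((\<lambda>s. 2 * (2 * B) / s1^2 * \<bar>s\<bar>) \<longlongrightarrow> 0) (at 0)" by simp
    qed
    then have "((\<lambda>s. \<rho> s x / s - b 1 x + b 1 x) \<longlongrightarrow> 0 + b 1 x) (at 0)" by (intro tendsto_intros)
    then have 2: "((\<lambda>s. \<rho> s x / s) \<longlongrightarrow> b 1 x) (at 0)" by simp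
    show "b 1 x = ?cos x" using tendsto_unique[OF _ 2 1] by simp
  qed
  \<comment> \<open>The value outside the punctured interval is set to the limit \<open>b 2\<close>,
    so that regularity and mean zero hold for every s.\<close>
  define u where "u = (\<lambda>s. if 0 < \<bar>s\<bar> \<and> \<bar>s\<bar> < \<delta> then (\<lambda>x. 1 / s^2 * \<rho> s x + (- 1 / s) * b 1 x) else b 2)"
  have b_int: "(b n has_integral 0) {-pi..pi}" for n by (rule little_holder0_evenD(4)[OF bX \<alpha>])
  have uk: "u s \<in> Ck_circle 4" for s
    using Ck_circle_linear[OF \<rho>k bk, of s "1 / s^2" "- 1 / s" 1] bk by (simp add: u_def)
  have ui: "(u s has_integral 0) {-pi..pi}" for s
  proof (cases "0 < \<bar>s\<bar> \<and> \<bar>s\<bar> < \<delta>")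
    case True
    then have "(\<rho> s has_integral 0) {-pi..pi}" using little_holder0_evenD(4)[OF \<rho>X \<alpha>] by blast
    then have "((\<lambda>x. 1 / s^2 * \<rho> s x + (- 1 / s) * b 1 x) has_integral 1 / s^2 * 0 + (- 1 / s) * 0) {-pi..pi}"
      by (intro has_integral_add has_integral_mult_right b_int)
    then show ?thesis using True by (simp add: u_def)
  next
    case False
    then have "u s = b 2" unfolding u_def by (rule if_not_P)
    then show ?thesis using b_int by simp
  qed
  have "\<rho> s = (\<lambda>x. s * (?cos x + s * u s x))" if "0 < \<bar>s\<bar> \<and> \<bar>s\<bar> < \<delta>" for s
    using that by (auto simp: u_def b1[simplified] field_simps power2_eq_square)
  moreover have "\<exists>C. \<forall>\<^sub>F s in at 0. \<forall>x. \<bar>(deriv ^^ j) (u s) x - (deriv ^^ j) (b 2) x\<bar> \<le> C * \<bar>s\<bar>" if j: "j \<le> 4" for j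
  proof -
    have "\<forall>\<^sub>F s in at 0. \<forall>x. \<bar>(deriv ^^ j) (u s) x - (deriv ^^ j) (b 2) x\<bar> \<le> 2 * (2 * B) / s1 ^ 3 * \<bar>s\<bar>"
      using small
    proof (eventually_elim, intro allI)
      case (elim s)
      fix x
      have "(deriv ^^ j) (u s) x = 1 / s^2 * (deriv ^^ j) (\<rho> s) x + (- 1 / s) * (deriv ^^ j) (b 1) x"
        using elim higher_deriv_linear[OF \<rho>k bk j, of s "1 / s^2" "- 1 / s" 1] by (simp add: u_def)
      moreover have "1 / s^2 * X + (- 1 / s) * Y - Z = (X - (s * Y + s^2 * Z)) / s^2" for X Y Z
        using elim by (simp add: field_simps power2_eq_square)
      moreover have "(\<Sum>n<3. s ^ n * (deriv ^^ j) (b n) x) = s * (deriv ^^ j) (b 1) x + s^2 * (deriv ^^ j) (b 2) x"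
        by (simp add: numeral_3_eq_3 numeral_2_eq_2 b0d)
      ultimately have "(deriv ^^ j) (u s) x - (deriv ^^ j) (b 2) x
        = ((deriv ^^ j) (\<rho> s) x - (\<Sum>n<3. s ^ n * (deriv ^^ j) (b n) x)) / s^2"
        by (simp only:)
      also have "\<bar>\<dots>\<bar> \<le> 2 * (2 * B) * (\<bar>s\<bar> / s1) ^ 3 / s^2"
        using tail[of s j x 3] elim j by (simp add: abs_divide divide_right_mono)
      also have "(\<bar>s\<bar> / s1) ^ 3 = s^2 * \<bar>s\<bar> / s1 ^ 3"
        by (simp add: power_divide power3_eq_cube power2_eq_square flip: abs_mult)
      finally show "\<bar>(deriv ^^ j) (u s) x - (deriv ^^ j) (b 2) x\<bar> \<le> 2 * (2 * B) / s1 ^ 3 * \<bar>s\<bar>"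
        using elim by simp
    qed
    then show ?thesis by blast
  qed
  ultimately show ?thesis using uk ui bk by blast
qed

text \<open>Termwise differentiation near 0 gives the derivatives b 1 and 2 b 2. A finite limit of
  the quotient by s^2 forces b 1 = 0, and the cubic tail bound identifies the limit with b
  2.\<close>

lemma real_analytic_expansion:
  assumes ana: "real_analytic_on {-\<delta><..<\<delta>} f" and \<delta>: "\<delta> > 0"
  shows "(f \<longlongrightarrow> f 0) (at 0)"
    and "((\<lambda>s. (f s - f 0) / s^2) \<longlongrightarrow> L) (at 0) \<Longrightarrow> deriv f 0 = 0 \<and> deriv (deriv f) 0 = 2 * L"
proof -
  have "0 \<in> {-\<delta><..<\<delta>}" using \<delta> by simp
  then obtain b R where R: "R > 0"
    and sums0: "\<And>s. s \<in> {-\<delta><..<\<delta>} \<Longrightarrow> \<bar>s - 0\<bar> < R \<Longrightarrow> (\<lambda>n. b n * (s - 0) ^ n) sums f s"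
    using ana unfolding real_analytic_on_def by blast
  define K where "K = min R \<delta>"
  have K: "K > 0" using R \<delta> by (simp add: K_def)
  have sums: "(\<lambda>n. b n * s ^ n) sums f s" if "\<bar>s\<bar> < K" for s
    using sums0[of s] that by (auto simp: K_def abs_less_iff)
  have summable: "summable (\<lambda>n. b n * s ^ n)" if "norm s < K" for s
    using sums[of s] that by (auto simp: summable_def)
  have f_eq: "f s = (\<Sum>n. b n * s ^ n)" if "s \<in> {-K<..<K}" for s
    using sums[of s] that by (simp add: sums_iff abs_less_iff)
  have d1: "(f has_real_derivative (\<Sum>n. diffs b n * s ^ n)) (at s)" if s: "s \<in> {-K<..<K}" for s
  proof (rule has_field_derivative_transform_within_open[where S = "{-K<..<K}"])
    show "((\<lambda>s. \<Sum>n. b n * s ^ n) has_real_derivative (\<Sum>n. diffs b n * s ^ n)) (at s)"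
      by (rule termdiffs_strong'[OF summable]) (use s in \<open>auto simp: abs_less_iff\<close>)
  qed (use s f_eq in auto)
  have summable': "summable (\<lambda>n. diffs b n * s ^ n)" if "norm s < K" for s
    using termdiff_converges[OF that summable] .
  have d2: "(deriv f has_real_derivative (\<Sum>n. diffs (diffs b) n * 0 ^ n)) (at 0)"
  proof (rule has_field_derivative_transform_within_open[where S = "{-K<..<K}"])
    show "((\<lambda>s. \<Sum>n. diffs b n * s ^ n) has_real_derivative (\<Sum>n. diffs (diffs b) n * 0 ^ n)) (at 0)"
      by (rule termdiffs_strong'[OF summable']) (use K in auto)
    show "(\<Sum>n. diffs b n * s ^ n) = deriv f s" if "s \<in> {-K<..<K}" for s
      using DERIV_imp_deriv[OF d1[OF that]] by simp
  qed (use K in auto)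
  have f0: "f 0 = b 0" using f_eq[of 0] K by simp
  have f1: "(f has_real_derivative b 1) (at 0)"
    using d1[of 0] K by (simp add: diffs_def)
  have f2: "deriv (deriv f) 0 = 2 * b 2"
    using DERIV_imp_deriv[OF d2] by (simp add: diffs_def numeral_2_eq_2)
  show cont: "(f \<longlongrightarrow> f 0) (at 0)"
    using DERIV_isCont[OF f1] by (simp add: isCont_def)
  assume L: "((\<lambda>s. (f s - f 0) / s^2) \<longlongrightarrow> L) (at 0)"
  have nz: "\<forall>\<^sub>F s in at (0::real). s \<noteq> 0" by (simp add: eventually_at_filter)
  have "((\<lambda>s. s * ((f s - f 0) / s^2)) \<longlongrightarrow> 0 * L) (at 0)" by (intro tendsto_intros L)
  then have "((\<lambda>s. (f s - f 0) / s) \<longlongrightarrow> 0 * L) (at 0)"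
    by (rule Lim_transform_eventually) (use nz in eventually_elim, simp add: power2_eq_square)
  then have b1: "b 1 = 0"
    using f1 tendsto_unique[of "at 0" "\<lambda>s. (f s - f 0) / s"] by (simp add: has_field_derivative_iff)
  define s1 where "s1 = K / 2"
  have s1: "s1 > 0" "\<bar>s1\<bar> < K" using K by (auto simp: s1_def)
  have "Bseq (\<lambda>n. b n * s1 ^ n)"
    using summable_LIMSEQ_zero[OF summable[of s1]] s1 by (intro convergent_imp_Bseq convergentI) auto
  then obtain M where M: "\<And>n. \<bar>b n * s1 ^ n\<bar> \<le> M" by (auto simp: Bseq_def)
  have "((\<lambda>s. (f s - f 0) / s^2 - b 2) \<longlongrightarrow> 0) (at 0)"
  proof (rule Lim_null_comparison)
    have "\<forall>\<^sub>F s in at (0::real). 0 < \<bar>s\<bar> \<and> \<bar>s\<bar> \<le> s1 / 2"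
      unfolding eventually_at using s1 by (intro exI[of _ "s1 / 2"]) auto
    then show "\<forall>\<^sub>F s in at 0. norm ((f s - f 0) / s^2 - b 2) \<le> 2 * M / s1 ^ 3 * \<bar>s\<bar>"
    proof eventually_elim
      case (elim s)
      have "(\<lambda>n. s ^ n * b n) sums f s" using sums[of s] elim s1 by (simp add: mult.commute)
      from power_series_tail_bound[OF this s1(1) _ conjunct2[OF elim], of M 3]
      have t: "\<bar>f s - (\<Sum>n<3. s ^ n * b n)\<bar> \<le> 2 * M * (\<bar>s\<bar> / s1) ^ 3"
        using M by (simp add: mult.commute)
      have "(f s - f 0) / s^2 - b 2 = (f s - (\<Sum>n<3. s ^ n * b n)) / s^2"
        using elim b1 by (simp add: numeral_3_eq_3 numeral_2_eq_2 f0 field_simps)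
      also have "norm \<dots> \<le> 2 * M * (\<bar>s\<bar> / s1) ^ 3 / s^2"
        using t by (simp add: abs_divide divide_right_mono)
      also have "(\<bar>s\<bar> / s1) ^ 3 = s^2 * \<bar>s\<bar> / s1 ^ 3"
        by (simp add: power_divide power3_eq_cube power2_eq_square flip: abs_mult)
      finally show ?case using elim by simp
    qed
    have "((\<lambda>s. 2 * M / s1 ^ 3 * \<bar>s\<bar>) \<longlongrightarrow> 2 * M / s1 ^ 3 * \<bar>0\<bar>) (at 0)" by (intro tendsto_intros) (use s1 in auto)
    then show "((\<lambda>s. 2 * M / s1 ^ 3 * \<bar>s\<bar>) \<longlongrightarrow> 0) (at 0)" by simp
  qed
  then have "((\<lambda>s. (f s - f 0) / s^2 - b 2 + b 2) \<longlongrightarrow> 0 + b 2) (at 0)" by (intro tendsto_intros)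
  then have "b 2 = L" using tendsto_unique[OF _ _ L, of "b 2"] by simp
  then show "deriv f 0 = 0 \<and> deriv (deriv f) 0 = 2 * L"
    using f2 DERIV_imp_deriv[OF f1] b1 by simp
qed

text \<open>Constants are orthogonal to cos (l x), and the second-order part of the curvature is the
  derivative of a periodic function, by \<open>slope_has_deriv\<close>. One integration by parts
  leaves first derivatives only.\<close>

lemma cmc_weak_form:
  assumes r: "r \<in> Ck_circle 4" and pos: "\<And>x. r x > 0" and cmc: "\<And>x. mean_curv r x = mean_curv r 0" and l: "l \<ge> (1::nat)"
  shows "((\<lambda>x. cos (real l * x) / (r x * line_elem r x) + (- real l * sin (real l * x)) * deriv r x / line_elem r x) has_integral 0) {-pi..pi}"
proof -
  define p where "p = (\<lambda>x. deriv r x / line_elem r x)"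
  have d: "((\<lambda>x. p x * cos (real l * x)) has_real_derivative
      deriv (deriv r) x / line_elem r x ^ 3 * cos (real l * x) + (- real l * sin (real l * x)) * p x) (at x)" for x
    unfolding p_def by (rule DERIV_mult[OF slope_has_deriv[OF r]]) (auto intro!: derivative_eq_intros)
  have per: "p pi = p (- pi)"
    using Ck_circle_periodic[OF r, of 1 "-pi"] by (simp add: p_def line_elem_def)
  have "((\<lambda>x. deriv (deriv r) x / line_elem r x ^ 3 * cos (real l * x) + (- real l * sin (real l * x)) * p x) has_integral 0) {-pi..pi}"
    using has_integral_deriv_circle[OF d] by (simp add: per)
  moreover have "((\<lambda>x. mean_curv r 0 * cos (real l * x)) has_integral mean_curv r 0 * 0) {-pi..pi}"
    by (intro has_integral_mult_right trig_integrals(1)[OF l])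
  ultimately have "((\<lambda>x. deriv (deriv r) x / line_elem r x ^ 3 * cos (real l * x) + (- real l * sin (real l * x)) * p x
     + mean_curv r 0 * cos (real l * x)) has_integral 0 + mean_curv r 0 * 0) {-pi..pi}"
    by (rule has_integral_add)
  then show ?thesis
  proof (rule has_integral_eq[rotated, THEN has_integral_eq_rhs])
    fix x
    have "mean_curv r 0 = 1 / (r x * line_elem r x) - deriv (deriv r) x / line_elem r x ^ 3"
      using cmc[of x] by (simp add: mean_curv_line_elem)
    then show "deriv (deriv r) x / line_elem r x ^ 3 * cos (real l * x) + (- real l * sin (real l * x)) * p x
     + mean_curv r 0 * cos (real l * x) = cos (real l * x) / (r x * line_elem r x) + (- real l * sin (real l * x)) * deriv r x / line_elem r x"
      by (simp add: p_def left_diff_distrib)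
  qed simp
qed

text \<open>Put A = 1 / a^2 = l^2 - l^4 s^2 + o(s^2). Then lambda^2 = A / (1 + s^2 I A) with I
  tending to 1/2, so lambda^2 = l^2 - (1 + 1/2) l^4 s^2 + o(s^2); dividing by lambda + l gives the
  3/4.\<close>

lemma lambda_expansion:
  fixes a I lam :: "real \<Rightarrow> real"
  assumes l: "l > 0" and lam: "(lam \<longlongrightarrow> l) (at 0)" and I: "(I \<longlongrightarrow> 1 / 2) (at 0)"
    and tau: "((\<lambda>s. (1 / (a s)^2 - l^2) / s^2) \<longlongrightarrow> - (l ^ 4)) (at 0)"
    and a: "\<forall>\<^sub>F s in at 0. a s > 0 \<and> (a s)^2 = 1 / (lam s)^2 - s^2 * I s"
  shows "((\<lambda>s. (lam s - l) / s^2) \<longlongrightarrow> - (3 / 4) * l ^ 3) (at 0)"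
proof -
  define T where "T = (\<lambda>s. (1 / (a s)^2 - l^2) / s^2)"
  define g where "g = (\<lambda>s. (T s - I s * l^2 * (l^2 + s^2 * T s)) / (1 + s^2 * I s * (l^2 + s^2 * T s)) / (lam s + l))"
  have T: "(T \<longlongrightarrow> - (l ^ 4)) (at 0)" using tau by (simp add: T_def)
  have "(g \<longlongrightarrow> (- (l ^ 4) - 1 / 2 * l^2 * (l^2 + 0^2 * - (l ^ 4))) / (1 + 0^2 * (1 / 2) * (l^2 + 0^2 * - (l ^ 4))) / (l + l)) (at 0)"
    unfolding g_def using l by (intro tendsto_intros T I lam tendsto_ident_at) auto
  also have "(- (l ^ 4) - 1 / 2 * l^2 * (l^2 + 0^2 * - (l ^ 4))) / (1 + 0^2 * (1 / 2) * (l^2 + 0^2 * - (l ^ 4))) / (l + l) = - (3 / 4) * l ^ 3"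
    using l by (simp add: field_simps power2_eq_square power3_eq_cube power4_eq_xxxx)
  finally show ?thesis
  proof (rule Lim_transform_eventually)
    have "\<forall>\<^sub>F s in at (0::real). s \<noteq> 0" by (simp add: eventually_at_filter)
    then show "\<forall>\<^sub>F s in at 0. g s = (lam s - l) / s^2"
      using a order_tendstoD(1)[OF lam l]
    proof eventually_elim
      case (elim s)
      define A where "A = 1 / (a s)^2"
      have as: "a s > 0" "(a s)^2 = 1 / (lam s)^2 - s^2 * I s" using elim by blast+
      have A: "A > 0" using as(1) by (simp add: A_def)
      have T_A: "l^2 + s^2 * T s = A" using elim(1) by (simp add: T_def A_def)
      have lamA: "1 / (lam s)^2 = 1 / A + s^2 * I s" using as(2) by (simp add: A_def)
      then have D: "1 + s^2 * I s * A = A / (lam s)^2"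
        using A by (simp add: field_simps) (simp add: divide_inverse algebra_simps)?
      have "T s - I s * l^2 * A = (A - l^2 * (1 + s^2 * I s * A)) / s^2"
        using elim T_A by (simp add: field_simps)
      also have "\<dots> = A * ((lam s)^2 - l^2) / (lam s)^2 / s^2"
        unfolding D using elim by (simp add: field_simps)
      finally have "(T s - I s * l^2 * A) / (1 + s^2 * I s * A) = ((lam s)^2 - l^2) / s^2"
        unfolding D using A elim by simp
      then have "g s = ((lam s)^2 - l^2) / s^2 / (lam s + l)"
        unfolding g_def T_A by simp
      also have "(lam s)^2 - l^2 = (lam s - l) * (lam s + l)" by (simp add: power2_eq_square algebra_simps)
      finally show ?case using elim l by simp
    qed
  qed
qed

theorem theorem6p4:
  fixes \<alpha> \<delta> :: real and l :: nat
    and \<rho> :: "real \<Rightarrow> (real \<Rightarrow> real)" and lam :: "real \<Rightarrow> real"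
  assumes "0 < \<alpha>" and "\<alpha> < 1" and "l \<ge> 1"
    and "bifurcation_branch \<alpha> l \<delta> \<rho> lam"
  shows "deriv lam 0 = 0 \<and> deriv (deriv lam) 0 < 0
    \<and> (\<forall>\<mu>. perturbed_eigenvalue \<alpha> \<delta> \<rho> lam \<mu> \<longrightarrow>
          (\<exists>\<epsilon>>0. \<forall>s. 0 < \<bar>s\<bar> \<and> \<bar>s\<bar> < \<epsilon> \<longrightarrow> \<mu> s > 0))"
proof -
  note \<alpha> = assms(1,2) and l = assms(3) and br = assms(4)
  have \<delta>: "\<delta> > 0" and lam_ana: "real_analytic_on {-\<delta><..<\<delta>} lam" and lam0: "lam 0 = real l"
    using br by (auto simp: bifurcation_branch_def)
  have lam_pos: "lam s > 0" and dom: "\<rho> s \<in> G_bar_dom \<alpha> (lam s)" and sol: "G_bar \<alpha> (\<rho> s) (lam s) = (\<lambda>x. 0)"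
    if "\<bar>s\<bar> < \<delta>" for s
    using br that by (auto simp: bifurcation_branch_def abs_less_iff)
  obtain u U where uU: "(\<forall>s. u s \<in> Ck_circle 4 \<and> (u s has_integral 0) {-pi..pi}) \<and> U \<in> Ck_circle 4
    \<and> (\<forall>s. 0 < \<bar>s\<bar> \<and> \<bar>s\<bar> < \<delta> \<longrightarrow> \<rho> s = (\<lambda>x. s * (cos (real l * x) + s * u s x)))
    \<and> (\<forall>j\<le>4. \<exists>C. \<forall>\<^sub>F s in at 0. \<forall>x. \<bar>(deriv ^^ j) (u s) x - (deriv ^^ j) U x\<bar> \<le> C * \<bar>s\<bar>)"
    using branch_expansion[OF \<alpha> br] by (elim exE)
  have uk: "u s \<in> Ck_circle 4" and ui: "(u s has_integral 0) {-pi..pi}" for s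
    using uU by simp_all
  have Uk: "U \<in> Ck_circle 4" using uU by simp
  have \<rho>: "\<rho> s = (\<lambda>x. s * (cos (real l * x) + s * u s x))" if "0 < \<bar>s\<bar>" "\<bar>s\<bar> < \<delta>" for s
    using uU that by blast
  have close: "\<exists>C. \<forall>\<^sub>F s in at 0. \<forall>x. \<bar>(deriv ^^ j) (u s) x - (deriv ^^ j) U x\<bar> \<le> C * \<bar>s\<bar>" if "j \<le> 4" for j
    using uU that by blast
  have ulim_u: "ulim (\<lambda>s. (deriv ^^ j) (u s)) ((deriv ^^ j) U)" if j: "j \<le> 4" for j
  proof -
    obtain C where C: "\<forall>\<^sub>F s in at 0. \<forall>x. \<bar>(deriv ^^ j) (u s) x - (deriv ^^ j) U x\<bar> \<le> C * \<bar>s\<bar>"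
      using close[OF j] by blast
    have "((\<lambda>s. C * \<bar>s\<bar>) \<longlongrightarrow> C * \<bar>0\<bar>) (at (0::real))" by (intro tendsto_intros)
    then have C0: "((\<lambda>s. C * \<bar>s\<bar>) \<longlongrightarrow> 0) (at (0::real))" by simp
    have "uniform_limit {-pi..pi} (\<lambda>s. (deriv ^^ j) (u s)) ((deriv ^^ j) U) (at 0)"
    proof (rule uniform_limitI)
      fix e :: real assume "e > 0"
      from C order_tendstoD(2)[OF C0 this]
      show "\<forall>\<^sub>F s in at 0. \<forall>x\<in>{-pi..pi}. dist ((deriv ^^ j) (u s) x) ((deriv ^^ j) U x) < e"
        by eventually_elim (auto simp: dist_real_def intro: le_less_trans)
    qed
    then show ?thesis
      using Ck_circle_continuous[OF uk j] Ck_circle_continuous[OF Uk j] by (simp add: ulim_def)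
  qed
  define a where "a = (\<lambda>s. lift_mean (lam s) (\<rho> s))"
  define I where "I = (\<lambda>s. 1 / (2 * pi) * integral {-pi..pi} (\<lambda>x. (cos (real l * x) + s * u s x)^2))"
  have near: "\<forall>\<^sub>F s in at (0::real). 0 < \<bar>s\<bar> \<and> \<bar>s\<bar> < \<delta>"
    unfolding eventually_at using \<delta> by (intro exI[of _ \<delta>]) auto
  have a_facts: "a s > 0 \<and> (a s)^2 = 1 / (lam s)^2 - s^2 * I s" if "0 < \<bar>s\<bar>" "\<bar>s\<bar> < \<delta>" for s
  proof -
    have "integral {-pi..pi} (\<lambda>x. (\<rho> s x)^2) = s^2 * integral {-pi..pi} (\<lambda>x. (cos (real l * x) + s * u s x)^2)"
      unfolding \<rho>[OF that] power_mult_distrib by simp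
    then show ?thesis
      using G_bar_dom_lift(3,4)[OF \<alpha> lam_pos dom, of s] that by (simp add: a_def I_def)
  qed
  have lam_lim: "(lam \<longlongrightarrow> real l) (at 0)"
    using real_analytic_expansion(1)[OF lam_ana \<delta>] by (simp add: lam0)
  have l0: "real l > 0" using l by simp
  have "ulim (\<lambda>s x. (cos (real l * x) + s * u s x)^2) (\<lambda>x. (cos (real l * x) + 0 * U x)^2)"
    using ulim_u[of 0] by (intro ulim_power ulim_add ulim_mult ulim_fun ulim_scalar tendsto_ident_at continuous_intros) simp
  from ulim_integral[OF this] have "((\<lambda>s. integral {-pi..pi} (\<lambda>x. (cos (real l * x) + s * u s x)^2)) \<longlongrightarrow> pi) (at 0)"
    using integral_unique[OF trig_integrals(2)[OF l]] by simp
  then have "(I \<longlongrightarrow> 1 / (2 * pi) * pi) (at 0)" unfolding I_def by (intro tendsto_intros)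
  then have I_lim: "(I \<longlongrightarrow> 1 / 2) (at 0)" by simp
  have "((\<lambda>s. sqrt (1 / (lam s)^2 - s^2 * I s)) \<longlongrightarrow> sqrt (1 / (real l)^2 - 0^2 * (1 / 2))) (at 0)"
    using l0 by (intro tendsto_intros lam_lim I_lim tendsto_ident_at) auto
  moreover have "sqrt (1 / (real l)^2 - 0^2 * (1 / 2)) = 1 / real l" by (simp add: real_sqrt_divide)
  moreover have "\<forall>\<^sub>F s in at 0. sqrt (1 / (lam s)^2 - s^2 * I s) = a s"
    using near
  proof eventually_elim
    case (elim s)
    then show ?case using a_facts[of s] by (simp flip: a_facts)
  qed
  ultimately have a_lim: "(a \<longlongrightarrow> 1 / real l) (at 0)" by (auto intro: Lim_transform_eventually)
  interpret P: bifurcating_profile l a u "\<lambda>s. deriv (u s)" "\<lambda>s. deriv (deriv (u s))" U "deriv U" "deriv (deriv U)"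
  proof
    show "ulim u U" "ulim (\<lambda>s. deriv (u s)) (deriv U)" "ulim (\<lambda>s. deriv (deriv (u s))) (deriv (deriv U))"
      using ulim_u[of 0] ulim_u[of 1] ulim_u[of 2] by (simp_all add: numeral_2_eq_2)
    show "(u s has_real_derivative deriv (u s) x) (at x)" "(deriv (u s) has_real_derivative deriv (deriv (u s)) x) (at x)" for s x
      using Ck4_derivs[OF uk] by auto
    show "u s pi = u s (-pi)" for s
      using Ck_circle_periodic[OF uk, of 0 s "-pi"] by simp
  qed (fact l a_lim ui)+
  have r_eq: "P.r s = (\<lambda>x. \<rho> s x + a s)" if "0 < \<bar>s\<bar>" "\<bar>s\<bar> < \<delta>" for s
    using \<rho>[OF that] by (simp add: P.r_def P.c_def add.commute)
  have \<rho>X: "\<rho> s \<in> little_holder0_even 4 \<alpha>" if "\<bar>s\<bar> < \<delta>" for s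
    using dom[OF that] by (simp add: G_bar_dom_def)
  have weak: "\<forall>\<^sub>F s in at 0. ((\<lambda>x. P.c x / (P.r s x * P.q s x) + P.c1 x * P.p s x / P.q s x) has_integral 0) {-pi..pi}"
    using near
  proof eventually_elim
    case (elim s)
    have rk: "P.r s \<in> Ck_circle 4"
      using elim little_holder0_evenD(2)[OF \<rho>X \<alpha>] by (simp add: r_eq Ck_circle_add_const)
    have pos: "P.r s x > 0" for x
    proof -
      have "\<rho> s x + a s > 0" using G_bar_dom_lift(2)[OF \<alpha> lam_pos dom] elim unfolding a_def by blast
      then show ?thesis using elim by (simp add: r_eq)
    qed
    have "mean_curv (P.r s) x = mean_curv (P.r s) 0" for x
    proof (rule equilibrium_mean_curv_const[OF rk pos])
      show "P.r s (- x) = P.r s x" for x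
        using elim little_holder0_evenD(3)[OF \<rho>X \<alpha>] by (simp add: r_eq)
      show "P0 (G_op (P.r s)) = (\<lambda>x. 0)"
      proof -
        have "P0 (G_op (\<lambda>x. \<rho> s x + a s)) = (\<lambda>x. 0)"
          using elim sol[of s] G_bar_dom_lift(1)[OF \<alpha> lam_pos dom, of s] unfolding a_def by simp
        then show ?thesis using elim by (simp add: r_eq)
      qed
    qed
    from cmc_weak_form[OF rk pos this l] show ?case
      by (simp add: P.deriv_r P.c_def P.c1_def)
  qed
  note tau = P.tau_asymptotics[OF weak]
  have "((\<lambda>s. (lam s - real l) / s^2) \<longlongrightarrow> - (3 / 4) * real l ^ 3) (at 0)"
  proof (rule lambda_expansion[OF l0 lam_lim I_lim])
    show "((\<lambda>s. (1 / (a s)^2 - (real l)^2) / s^2) \<longlongrightarrow> - (real l ^ 4)) (at 0)"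
      using tau unfolding P.\<tau>_def .
    show "\<forall>\<^sub>F s in at 0. a s > 0 \<and> (a s)^2 = 1 / (lam s)^2 - s^2 * I s"
      using near by eventually_elim (rule a_facts; blast)
  qed
  then have "deriv lam 0 = 0 \<and> deriv (deriv lam) 0 = 2 * (- (3 / 4) * real l ^ 3)"
    using real_analytic_expansion(2)[OF lam_ana \<delta>] by (simp add: lam0)
  moreover have "2 * (- (3 / 4) * real l ^ 3) < 0" using l0 by simp
  moreover have "\<exists>\<epsilon>>0. \<forall>s. 0 < \<bar>s\<bar> \<and> \<bar>s\<bar> < \<epsilon> \<longrightarrow> \<mu> s > 0" if pe: "perturbed_eigenvalue \<alpha> \<delta> \<rho> lam \<mu>" for \<mu>
  proof -
    obtain \<eta> where \<eta>: "\<eta> > 0" "\<eta> \<le> \<delta>" and cont: "continuous_on {-\<eta><..<\<eta>} \<mu>" and \<mu>0: "\<mu> 0 = 0"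
      and eig: "\<And>s. s \<in> {-\<eta><..<\<eta>} \<Longrightarrow> \<exists>A. has_D1_G_bar \<alpha> (\<rho> s) (lam s) A \<and> eigenvalue_on (little_holder0_even 4 \<alpha>) A (\<mu> s)"
      using pe unfolding perturbed_eigenvalue_def by blast
    have "isCont \<mu> 0" using cont \<eta>(1) by (simp add: continuous_on_eq_continuous_at)
    then have \<mu>_lim: "(\<mu> \<longlongrightarrow> 0) (at 0)" by (simp add: isCont_def \<mu>0)
    have near': "\<forall>\<^sub>F s in at (0::real). 0 < \<bar>s\<bar> \<and> \<bar>s\<bar> < \<eta>"
      unfolding eventually_at using \<eta> by (intro exI[of _ \<eta>]) auto
    have "\<forall>\<^sub>F s in at 0. \<exists>v v1 v2 R K k. P.eigen_data s (\<mu> s) v v1 v2 R K k"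
      using near'
    proof eventually_elim
      case (elim s)
      then have s: "0 < \<bar>s\<bar>" "\<bar>s\<bar> < \<delta>" using \<eta> by auto
      obtain A w where A: "has_D1_G_bar \<alpha> (\<rho> s) (lam s) A" and w: "w \<in> little_holder0_even 4 \<alpha>"
        and w0: "w \<noteq> (\<lambda>x. 0)" and Aw: "A w = (\<lambda>x. \<mu> s * w x)"
        using eig[of s] elim by (auto simp: eigenvalue_on_def abs_less_iff)
      define b where "b = - integral {-pi..pi} (\<lambda>x. \<rho> s x * w x) / (2 * pi * a s)"
      define v where "v = (\<lambda>x. w x + b)"
      have v_alt: "v = (\<lambda>x. w x - integral {-pi..pi} (\<lambda>x. \<rho> s x * w x) / (2 * pi * lift_mean (lam s) (\<rho> s)))"
        by (simp add: v_def b_def a_def)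
      have r_alt: "P.r s = (\<lambda>x. \<rho> s x + lift_mean (lam s) (\<rho> s))" using r_eq[OF s] by (simp only: a_def)
      have "\<exists>R K. (\<forall>x. (R has_real_derivative P.r s x * v x) (at x)) \<and> R 0 = 0
        \<and> (\<forall>x. (K has_real_derivative line_elem (P.r s) x / P.r s x * R x) (at x)) \<and> K 0 = 0
        \<and> (\<forall>x\<in>{-pi..pi}. linearized_mean_curv (P.r s) v x = linearized_mean_curv (P.r s) v 0 + \<mu> s * K x)"
        unfolding r_alt v_alt by (rule eigen_equation[OF \<alpha> lam_pos[OF s(2)] A sol[OF s(2)] w Aw])
      then obtain R K where RK: "\<forall>x. (R has_real_derivative P.r s x * v x) (at x)" "R 0 = 0"
        "\<forall>x. (K has_real_derivative P.q s x / P.r s x * R x) (at x)" "K 0 = 0"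
        "\<forall>x\<in>{-pi..pi}. linearized_mean_curv (P.r s) v x = linearized_mean_curv (P.r s) v 0 + \<mu> s * K x"
        unfolding P.deriv_r by blast
      note wD = little_holder0_evenD[OF w \<alpha>] and \<rho>D = little_holder0_evenD[OF \<rho>X[OF s(2)] \<alpha>]
      have vk: "v \<in> Ck_circle 4" unfolding v_def by (rule Ck_circle_add_const[OF wD(2)])
      have veven: "v (- x) = v x" for x by (simp add: v_def wD(3))
      have vodd: "deriv v (- x) = - deriv v x" for x
        using even_deriv[of v, OF veven Ck4_derivs(1)[OF vk]] .
      have vper: "deriv v pi = deriv v (- pi)" "v pi = v (- pi)"
        using Ck_circle_periodic[OF vk, of 1 "-pi"] Ck_circle_periodic[OF vk, of 0 "-pi"] by simp_all
      \<comment> \<open>At pi, oddness and periodicity of the derivative give opposite and equal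
        values at the two end points.\<close>
      have v1: "deriv v 0 = 0" "deriv v pi = 0" "deriv v (- pi) = 0"
        using vodd[of 0] vodd[of pi] vper(1) by auto
      have cont: "continuous_on {-pi..pi} (\<rho> s)" "continuous_on {-pi..pi} w"
        using Ck_circle_continuous[OF \<rho>D(2), of 0] Ck_circle_continuous[OF wD(2), of 0] by auto
      \<comment> \<open>Expansion of (\<rho> + a) (w + b): the mixed terms integrate to 0, and
        \<open>b\<close> is chosen so that the other two cancel. This is the linearized volume
        constraint.\<close>
      have "((\<lambda>x. \<rho> s x * w x + \<rho> s x * b + a s * w x + a s * b) has_integral
          integral {-pi..pi} (\<lambda>x. \<rho> s x * w x) + 0 * b + a s * 0 + (pi - (-pi)) *\<^sub>R (a s * b)) {-pi..pi}"
        using has_integral_const_real[of "a s * b" "-pi" pi]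
        by (intro has_integral_add has_integral_mult_left has_integral_mult_right \<rho>D wD integrable_integral
            integrable_continuous_real continuous_intros cont) simp
      moreover have "integral {-pi..pi} (\<lambda>x. \<rho> s x * w x) + 0 * b + a s * 0 + (pi - (-pi)) *\<^sub>R (a s * b) = 0"
        using a_facts[OF s] by (simp add: b_def)
      ultimately have rv: "((\<lambda>x. P.r s x * v x) has_integral 0) {-pi..pi}"
        by (simp add: r_eq[OF s] v_def algebra_simps)
      \<comment> \<open>Adding \<open>b\<close> cannot annihilate the eigenfunction:
        \<open>w\<close> would be constant on a period, and its mean is zero.\<close>
      have nz: "\<exists>x\<in>{-pi..pi}. v x \<noteq> 0"
      proof (rule ccontr)
        assume "\<not> ?thesis"
        then have wb: "w x = - b" if "x \<in> {-pi..pi}" for x using that by (force simp: v_def)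
        have "((\<lambda>x. - b) has_integral 0) {-pi..pi}"
          using wD(4) by (rule has_integral_eq[rotated]) (rule wb)
        from has_integral_unique[OF this has_integral_const_real] have b0: "b = 0" by simp
        have "w x = 0" for x
        proof -
          obtain k :: int where "x + of_int k * (2 * pi) \<in> {-pi..pi}" using periodic_reduce by blast
          moreover have "w (x + of_int k * (2 * pi)) = w x"
            by (rule periodic_int) (use Ck_circle_periodic[OF wD(2), of 0] in simp)
          ultimately show ?thesis using wb b0 by force
        qed
        then show False using w0 by auto
      qed
      have dv: "\<forall>x. (v has_real_derivative deriv v x) (at x)" "\<forall>x. (deriv v has_real_derivative deriv (deriv v) x) (at x)"
        using Ck4_derivs[OF vk] by simp_all
      have cv: "continuous_on {-pi..pi} (deriv (deriv v))"
        using Ck_circle_continuous[OF vk, of 2] by (simp add: numeral_2_eq_2)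
      have "P.eigen_data s (\<mu> s) v (deriv v) (deriv (deriv v)) R K (linearized_mean_curv (P.r s) v 0)"
        unfolding P.eigen_data_def P.linearization_deriv
        by (intro conjI dv cv v1 vper(2) RK rv nz)
      then show ?case by blast
    qed
    from P.eigenvalue_positive[OF tau \<mu>_lim this] show ?thesis
      unfolding eventually_at by (auto simp: dist_real_def)
  qed
  ultimately show ?thesis by auto
qed

end
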